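(* Let $n\ge 2$ and let $x: M^n\rightarrow \mathbb{R}^{n+1}_{1}$ be a complete space-like self-shrinker with weight $s=\langle x, x\rangle$, i.e. a complete space-like hypersurface with $H-\langle x,x\rangle\langle x,N\rangle=0$ on $M^n$. If $S-\frac{H^{2}}{n}$ is constant and $$4A^{2}-\frac{4HA}{n}+\left(S-\frac{H^{2}}{n}\right)I\geq 0,$$ then $x$ is isometric to either the hyperbolic space $\mathbb{H}^{n}\left(-\frac1{\sqrt{n}}\right)\subset\mathbb{R}^{n+1}_{1}$ or the hyperplane $\mathbb{R}^{n}\subset\mathbb{R}^{n+1}_{1}$.
   Context: $\mathbb{R}^{n+1}_1$ is $\mathbb{R}^{n+1}$ with the Lorentzian product $\langle X,Y\rangle=X_1Y_1+\cdots+X_nY_n-X_{n+1}Y_{n+1}$. A space-like hypersurface is an immersion $x:M^n\to\mathbb{R}^{n+1}_1$ of a connected $n$-manifold whose induced metric is Riemannian; it is complete if the induced metric is complete. The letter $x$ also denotes the position vector. $N$ is a smooth unit normal field, $\langle N,N\rangle=-1$. In a local orthonormal tangent frame $e_1,\dots,e_n$ the second fundamental form is $h_{ij}=\langle dN(e_i),e_j\rangle$; $A$ is the shape operator (with matrix $(h_{ij})$), $I$ the identity map of the tangent spaces, $H=\sum_i h_{ii}$ the mean curvature (no factor $1/n$) and $S=\sum_{i,j}h_{ij}^2$ the squared norm of the second fundamental form. An inequality $T\ge0$ for a self-adjoint endomorphism $T$ of the tangent bundle means $T$ is positive semidefinite at each point. For $c=-r^{-2}$ with $r>0$, $\mathbb{H}^n(c)=\{x\in\mathbb{R}^{n+1}_1:\langle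 x,x\rangle=-r^2,\ x_{n+1}>0\}$ (sectional curvature $c$); $\mathbb{R}^n\subset\mathbb{R}^{n+1}_1$ denotes a space-like hyperplane. "Isometric to" one of these hypersurfaces means coinciding with it up to an isometry of $\mathbb{R}^{n+1}_1$. *)

theory Defs
  imports "HOL-Analysis.Analysis"
begin

primrec k_smooth_on ::
  "nat \<Rightarrow> 'a::real_normed_vector set \<Rightarrow> ('a \<Rightarrow> 'b::real_normed_vector) \<Rightarrow> bool" where
  "k_smooth_on 0 S f \<longleftrightarrow> continuous_on S f"
| "k_smooth_on (Suc k) S f \<longleftrightarrow>
     (\<forall>x\<in>S. f differentiable (at x)) \<and>
     (\<forall>v. k_smooth_on k S (\<lambda>x. frechet_derivative f (at x) v))"

text \<open>For open sets \<open>S\<close> in a finite-dimensional space this is the class \<open>C\<^sup>\<infinity>\<close>.\<close>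

definition smooth_on :: "'a::real_normed_vector set \<Rightarrow> ('a \<Rightarrow> 'b::real_normed_vector) \<Rightarrow> bool" where
  "smooth_on S f \<longleftrightarrow> (\<forall>k. k_smooth_on k S f)"

text \<open>A chart is a pair of its domain and the coordinate map. The dimension of the manifold
  is \<open>CARD('n)\<close>. Atlases need not be maximal.\<close>

type_synonym ('m, 'n) chart = "'m set \<times> ('m \<Rightarrow> real ^ 'n)"

definition is_chart :: "'m topology \<Rightarrow> ('m, 'n::finite) chart \<Rightarrow> bool" where
  "is_chart M = (\<lambda>(U, \<phi>). openin M U \<and> open (\<phi> ` U) \<and>
     homeomorphic_map (subtopology M U) (top_of_set (\<phi> ` U)) \<phi>)"

definition smooth_atlas :: "'m topology \<Rightarrow> ('m, 'n::finite) chart set \<Rightarrow> bool" where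
  "smooth_atlas M \<A> \<longleftrightarrow>
     (\<forall>c\<in>\<A>. is_chart M c) \<and> (\<Union>(U, \<phi>)\<in>\<A>. U) = topspace M \<and>
     (\<forall>(U, \<phi>)\<in>\<A>. \<forall>(V, \<psi>)\<in>\<A>. smooth_on (\<phi> ` (U \<inter> V)) (\<psi> \<circ> inv_into U \<phi>))"

definition smooth_manifold :: "'m topology \<Rightarrow> ('m, 'n::finite) chart set \<Rightarrow> bool" where
  "smooth_manifold M \<A> \<longleftrightarrow> Hausdorff_space M \<and> second_countable M \<and> smooth_atlas M \<A>"

definition smooth_map :: "('m, 'n::finite) chart set \<Rightarrow> ('m \<Rightarrow> 'b::real_normed_vector) \<Rightarrow> bool" where
  "smooth_map \<A> f \<longleftrightarrow> (\<forall>(U, \<phi>)\<in>\<A>. smooth_on (\<phi> ` U) (f \<circ> inv_into U \<phi>))"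

text \<open>The tangent space at \<open>p\<close> is identified with \<open>\<real>\<^sup>n\<close> through one chosen chart around \<open>p\<close>.
  Different points may get unrelated charts; all tensors below are only used pointwise, and
  everything derived from them is independent of the choice.\<close>

definition chart_at :: "('m, 'n::finite) chart set \<Rightarrow> 'm \<Rightarrow> ('m, 'n) chart" where
  "chart_at \<A> p = (SOME c. c \<in> \<A> \<and> p \<in> fst c)"

definition differential ::
  "('m, 'n::finite) chart set \<Rightarrow> ('m \<Rightarrow> 'b::real_normed_vector) \<Rightarrow> 'm \<Rightarrow> real ^ 'n \<Rightarrow> 'b" where
  "differential \<A> f p =
     (case chart_at \<A> p of (U, \<phi>) \<Rightarrow> frechet_derivative (f \<circ> inv_into U \<phi>) (at (\<phi> p)))"

definition velocity :: "('m, 'n::finite) chart set \<Rightarrow> (real \<Rightarrow> 'm) \<Rightarrow> real \<Rightarrow> real ^ 'n" where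
  "velocity \<A> \<gamma> t =
     (case chart_at \<A> (\<gamma> t) of (U, \<phi>) \<Rightarrow> vector_derivative (\<phi> \<circ> \<gamma>) (at t))"

text \<open>The library's \<open>piecewise_C1_differentiable_on\<close> allows the derivative to be unbounded near
  break points, where the length integral may fail to exist (and then has the value \<open>0\<close>). Here
  the curve is \<open>C\<^sup>1\<close> with one-sided derivatives on each closed piece; \<open>T\<close> contains the break
  points.\<close>

definition piecewise_C1_curve ::
  "'m topology \<Rightarrow> ('m, 'n::finite) chart set \<Rightarrow> (real \<Rightarrow> 'm) \<Rightarrow> bool" where
  "piecewise_C1_curve M \<A> \<gamma> \<longleftrightarrow>
     continuous_map (top_of_set {0..1}) M \<gamma> \<and>
     (\<exists>T. finite T \<and>
       (\<forall>(U, \<phi>)\<in>\<A>. \<forall>a b. 0 \<le> a \<and> a < b \<and> b \<le> 1 \<and> {a<..<b} \<inter> T = {} \<and> \<gamma> ` {a..b} \<subseteq> U \<longrightarrow>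
         (\<exists>D. continuous_on {a..b} D \<and>
           (\<forall>t\<in>{a..b}. ((\<phi> \<circ> \<gamma>) has_vector_derivative D t) (at t within {a..b})))))"

text \<open>The last component is the time-like coordinate \<open>X\<^sub>n\<^sub>+\<^sub>1\<close>.\<close>

type_synonym 'n lorentz_space = "(real ^ 'n) \<times> real"

definition lorentz :: "'n::finite lorentz_space \<Rightarrow> 'n lorentz_space \<Rightarrow> real"
    ("\<langle>_, _\<rangle>\<^sub>L") where
  "\<langle>X, Y\<rangle>\<^sub>L = fst X \<bullet> fst Y - snd X * snd Y"

definition lorentz_isometry :: "('n::finite lorentz_space \<Rightarrow> 'n lorentz_space) \<Rightarrow> bool" where
  "lorentz_isometry F \<longleftrightarrow>
     (\<exists>L b. linear L \<and> (\<forall>X Y. \<langle>L X, L Y\<rangle>\<^sub>L = \<langle>X, Y\<rangle>\<^sub>L) \<and> F = (\<lambda>X. L X + b))"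

text \<open>For \<open>c = - 1 / r\<^sup>2\<close> the equation is \<open>\<langle>X, X\<rangle>\<^sub>L = - r\<^sup>2\<close>.\<close>

definition hyperbolic_space :: "real \<Rightarrow> 'n::finite lorentz_space set" where
  "hyperbolic_space c = {X. \<langle>X, X\<rangle>\<^sub>L = 1 / c \<and> snd X > 0}"

text \<open>All space-like affine hyperplanes are images of this one under Lorentz isometries.\<close>

definition spacelike_hyperplane :: "'n::finite lorentz_space set" where
  "spacelike_hyperplane = {X. snd X = 0}"

definition induced_metric ::
  "('m, 'n::finite) chart set \<Rightarrow> ('m \<Rightarrow> 'n lorentz_space) \<Rightarrow> 'm \<Rightarrow> real ^ 'n \<Rightarrow> real ^ 'n \<Rightarrow> real" where
  "induced_metric \<A> x p v w = \<langle>differential \<A> x p v, differential \<A> x p w\<rangle>\<^sub>L"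

definition spacelike_immersion ::
  "'m topology \<Rightarrow> ('m, 'n::finite) chart set \<Rightarrow> ('m \<Rightarrow> 'n lorentz_space) \<Rightarrow> bool" where
  "spacelike_immersion M \<A> x \<longleftrightarrow> smooth_map \<A> x \<and>
     (\<forall>p\<in>topspace M. inj (differential \<A> x p) \<and> (\<forall>v. v \<noteq> 0 \<longrightarrow> induced_metric \<A> x p v v > 0))"

definition curve_length ::
  "('m, 'n::finite) chart set \<Rightarrow> ('m \<Rightarrow> 'n lorentz_space) \<Rightarrow> (real \<Rightarrow> 'm) \<Rightarrow> real" where
  "curve_length \<A> x \<gamma> =
     integral {0..1} (\<lambda>t. sqrt (induced_metric \<A> x (\<gamma> t) (velocity \<A> \<gamma> t) (velocity \<A> \<gamma> t)))"

text \<open>The value \<open>0\<close> off the manifold is needed because \<open>Metric_space\<close> requires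
  nonnegativity of the distance function everywhere.\<close>

definition induced_dist ::
  "'m topology \<Rightarrow> ('m, 'n::finite) chart set \<Rightarrow> ('m \<Rightarrow> 'n lorentz_space) \<Rightarrow> 'm \<Rightarrow> 'm \<Rightarrow> real" where
  "induced_dist M \<A> x p q =
     (if p \<in> topspace M \<and> q \<in> topspace M
      then Inf {curve_length \<A> x \<gamma> |\<gamma>. piecewise_C1_curve M \<A> \<gamma> \<and> \<gamma> 0 = p \<and> \<gamma> 1 = q}
      else 0)"

definition complete_hypersurface ::
  "'m topology \<Rightarrow> ('m, 'n::finite) chart set \<Rightarrow> ('m \<Rightarrow> 'n lorentz_space) \<Rightarrow> bool" where
  "complete_hypersurface M \<A> x \<longleftrightarrow> Metric_space.mcomplete (topspace M) (induced_dist M \<A> x)"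

definition unit_normal_field ::
  "'m topology \<Rightarrow> ('m, 'n::finite) chart set \<Rightarrow> ('m \<Rightarrow> 'n lorentz_space) \<Rightarrow>
   ('m \<Rightarrow> 'n lorentz_space) \<Rightarrow> bool" where
  "unit_normal_field M \<A> x N \<longleftrightarrow> smooth_map \<A> N \<and>
     (\<forall>p\<in>topspace M. \<langle>N p, N p\<rangle>\<^sub>L = -1 \<and> (\<forall>v. \<langle>N p, differential \<A> x p v\<rangle>\<^sub>L = 0))"

definition second_fundamental_form ::
  "('m, 'n::finite) chart set \<Rightarrow> ('m \<Rightarrow> 'n lorentz_space) \<Rightarrow> ('m \<Rightarrow> 'n lorentz_space) \<Rightarrow>
   'm \<Rightarrow> real ^ 'n \<Rightarrow> real ^ 'n \<Rightarrow> real" where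
  "second_fundamental_form \<A> x N p v w = \<langle>differential \<A> N p v, differential \<A> x p w\<rangle>\<^sub>L"

definition shape_operator ::
  "('m, 'n::finite) chart set \<Rightarrow> ('m \<Rightarrow> 'n lorentz_space) \<Rightarrow> ('m \<Rightarrow> 'n lorentz_space) \<Rightarrow>
   'm \<Rightarrow> real ^ 'n \<Rightarrow> real ^ 'n" where
  "shape_operator \<A> x N p v =
     (THE w. \<forall>u. induced_metric \<A> x p w u = second_fundamental_form \<A> x N p v u)"

definition orthonormal_frame ::
  "('m, 'n::finite) chart set \<Rightarrow> ('m \<Rightarrow> 'n lorentz_space) \<Rightarrow> 'm \<Rightarrow> ('n \<Rightarrow> real ^ 'n) \<Rightarrow> bool" where
  "orthonormal_frame \<A> x p e \<longleftrightarrow>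
     (\<forall>i j. induced_metric \<A> x p (e i) (e j) = (if i = j then 1 else 0))"

text \<open>\<open>H\<close> and \<open>S\<close> do not depend on the orthonormal frame that is picked.\<close>

definition mean_curvature ::
  "('m, 'n::finite) chart set \<Rightarrow> ('m \<Rightarrow> 'n lorentz_space) \<Rightarrow> ('m \<Rightarrow> 'n lorentz_space) \<Rightarrow>
   'm \<Rightarrow> real" where
  "mean_curvature \<A> x N p =
     (let e = (SOME e. orthonormal_frame \<A> x p e)
      in \<Sum>i\<in>UNIV. second_fundamental_form \<A> x N p (e i) (e i))"

definition sq_norm_sff ::
  "('m, 'n::finite) chart set \<Rightarrow> ('m \<Rightarrow> 'n lorentz_space) \<Rightarrow> ('m \<Rightarrow> 'n lorentz_space) \<Rightarrow>
   'm \<Rightarrow> real" where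
  "sq_norm_sff \<A> x N p =
     (let e = (SOME e. orthonormal_frame \<A> x p e)
      in \<Sum>i\<in>UNIV. \<Sum>j\<in>UNIV. (second_fundamental_form \<A> x N p (e i) (e j))\<^sup>2)"

definition endo_nonneg ::
  "('m, 'n::finite) chart set \<Rightarrow> ('m \<Rightarrow> 'n lorentz_space) \<Rightarrow> 'm \<Rightarrow> (real ^ 'n \<Rightarrow> real ^ 'n) \<Rightarrow> bool" where
  "endo_nonneg \<A> x p T \<longleftrightarrow> (\<forall>v. induced_metric \<A> x p (T v) v \<ge> 0)"

text \<open>A Lorentz isometry followed after \<open>x\<close> maps \<open>M\<close> homeomorphically onto \<open>P\<close>. For an immersion
  \<open>x\<close> and a smooth hypersurface \<open>P\<close> such a map is a diffeomorphism, and it preserves the induced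
  metrics.\<close>

definition isometric_to ::
  "'m topology \<Rightarrow> ('m \<Rightarrow> 'n::finite lorentz_space) \<Rightarrow> 'n lorentz_space set \<Rightarrow> bool" where
  "isometric_to M x P \<longleftrightarrow>
     (\<exists>F. lorentz_isometry F \<and> homeomorphic_map M (top_of_set P) (F \<circ> x))"

end

theory Submission
  imports Defs
begin

text \<open>Write \<open>T = A - (H/n) I\<close>. On a self-shrinker with weight \<open>s = \<langle>x, x\<rangle>\<^sub>L\<close> the Simons identity gives
  \<open>\<Delta>|T|\<^sup>2/2 - s \<langle>x, \<nabla>|T|\<^sup>2\<rangle>/2 = |\<nabla>T|\<^sup>2 + \<langle>(4TA + |T|\<^sup>2 I)v, v\<rangle> + (u\<^sup>2 + S)|T|\<^sup>2\<close>, where \<open>v\<close> is the tangential part of \<open>x\<close> and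
  \<open>u = \<langle>x, N\<rangle>\<^sub>L\<close>. If \<open>|T|\<^sup>2\<close> is constant the left side vanishes, and by hypothesis every term on the
  right is nonnegative; as \<open>S \<ge> |T|\<^sup>2\<close>, already one point forces \<open>T = 0\<close>. At that point a Lorentz
  reflection makes \<open>N\<close> vertical, so that the hypersurface is a graph with critical height there
  and the identity becomes a computation with partial derivatives of the height function.
  Umbilicity yields \<open>dN = \<lambda> dx\<close> with \<open>\<lambda>\<close> constant, so \<open>N - \<lambda> x\<close> is constant. Completeness makes
  \<open>M\<close> the graph of an entire function, which turns these local equations into global ones.\<close>

section \<open>Calculus of \<open>C\<^sup>k\<close> maps\<close>

text \<open>Each tangent space comes from its own unrelated chart, and no connection is defined. A
  critical point of a graph avoids both: two scalar equations for the height function, cleared of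
  denominators and differentiated twice there, replace covariant calculus. The reflection that
  creates the critical point is linear. It fixes the origin and so preserves \<open>x\<close> paired
  with itself and with \<open>N\<close>, hence the self-shrinker equation, which a translation would
  destroy. It also tilts the direction of projection, so the theorem on entire graphs is applied
  both to \<open>x\<close> and to its reflected copy. That theorem rests on one inequality: a curve
  in a space-like hypersurface is no longer than its horizontal shadow, so Euclidean Cauchy
  sequences lift to Cauchy sequences and completeness keeps the local inverses of the projection
  from breaking off. The dimension bound enters through the mixed second derivatives of a coordinate
  of \<open>N\<close> in two different directions, which force the principal curvature to be
  constant.\<close>

abbreviation dird :: "'a::real_normed_vector \<Rightarrow> ('a \<Rightarrow> 'b::real_normed_vector) \<Rightarrow> 'a \<Rightarrow> 'b" where
  "dird v f \<equiv> (\<lambda>x. frechet_derivative f (at x) v)"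

lemma frechet_derivative_eqI: "(f has_derivative f') (at x) \<Longrightarrow> frechet_derivative f (at x) = f'"
  using frechet_derivative_at by metis

text \<open>Derivatives at a point of an open set see only nearby values, so agreement on
  \<open>S\<close> passes to all derivatives.\<close>

lemma k_smooth_on_cong:
  assumes "open S" "\<And>x. x \<in> S \<Longrightarrow> f x = g x" "k_smooth_on k S f"
  shows "k_smooth_on k S g"
  using assms(2,3)
proof (induction k arbitrary: f g)
  case 0
  then show ?case using continuous_on_cong by (metis k_smooth_on.simps(1))
next
  case (Suc k)
  have D: "f differentiable (at x)" "frechet_derivative g (at x) = frechet_derivative f (at x)"
    "g differentiable (at x)" if "x \<in> S" for x
  proof -
    show 1: "f differentiable (at x)" using Suc.prems that by simp
    have 2: "(g has_derivative frechet_derivative f (at x)) (at x)"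
      by (rule has_derivative_transform_within_open[OF 1[unfolded frechet_derivative_works] assms(1) that Suc.prems(1)])
    show "frechet_derivative g (at x) = frechet_derivative f (at x)"
      by (rule frechet_derivative_eqI[OF 2])
    show "g differentiable (at x)" using 2 by (rule differentiableI)
  qed
  have "k_smooth_on k S (dird v g)" for v
  proof (rule Suc.IH[of "dird v f"])
    show "k_smooth_on k S (dird v f)" using Suc.prems by simp
    show "dird v f x = dird v g x" if "x \<in> S" for x by (simp only: D(2)[OF that])
  qed
  then show ?case using D by simp
qed

lemma k_smooth_on_local:
  assumes "\<And>x. x \<in> S \<Longrightarrow> \<exists>T. open T \<and> x \<in> T \<and> k_smooth_on k T f"
  shows "k_smooth_on k S f"
  using assms
proof (induction k arbitrary: f)
  case 0
  then show ?case
    by (metis continuous_at_imp_continuous_on continuous_on_eq_continuous_at k_smooth_on.simps(1))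
next
  case (Suc k)
  then show ?case by (fastforce intro!: Suc.IH)
qed

lemma k_smooth_on_Suc_imp: "k_smooth_on (Suc k) S f \<Longrightarrow> k_smooth_on k S f"
proof (induction k arbitrary: f)
  case 0
  then have "f differentiable_on S"
    unfolding differentiable_on_def using differentiable_at_withinI by auto
  then show ?case using differentiable_imp_continuous_on by simp
next
  case (Suc k)
  from Suc.prems have "\<And>v. k_smooth_on (Suc k) S (dird v f)" "\<forall>x\<in>S. f differentiable (at x)"
    by simp_all
  then show ?case using Suc.IH by auto
qed

lemma k_smooth_on_le: "k_smooth_on k S f \<Longrightarrow> m \<le> k \<Longrightarrow> k_smooth_on m S f"
  by (induction k) (use k_smooth_on_Suc_imp le_Suc_eq in blast)+

lemma k_smooth_on_SucI:
  assumes "open S" "\<And>x. x \<in> S \<Longrightarrow> (f has_derivative f' x) (at x)"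
    "\<And>v. k_smooth_on k S (\<lambda>x. f' x v)"
  shows "k_smooth_on (Suc k) S f"
proof -
  have "k_smooth_on k S (dird v f)" for v
    by (rule k_smooth_on_cong[OF assms(1) _ assms(3)[of v]]) (use assms(2) frechet_derivative_eqI in metis)
  then show ?thesis using assms(2) by (auto simp: differentiable_def)
qed

lemma k_smooth_on_SucD:
  assumes "k_smooth_on (Suc k) S f"
  shows "x \<in> S \<Longrightarrow> (f has_derivative frechet_derivative f (at x)) (at x)"
    "k_smooth_on k S (dird v f)"
  using assms frechet_derivative_works by auto

lemma k_smooth_on_const: "k_smooth_on k S (\<lambda>x. c)"
  by (induction k arbitrary: c) auto

lemma k_smooth_on_linear_comp:
  assumes "open S" "bounded_linear L" "k_smooth_on k S f"
  shows "k_smooth_on k S (\<lambda>x. L (f x))"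
  using assms(3)
proof (induction k arbitrary: f)
  case 0
  then show ?case
    by (simp add: bounded_linear.continuous_on[OF assms(2)])
next
  case (Suc k)
  show ?case
    by (rule k_smooth_on_SucI[OF assms(1) bounded_linear.has_derivative[OF assms(2) k_smooth_on_SucD(1)[OF Suc.prems]]])
       (auto intro: Suc.IH k_smooth_on_SucD(2)[OF Suc.prems])
qed

lemma k_smooth_on_add:
  assumes "open S" "k_smooth_on k S f" "k_smooth_on k S g"
  shows "k_smooth_on k S (\<lambda>x. f x + g x)"
  using assms(2,3)
proof (induction k arbitrary: f g)
  case 0
  then show ?case by (simp add: continuous_on_add)
next
  case (Suc k)
  show ?case
    by (rule k_smooth_on_SucI[OF assms(1) has_derivative_add[OF k_smooth_on_SucD(1)[OF Suc.prems(1)] k_smooth_on_SucD(1)[OF Suc.prems(2)]]])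
       (auto intro: Suc.IH k_smooth_on_SucD(2)[OF Suc.prems(1)] k_smooth_on_SucD(2)[OF Suc.prems(2)])
qed

lemma (in bounded_bilinear) k_smooth_on:
  assumes "open S" "k_smooth_on k S f" "k_smooth_on k S g"
  shows "k_smooth_on k S (\<lambda>x. prod (f x) (g x))"
  using assms(2,3)
proof (induction k arbitrary: f g)
  case 0
  then show ?case by (simp add: continuous_on)
next
  case (Suc k)
  show ?case
    by (rule k_smooth_on_SucI[OF assms(1) FDERIV[OF k_smooth_on_SucD(1)[OF Suc.prems(1)] k_smooth_on_SucD(1)[OF Suc.prems(2)]]])
       (auto intro!: k_smooth_on_add[OF assms(1)] intro: Suc.IH k_smooth_on_SucD(2)[OF Suc.prems(1)] k_smooth_on_SucD(2)[OF Suc.prems(2)]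
         k_smooth_on_Suc_imp[OF Suc.prems(1)] k_smooth_on_Suc_imp[OF Suc.prems(2)])
qed

lemmas k_smooth_on_mult = bounded_bilinear.k_smooth_on[OF bounded_bilinear_mult]
lemmas k_smooth_on_scaleR = bounded_bilinear.k_smooth_on[OF bounded_bilinear_scaleR]

lemma k_smooth_on_sum:
  assumes "open S" "\<And>i. i \<in> I \<Longrightarrow> k_smooth_on k S (f i)"
  shows "k_smooth_on k S (\<lambda>x. \<Sum>i\<in>I. f i x)"
  using assms(2)
  by (induction I rule: infinite_finite_induct) (auto intro: k_smooth_on_const k_smooth_on_add[OF assms(1)])

lemma k_smooth_on_prod:
  fixes f :: "'i \<Rightarrow> 'a::real_normed_vector \<Rightarrow> real"
  assumes "open S" "\<And>i. i \<in> I \<Longrightarrow> k_smooth_on k S (f i)"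
  shows "k_smooth_on k S (\<lambda>x. \<Prod>i\<in>I. f i x)"
  using assms(2)
  by (induction I rule: infinite_finite_induct) (auto intro: k_smooth_on_const k_smooth_on_mult[OF assms(1)])

lemma k_smooth_on_inverse:
  fixes f :: "'a::real_normed_vector \<Rightarrow> real"
  assumes "open S" "\<And>x. x \<in> S \<Longrightarrow> f x \<noteq> 0" "k_smooth_on k S f"
  shows "k_smooth_on k S (\<lambda>x. inverse (f x))"
  using assms(3)
proof (induction k)
  case 0
  then show ?case using assms(2) by (simp add: continuous_on_inverse)
next
  case (Suc k)
  have m: "k_smooth_on k S (\<lambda>x. inverse (f x))" using Suc.IH k_smooth_on_Suc_imp[OF Suc.prems] by auto
  have "k_smooth_on k S (\<lambda>x. - 1 * (inverse (f x) * dird v f x * inverse (f x)))" for v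
    by (intro k_smooth_on_mult assms(1) k_smooth_on_const m k_smooth_on_SucD(2)[OF Suc.prems])
  then show ?case
    by (intro k_smooth_on_SucI[OF assms(1) Deriv.has_derivative_inverse[OF assms(2) k_smooth_on_SucD(1)[OF Suc.prems]]]) auto
qed

lemma k_smooth_on_compose:
  fixes f :: "'b::euclidean_space \<Rightarrow> 'c::real_normed_vector"
  assumes "open S" "open T" "\<And>x. x \<in> S \<Longrightarrow> g x \<in> T" "k_smooth_on k S g" "k_smooth_on k T f"
  shows "k_smooth_on k S (\<lambda>x. f (g x))"
  using assms(4,5)
proof (induction k arbitrary: f)
  case 0
  then show ?case using assms(3) continuous_on_compose2[of T f S g] by auto
next
  case (Suc k)
  have fg: "((\<lambda>x. f (g x)) has_derivative (\<lambda>v. frechet_derivative f (at (g x)) (frechet_derivative g (at x) v))) (at x)"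
    if "x \<in> S" for x
    using has_derivative_compose[OF k_smooth_on_SucD(1)[OF Suc.prems(1) that] k_smooth_on_SucD(1)[OF Suc.prems(2) assms(3)[OF that]]] .
  \<comment> \<open>\<open>k_smooth_on\<close> controls derivatives in fixed directions only, but
    the chain rule differentiates \<open>f\<close> in a direction that moves with the point.
    Expanding that direction in \<open>Basis\<close> leaves sums of products, which the induction
    can handle.\<close>
  have "frechet_derivative f (at (g x)) y = (\<Sum>b\<in>Basis. (y \<bullet> b) *\<^sub>R frechet_derivative f (at (g x)) b)"
    if "x \<in> S" for x y
  proof -
    interpret linear "frechet_derivative f (at (g x))"
      using k_smooth_on_SucD(1)[OF Suc.prems(2) assms(3)[OF that]] has_derivative_linear by blast
    show ?thesis by (subst (1) euclidean_representation[of y, symmetric]) (simp add: sum scale)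
  qed
  note eq = this
  have "k_smooth_on k S (\<lambda>x. frechet_derivative f (at (g x)) (frechet_derivative g (at x) v))" for v
  proof (rule k_smooth_on_cong[OF assms(1) eq[symmetric]], assumption)
    show "k_smooth_on k S (\<lambda>x. \<Sum>b\<in>Basis. (frechet_derivative g (at x) v \<bullet> b) *\<^sub>R frechet_derivative f (at (g x)) b)"
      by (intro k_smooth_on_sum k_smooth_on_scaleR assms(1) Suc.IH[OF k_smooth_on_Suc_imp[OF Suc.prems(1)] k_smooth_on_SucD(2)[OF Suc.prems(2)]]
         k_smooth_on_linear_comp[OF assms(1) bounded_linear_inner_left] k_smooth_on_SucD(2)[OF Suc.prems(1)])
  qed
  then show ?case
    by (intro k_smooth_on_SucI[OF assms(1) fg])
qed

lemma k_smooth_on_vec: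
  fixes f :: "'a::real_normed_vector \<Rightarrow> real ^ 'n"
  assumes "open S" "\<And>i. k_smooth_on k S (\<lambda>x. f x $ i)"
  shows "k_smooth_on k S f"
proof -
  have "k_smooth_on k S (\<lambda>x. \<Sum>i\<in>UNIV. (f x $ i) *\<^sub>R (axis i 1 :: real ^ 'n))"
    by (intro k_smooth_on_sum k_smooth_on_scaleR assms k_smooth_on_const)
  moreover have "(\<lambda>x. \<Sum>i\<in>UNIV. (f x $ i) *\<^sub>R (axis i 1 :: real ^ 'n)) = f"
    by (intro ext) (metis (no_types, lifting) basis_expansion scalar_mult_eq_scaleR sum.cong)
  ultimately show ?thesis by (simp only:)
qed

section \<open>Smoothness of inverse maps\<close>

text \<open>Cramer's rule: the solution is a quotient of determinants, and these are polynomials in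
  the entries of \<open>B\<close>.\<close>

lemma k_smooth_on_matrix_inverse_mult:
  fixes B :: "'a::real_normed_vector \<Rightarrow> real ^ 'n ^ 'n"
  assumes "open S" "\<And>x. x \<in> S \<Longrightarrow> det (B x) \<noteq> 0" "\<And>i j. k_smooth_on k S (\<lambda>x. B x $ i $ j)"
    "\<And>x. x \<in> S \<Longrightarrow> B x *v y x = c"
  shows "k_smooth_on k S y"
proof (rule k_smooth_on_cong[OF assms(1)])
  let ?y = "\<lambda>x. (\<chi> m. det (\<chi> i j. if j = m then c $ i else B x $ i $ j) * inverse (det (B x)))"
  show "?y x = y x" if "x \<in> S" for x
    using cramer[OF assms(2)[OF that], of "y x" c] assms(4)[OF that] by (simp add: divide_inverse)
  have e: "k_smooth_on k S (\<lambda>x. (if j = m then c $ i else B x $ i $ j))" for i j m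
    by (cases "j = m") (simp_all add: k_smooth_on_const assms(3))
  have d: "k_smooth_on k S (\<lambda>x. det (B x))" unfolding det_def
    by (intro k_smooth_on_sum k_smooth_on_mult k_smooth_on_prod assms k_smooth_on_const)
  have d2: "k_smooth_on k S (\<lambda>x. det (\<chi> i j. if j = m then c $ i else B x $ i $ j))" for m
    unfolding det_def
    by (intro k_smooth_on_sum k_smooth_on_mult k_smooth_on_prod assms k_smooth_on_const) (simp add: e)
  show "k_smooth_on k S ?y"
    by (rule k_smooth_on_vec[OF assms(1)]) (simp, intro k_smooth_on_mult k_smooth_on_inverse d d2 assms(1,2))
qed

text \<open>Bootstrapping: the derivative of \<open>G\<close> at \<open>y\<close> inverts that of
  \<open>F\<close> at \<open>G y\<close>. If \<open>G\<close> is of class m, so are the coefficients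
  of this linear system and hence its solutions, which lifts \<open>G\<close> to class m + 1.
  Continuity of \<open>G\<close> starts the induction.\<close>

lemma k_smooth_on_right_inverse:
  fixes F :: "real ^ 'n \<Rightarrow> real ^ 'n" and G :: "real ^ 'n \<Rightarrow> real ^ 'n"
  assumes V: "open V" and W: "open W" and G: "continuous_on V G" "\<And>y. y \<in> V \<Longrightarrow> G y \<in> W"
    and FG: "\<And>y. y \<in> V \<Longrightarrow> F (G y) = y"
    and F: "k_smooth_on (Suc k) W F" and inj: "\<And>x. x \<in> W \<Longrightarrow> inj (frechet_derivative F (at x))"
  shows "k_smooth_on k V G"
proof -
  define D where "D = (\<lambda>x. frechet_derivative F (at x))"
  have F': "(F has_derivative D x) (at x)" if "x \<in> W" for x
    using k_smooth_on_SucD(1)[OF F that] by (simp add: D_def)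
  have lin: "linear (D x)" if "x \<in> W" for x using F'[OF that] has_derivative_linear by blast
  obtain D' where D': "\<And>x. x \<in> W \<Longrightarrow> linear (D' x) \<and> D' x \<circ> D x = id" 
    using linear_injective_left_inverse[OF lin] inj unfolding D_def by metis
  have D'2: "D x (D' x v) = v" if "x \<in> W" for x v
  proof -
    have "surj (D x)" using linear_injective_imp_surjective[OF lin[OF that]] inj[OF that] by (simp add: D_def)
    then obtain u where "v = D x u" by (metis surjD)
    then show ?thesis using D'[OF that] by (metis comp_apply id_apply)
  qed
  have G': "(G has_derivative D' (G y)) (at y)" if "y \<in> V" for y
  proof (rule has_derivative_inverse_basic[OF F' _ _ _ V that FG])
    show "G y \<in> W" "bounded_linear (D' (G y))" "D' (G y) \<circ> D (G y) = id" "isCont G y"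
      using that G D' linear_conv_bounded_linear V continuous_on_eq_continuous_at by blast+
  qed
  have sm: "m \<le> k \<Longrightarrow> k_smooth_on m V G" for m
  proof (induction m)
    case 0
    then show ?case using G by simp
  next
    case (Suc m)
    have Fm: "k_smooth_on m W (dird v F)" for v
      using k_smooth_on_le[OF k_smooth_on_SucD(2)[OF F]] Suc.prems by simp
    have "k_smooth_on m V (\<lambda>y. D' (G y) v)" for v
    proof (rule k_smooth_on_matrix_inverse_mult[OF V, where c = v and B = "\<lambda>y. matrix (D (G y))"])
      fix y assume y: "y \<in> V"
      show "det (matrix (D (G y))) \<noteq> 0"
        using det_nz_iff_inj[OF lin[OF G(2)[OF y]]] inj[OF G(2)[OF y]] by (simp add: D_def)
      show "matrix (D (G y)) *v D' (G y) v = v"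
        using matrix_works[of "D (G y)"] lin[OF G(2)[OF y]] D'2[OF G(2)[OF y]] by (simp add: scalar_mult_eq_scaleR[abs_def])
    next
      fix i j
      have "k_smooth_on m V (\<lambda>y. dird (axis j 1) F (G y))"
        by (rule k_smooth_on_compose[OF V W G(2) Suc.IH Fm]) (use Suc.prems in auto)
      then have "k_smooth_on m V (\<lambda>y. dird (axis j 1) F (G y) $ i)"
        by (rule k_smooth_on_linear_comp[OF V bounded_linear_vec_nth])
      then show "k_smooth_on m V (\<lambda>y. matrix (D (G y)) $ i $ j)" by (simp add: matrix_def D_def)
    qed
    then show ?case by (intro k_smooth_on_SucI[OF V G'])
  qed
  then show ?thesis by simp
qed

section \<open>Symmetry of second derivatives\<close>

text \<open>The mean value theorem is applied twice: along \<open>u\<close> to the increment of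
  \<open>f\<close> by \<open>h *\<^sub>R v\<close>, then along \<open>v\<close> to the derivative
  that appears.\<close>

lemma mixed_difference:
  fixes f :: "'a::real_normed_vector \<Rightarrow> real"
  assumes S: "\<And>s t. 0 \<le> s \<Longrightarrow> s \<le> h \<Longrightarrow> 0 \<le> t \<Longrightarrow> t \<le> h \<Longrightarrow> x + s *\<^sub>R u + t *\<^sub>R v \<in> S"
    and f: "k_smooth_on 2 S f" and h: "0 < h"
  shows "\<exists>s t. 0 \<le> s \<and> s \<le> h \<and> 0 \<le> t \<and> t \<le> h \<and>
    f (x + h *\<^sub>R u + h *\<^sub>R v) - f (x + h *\<^sub>R u) - f (x + h *\<^sub>R v) + f x
      = h * h * dird v (dird u f) (x + s *\<^sub>R u + t *\<^sub>R v)"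
proof -
  have f2: "k_smooth_on (Suc (Suc 0)) S f" using f by (simp add: numeral_2_eq_2)
  note d1 = k_smooth_on_SucD(1)[OF f2]
  note d2 = k_smooth_on_SucD(1)[OF k_smooth_on_SucD(2)[OF f2]]
  have chain: "((\<lambda>s. g (c + s *\<^sub>R z)) has_real_derivative dird z g (c + s *\<^sub>R z)) (at s)"
    if "(g has_derivative frechet_derivative g (at (c + s *\<^sub>R z))) (at (c + s *\<^sub>R z))"
    for g :: "'a \<Rightarrow> real" and c z s
  proof -
    have l: "((\<lambda>s. c + s *\<^sub>R z) has_derivative (\<lambda>r. r *\<^sub>R z)) (at s)"
      by (auto intro!: derivative_eq_intros)
    have "linear (frechet_derivative g (at (c + s *\<^sub>R z)))" using that has_derivative_linear by blast
    then have "(\<lambda>r. frechet_derivative g (at (c + s *\<^sub>R z)) (r *\<^sub>R z)) = (*) (dird z g (c + s *\<^sub>R z))"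
      by (intro ext) (simp add: linear_cmul)
    then show ?thesis using has_derivative_compose[OF l that] by (simp add: has_field_derivative_def)
  qed
  define \<phi> where "\<phi> s = f ((x + h *\<^sub>R v) + s *\<^sub>R u) - f (x + s *\<^sub>R u)" for s
  have "(\<phi> has_real_derivative dird u f ((x + h *\<^sub>R v) + s *\<^sub>R u) - dird u f (x + s *\<^sub>R u)) (at s)"
    if "0 \<le> s" "s \<le> h" for s
    unfolding \<phi>_def
    by (intro DERIV_diff chain d1) (use S[of s h] S[of s 0] that h in \<open>auto simp: algebra_simps\<close>)
  from MVT2[OF h this] obtain s where s: "0 < s" "s < h"
    "\<phi> h - \<phi> 0 = h * (dird u f ((x + h *\<^sub>R v) + s *\<^sub>R u) - dird u f (x + s *\<^sub>R u))"
    by auto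
  have "((\<lambda>t. dird u f ((x + s *\<^sub>R u) + t *\<^sub>R v)) has_real_derivative dird v (dird u f) ((x + s *\<^sub>R u) + t *\<^sub>R v)) (at t)"
    if "0 \<le> t" "t \<le> h" for t
    by (intro chain d2) (use S[of s t] that s in \<open>auto simp: algebra_simps\<close>)
  from MVT2[OF h this] obtain t where t: "0 < t" "t < h"
    "dird u f ((x + s *\<^sub>R u) + h *\<^sub>R v) - dird u f (x + s *\<^sub>R u) = h * dird v (dird u f) ((x + s *\<^sub>R u) + t *\<^sub>R v)"
    by auto
  have "\<phi> h - \<phi> 0 = h * h * dird v (dird u f) (x + s *\<^sub>R u + t *\<^sub>R v)"
    using s(3) t(3) by (simp add: add.commute add.left_commute)
  then show ?thesis using s t unfolding \<phi>_def
    by (intro exI[of _ s] exI[of _ t] conjI) (simp_all add: add_ac)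
qed

text \<open>The second difference over a parallelogram is symmetric in \<open>u\<close> and
  \<open>v\<close>, and \<open>mixed_difference\<close> identifies it with a nearby value of either
  mixed derivative. Continuity at \<open>x\<close> does the rest.\<close>

lemma dird_commute:
  fixes f :: "'a::real_normed_vector \<Rightarrow> real"
  assumes "open S" "k_smooth_on 2 S f" "x \<in> S"
  shows "dird v (dird u f) x = dird u (dird v f) x"
proof (rule ccontr)
  have f2: "k_smooth_on (Suc (Suc 0)) S f" using assms(2) by (simp add: numeral_2_eq_2)
  let ?A = "dird v (dird u f)" and ?B = "dird u (dird v f)"
  assume ne: "?A x \<noteq> ?B x"
  define e where "e = \<bar>?A x - ?B x\<bar> / 2"
  have e: "e > 0" using ne by (simp add: e_def)
  have cont: "isCont ?A x" "isCont ?B x"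
    using k_smooth_on_SucD(2)[OF k_smooth_on_SucD(2)[OF f2]] assms(1,3)
    by (auto simp: continuous_on_eq_continuous_at)
  obtain d1 where d1: "d1 > 0" "\<And>y. dist y x < d1 \<Longrightarrow> dist (?A y) (?A x) < e"
    using cont(1) e unfolding continuous_at_eps_delta by metis
  obtain d2 where d2: "d2 > 0" "\<And>y. dist y x < d2 \<Longrightarrow> dist (?B y) (?B x) < e"
    using cont(2) e unfolding continuous_at_eps_delta by metis
  obtain d3 where d3: "d3 > 0" "ball x d3 \<subseteq> S" using assms(1,3) openE by blast
  define d where "d = Min {d1, d2, d3}"
  \<comment> \<open>The factor 2 keeps the whole parallelogram strictly inside the ball of radius
    \<open>d\<close>; the \<open>+ 1\<close> keeps the denominator positive when both directions
    vanish.\<close>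
  define h where "h = d / (2 * (norm u + norm v + 1))"
  have d: "d > 0" "d \<le> d1" "d \<le> d2" "d \<le> d3" using d1 d2 d3 by (auto simp: d_def)
  have pos: "norm u + norm v + 1 > 0" by (meson add_nonneg_pos add_nonneg_nonneg norm_ge_zero zero_less_one)
  then have h: "h > 0" using d by (simp add: h_def)
  have near: "dist (x + s *\<^sub>R u + t *\<^sub>R v) x < d" if "0 \<le> s" "s \<le> h" "0 \<le> t" "t \<le> h" for s t
  proof -
    have "dist (x + s *\<^sub>R u + t *\<^sub>R v) x = norm (s *\<^sub>R u + t *\<^sub>R v)" by (simp add: dist_norm)
    also have "\<dots> \<le> s * norm u + t * norm v" using norm_triangle_ineq[of "s *\<^sub>R u" "t *\<^sub>R v"] that by simp
    also have "\<dots> \<le> h * norm u + h * norm v" using that by (intro add_mono mult_right_mono) auto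
    also have "\<dots> \<le> h * (norm u + norm v + 1)" using h by (simp add: algebra_simps)
    also have "\<dots> = d / 2" unfolding h_def using pos
      by (metis divide_divide_eq_left less_irrefl nonzero_eq_divide_eq)
    finally show ?thesis using d(1) by linarith
  qed
  have inS: "x + s *\<^sub>R u + t *\<^sub>R v \<in> S" if "0 \<le> s" "s \<le> h" "0 \<le> t" "t \<le> h" for s t
    using near[OF that] d d3 by (auto simp: dist_commute subset_iff)
  obtain s t where st: "0 \<le> s" "s \<le> h" "0 \<le> t" "t \<le> h"
    "f (x + h *\<^sub>R u + h *\<^sub>R v) - f (x + h *\<^sub>R u) - f (x + h *\<^sub>R v) + f x = h * h * ?A (x + s *\<^sub>R u + t *\<^sub>R v)"
    using mixed_difference[OF inS assms(2) h] by blast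
  have inS': "x + s *\<^sub>R v + t *\<^sub>R u \<in> S" if "0 \<le> s" "s \<le> h" "0 \<le> t" "t \<le> h" for s t
    using inS[of t s] that by (simp add: algebra_simps)
  obtain s' t' where st': "0 \<le> s'" "s' \<le> h" "0 \<le> t'" "t' \<le> h"
    "f (x + h *\<^sub>R v + h *\<^sub>R u) - f (x + h *\<^sub>R v) - f (x + h *\<^sub>R u) + f x = h * h * ?B (x + s' *\<^sub>R v + t' *\<^sub>R u)"
    using mixed_difference[OF inS' assms(2) h] by blast
  have "h * h * ?A (x + s *\<^sub>R u + t *\<^sub>R v) = h * h * ?B (x + s' *\<^sub>R v + t' *\<^sub>R u)"
    using st(5) st'(5) by (simp add: algebra_simps)
  then have eq: "?A (x + s *\<^sub>R u + t *\<^sub>R v) = ?B (x + t' *\<^sub>R u + s' *\<^sub>R v)" using h by (simp add: algebra_simps)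
  have "dist (?A (x + s *\<^sub>R u + t *\<^sub>R v)) (?A x) < e" using d1(2) near st d by fastforce
  moreover have "dist (?B (x + t' *\<^sub>R u + s' *\<^sub>R v)) (?B x) < e" using d2(2) near[of t' s'] st' d by fastforce
  \<comment> \<open>A common value cannot be closer than half the gap to both limits.\<close>
  moreover have "\<bar>c - a\<bar> < \<bar>a - b\<bar> / 2 \<Longrightarrow> \<bar>c - b\<bar> < \<bar>a - b\<bar> / 2 \<Longrightarrow> False" for a b c :: real
    by (simp add: abs_if split: if_splits)
  ultimately show False using eq unfolding dist_real_def e_def by metis
qed

section \<open>The Bochner formula for a graph at a critical point\<close>

abbreviation smooth :: "(real ^ 'n \<Rightarrow> real) \<Rightarrow> bool" where
  "smooth f \<equiv> smooth_on UNIV f"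

definition pd :: "'n \<Rightarrow> (real ^ 'n::finite \<Rightarrow> real) \<Rightarrow> real ^ 'n \<Rightarrow> real" where
  "pd i f x = frechet_derivative f (at x) (axis i 1)"

lemma smooth_imp_has_derivative:
  "smooth_on S f \<Longrightarrow> x \<in> S \<Longrightarrow> (f has_derivative frechet_derivative f (at x)) (at x)"
  using k_smooth_on_SucD(1)[of 0 S f x] unfolding smooth_on_def by blast

lemma smooth_const [simp]: "smooth (\<lambda>x. c)"
  by (simp add: smooth_on_def k_smooth_on_const)

lemma smooth_add [simp]: "smooth f \<Longrightarrow> smooth g \<Longrightarrow> smooth (\<lambda>x. f x + g x)"
  by (simp add: smooth_on_def k_smooth_on_add)

lemma smooth_mult [simp]: "smooth f \<Longrightarrow> smooth g \<Longrightarrow> smooth (\<lambda>x. f x * g x)"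
  by (simp add: smooth_on_def k_smooth_on_mult)

lemma smooth_diff [simp]: "smooth f \<Longrightarrow> smooth g \<Longrightarrow> smooth (\<lambda>x. f x - g x)"
  using smooth_add[OF _ smooth_mult[OF smooth_const[of "-1"]], of f g] by simp

lemma smooth_sum [simp]: "(\<And>i. smooth (f i)) \<Longrightarrow> smooth (\<lambda>x. \<Sum>i\<in>I. f i x)"
  by (simp add: smooth_on_def k_smooth_on_sum)

lemma k_smooth_on_ident:
  assumes "open S" shows "k_smooth_on k S (\<lambda>x. x)"
  by (cases k) (auto intro!: k_smooth_on_SucI[OF assms has_derivative_ident] k_smooth_on_const)

lemma smooth_coord [simp]:
  fixes i :: "'n::finite"
  shows "smooth (\<lambda>x. x $ i)"
  unfolding smooth_on_def
  by (intro allI k_smooth_on_linear_comp[OF open_UNIV bounded_linear_vec_nth k_smooth_on_ident] open_UNIV)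

lemma smooth_pd [simp]: "smooth f \<Longrightarrow> smooth (pd i f)"
  unfolding smooth_on_def pd_def[abs_def] using k_smooth_on_SucD(2) by blast

lemma pd_eqI: "(f has_derivative f') (at x) \<Longrightarrow> pd i f x = f' (axis i 1)"
  by (simp add: pd_def frechet_derivative_eqI)

text \<open>This rule and the next ones equate functions, not values, so that the simplifier can use
  them under a further \<open>pd\<close> and compute iterated partial derivatives.\<close>

lemma pd_const [simp]: "pd i (\<lambda>x. c) = (\<lambda>x. 0)"
  by (intro ext, subst pd_eqI[OF has_derivative_const]) simp

lemma pd_add [simp]:
  "smooth f \<Longrightarrow> smooth g \<Longrightarrow> pd i (\<lambda>x. f x + g x) = (\<lambda>x. pd i f x + pd i g x)"
  by (intro ext, subst pd_eqI[OF has_derivative_add[OF smooth_imp_has_derivative smooth_imp_has_derivative]])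
     (auto simp: pd_def)

lemma pd_diff [simp]:
  "smooth f \<Longrightarrow> smooth g \<Longrightarrow> pd i (\<lambda>x. f x - g x) = (\<lambda>x. pd i f x - pd i g x)"
  by (intro ext, subst pd_eqI[OF has_derivative_diff[OF smooth_imp_has_derivative smooth_imp_has_derivative]])
     (auto simp: pd_def)

lemma pd_mult [simp]:
  "smooth f \<Longrightarrow> smooth g \<Longrightarrow> pd i (\<lambda>x. f x * g x) = (\<lambda>x. f x * pd i g x + pd i f x * g x)"
  by (intro ext, subst pd_eqI[OF has_derivative_mult[OF smooth_imp_has_derivative smooth_imp_has_derivative]])
     (auto simp: pd_def)

lemma pd_sum [simp]:
  "(\<And>i. smooth (f i)) \<Longrightarrow> pd j (\<lambda>x. \<Sum>i\<in>I. f i x) = (\<lambda>x. \<Sum>i\<in>I. pd j (f i) x)"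
  by (induction I rule: infinite_finite_induct) auto

lemma pd_coord [simp]: "pd i (\<lambda>x. x $ j) = (\<lambda>x. if i = j then 1 else 0)"
  by (intro ext, subst pd_eqI[OF bounded_linear_imp_has_derivative[OF bounded_linear_vec_nth]])
     (auto simp: axis_def)

lemma pd_commute: "smooth f \<Longrightarrow> pd i (pd j f) = pd j (pd i f)"
  unfolding pd_def by (intro ext dird_commute[of UNIV]) (auto simp: smooth_on_def)

lemma sum_delta_mult:
  fixes f :: "'n::finite \<Rightarrow> real"
  shows "(\<Sum>i\<in>UNIV. f i * (if j = i then 1 else 0)) = f j"
    "(\<Sum>i\<in>UNIV. (if j = i then 1 else 0) * f i) = f j"
    "(\<Sum>i\<in>UNIV. if j = i then f i else 0) = f j"
proof -
  show *: "(\<Sum>i\<in>UNIV. if j = i then f i else 0) = f j" by simp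
  have "(if j = i then 1 else 0) * f i = (if j = i then f i else 0)" "f i * (if j = i then 1 else 0) = (if j = i then f i else 0)" for i
    by simp_all
  then show "(\<Sum>i\<in>UNIV. f i * (if j = i then 1 else 0)) = f j" "(\<Sum>i\<in>UNIV. (if j = i then 1 else 0) * f i) = f j"
    using * by (simp_all only:)
qed

text \<open>At a critical point \<open>p\<close> the graph of \<open>w\<close> has the flat metric to first order, so the
  Christoffel symbols vanish there and partial derivatives replace covariant ones.\<close>

locale graph_shrinker =
  fixes w :: "real ^ 'n::finite \<Rightarrow> real" and k :: real and p :: "real ^ 'n"
  assumes w [simp]: "smooth w"
    and crit: "pd i w p = 0"
    and shrinker: "(\<Sum>i\<in>UNIV. pd i (pd i w) y) * (1 - (\<Sum>i\<in>UNIV. pd i w y * pd i w y))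
        + (\<Sum>i\<in>UNIV. \<Sum>j\<in>UNIV. pd i w y * pd i (pd j w) y * pd j w y)
      = ((\<Sum>i\<in>UNIV. y $ i * y $ i) - w y * w y) * ((\<Sum>i\<in>UNIV. y $ i * pd i w y) - w y)
        * (1 - (\<Sum>i\<in>UNIV. pd i w y * pd i w y))"
    and traceless: "(\<Sum>i\<in>UNIV. \<Sum>j\<in>UNIV. pd i (pd j w) y * pd i (pd j w) y) * (1 - (\<Sum>i\<in>UNIV. pd i w y * pd i w y))\<^sup>2
        + 2 * (\<Sum>i\<in>UNIV. (\<Sum>j\<in>UNIV. pd i (pd j w) y * pd j w y) * (\<Sum>j\<in>UNIV. pd i (pd j w) y * pd j w y))
            * (1 - (\<Sum>i\<in>UNIV. pd i w y * pd i w y))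
        + (\<Sum>i\<in>UNIV. \<Sum>j\<in>UNIV. pd i w y * pd i (pd j w) y * pd j w y)\<^sup>2
        - (((\<Sum>i\<in>UNIV. y $ i * y $ i) - w y * w y) * ((\<Sum>i\<in>UNIV. y $ i * pd i w y) - w y)
            * (1 - (\<Sum>i\<in>UNIV. pd i w y * pd i w y)))\<^sup>2 / real CARD('n)
      = k * (1 - (\<Sum>i\<in>UNIV. pd i w y * pd i w y)) ^ 3"
begin

section \<open>Jets of the graph equations at the critical point\<close>

abbreviation "h i j \<equiv> pd i (pd j w)"
text \<open>Write D for the gradient and h for the Hessian of \<open>w\<close>. Then
  \<open>al\<close> is |D|^2, \<open>ga\<close> is h(D, D), \<open>be\<close> is |h D|^2 and
  \<open>tr\<close> is |h|^2. If n0 is the vertical component of the unit normal, n0^2 (1 -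
  \<open>al\<close>) = 1; \<open>sg\<close> is the Lorentz square of the position vector and n0
  \<open>ta\<close> its product with the normal. The locale assumption \<open>shrinker\<close> is H
  = n0 \<open>P\<close> times (1 - \<open>al\<close>)/n0, and \<open>traceless\<close> is |T|^2 =
  \<open>k\<close> times (1 - \<open>al\<close>)^3.\<close>

definition "al y = (\<Sum>i\<in>UNIV. pd i w y * pd i w y)"
definition "ga y = (\<Sum>i\<in>UNIV. \<Sum>j\<in>UNIV. pd i w y * h i j y * pd j w y)"
definition "be y = (\<Sum>i\<in>UNIV. (\<Sum>j\<in>UNIV. h i j y * pd j w y) * (\<Sum>j\<in>UNIV. h i j y * pd j w y))"
definition "tr y = (\<Sum>i\<in>UNIV. \<Sum>j\<in>UNIV. h i j y * h i j y)"
definition "lap y = (\<Sum>i\<in>UNIV. h i i y)"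
definition "sg y = (\<Sum>i\<in>UNIV. y $ i * y $ i) - w y * w y"
definition "ta y = (\<Sum>i\<in>UNIV. y $ i * pd i w y) - w y"
definition "P y = sg y * ta y"

lemma smooths [simp]: "smooth al" "smooth ga" "smooth be" "smooth tr" "smooth lap" "smooth sg" "smooth ta" "smooth P"
proof -
  show s: "smooth sg" "smooth ta" unfolding sg_def[abs_def] ta_def[abs_def] by simp_all
  show "smooth P" unfolding P_def[abs_def] using s by simp
qed (simp_all add: al_def[abs_def] ga_def[abs_def] be_def[abs_def] tr_def[abs_def] lap_def[abs_def])

lemma h_sym: "h i j = h j i" by (rule pd_commute) simp

lemma pd3_sym: "pd l (h i j) = pd j (h i l)" "pd l (h i j) = pd i (h l j)"
  using h_sym pd_commute[of "pd i w" l j] pd_commute[of "pd j w" l i] by simp_all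

text \<open>Summed over \<open>l\<close>, this exchanges the Laplacian of the Hessian for the
  Hessian of the Laplacian, as Codazzi and the Ricci commutation do in the Simons identity. The
  curvature terms of the latter come back through the second derivatives of \<open>al\<close>,
  \<open>ga\<close> and \<open>be\<close>.\<close>

lemma pd4: "pd l (pd l (h i j)) = pd i (pd j (h l l))"
  by (metis pd_commute smooth_pd w)

text \<open>\<open>al\<close>, \<open>ga\<close> and \<open>be\<close> are quadratic in the
  gradient, which vanishes at \<open>p\<close>. So their values and first derivatives vanish there,
  and their second derivatives see only the Hessian.\<close>

lemma jets_al: "al p = 0" "pd i al p = 0" "pd i (pd j al) p = 2 * (\<Sum>m\<in>UNIV. h i m p * h j m p)"
  unfolding al_def[abs_def] by (simp_all add: crit sum_distrib_left)

lemma jets_ga: "ga p = 0" "pd i ga p = 0"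
  "pd i (pd j ga) p = 2 * (\<Sum>m\<in>UNIV. \<Sum>l\<in>UNIV. h i m p * h m l p * h l j p)"
proof -
  show "ga p = 0" "pd i ga p = 0" unfolding ga_def[abs_def] by (simp_all add: crit)
  have "pd i (pd j ga) p = (\<Sum>m\<in>UNIV. \<Sum>l\<in>UNIV. h j m p * h m l p * h i l p)
      + (\<Sum>m\<in>UNIV. \<Sum>l\<in>UNIV. h i m p * h m l p * h j l p)"
    unfolding ga_def[abs_def] by (simp add: crit sum.distrib)
  also have "(\<Sum>m\<in>UNIV. \<Sum>l\<in>UNIV. h j m p * h m l p * h i l p) = (\<Sum>m\<in>UNIV. \<Sum>l\<in>UNIV. h i m p * h m l p * h j l p)"
    by (subst sum.swap) (simp add: h_sym mult_ac)
  finally show "pd i (pd j ga) p = 2 * (\<Sum>m\<in>UNIV. \<Sum>l\<in>UNIV. h i m p * h m l p * h l j p)"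
    using h_sym by simp
qed

lemma jets_be: "be p = 0" "pd i be p = 0"
  "pd l (pd l be) p = 2 * (\<Sum>i\<in>UNIV. (\<Sum>j\<in>UNIV. h i j p * h l j p)\<^sup>2)"
  unfolding be_def[abs_def] by (simp_all add: crit power2_eq_square sum.distrib) (simp add: sum_distrib_left)

lemma jets_tr: "pd l tr p = 2 * (\<Sum>i\<in>UNIV. \<Sum>j\<in>UNIV. h i j p * pd l (h i j) p)"
  "pd l (pd l tr) p = 2 * (\<Sum>i\<in>UNIV. \<Sum>j\<in>UNIV. (pd l (h i j) p)\<^sup>2) + 2 * (\<Sum>i\<in>UNIV. \<Sum>j\<in>UNIV. h i j p * pd i (pd j (h l l)) p)"
proof -
  show "pd l tr p = 2 * (\<Sum>i\<in>UNIV. \<Sum>j\<in>UNIV. h i j p * pd l (h i j) p)"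
    unfolding tr_def[abs_def] by (simp add: sum_distrib_left)
  have "pd l (pd l tr) p = 2 * (\<Sum>i\<in>UNIV. \<Sum>j\<in>UNIV. (pd l (h i j) p)\<^sup>2) + 2 * (\<Sum>i\<in>UNIV. \<Sum>j\<in>UNIV. h i j p * pd l (pd l (h i j)) p)"
    unfolding tr_def[abs_def] by (simp add: sum_distrib_left power2_eq_square sum.distrib[symmetric] algebra_simps)
  then show "pd l (pd l tr) p = 2 * (\<Sum>i\<in>UNIV. \<Sum>j\<in>UNIV. (pd l (h i j) p)\<^sup>2) + 2 * (\<Sum>i\<in>UNIV. \<Sum>j\<in>UNIV. h i j p * pd i (pd j (h l l)) p)"
    by (simp add: pd4)
qed

lemma jets_sg: "pd i sg p = 2 * p $ i" "pd i (pd j sg) p = (if i = j then 2 else 0) - 2 * w p * h i j p"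
  unfolding sg_def[abs_def] by (simp_all add: crit sum_delta_mult sum.distrib sum_distrib_left[symmetric])

lemma jets_ta: "ta p = - w p" "pd i ta p = (\<Sum>m\<in>UNIV. h i m p * p $ m)"
  "pd i (pd j ta) p = h i j p + (\<Sum>m\<in>UNIV. p $ m * pd i (h j m) p)"
  unfolding ta_def[abs_def] by (simp_all add: crit sum_delta_mult sum.distrib mult.commute) (rule h_sym[THEN fun_cong])

lemma E1: "lap y * (1 - al y) + ga y = P y * (1 - al y)"
  using shrinker[of y] by (simp add: lap_def al_def ga_def P_def sg_def ta_def)

lemma E2: "tr y * ((1 - al y) * (1 - al y)) + 2 * be y * (1 - al y) + ga y * ga y
    - (P y * (1 - al y)) * (P y * (1 - al y)) * (1 / real CARD('n)) = k * ((1 - al y) * (1 - al y) * (1 - al y))"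
  using traceless[of y] by (simp add: tr_def al_def ga_def be_def P_def sg_def ta_def power2_eq_square power3_eq_cube)

text \<open>To second order only \<open>al\<close> and \<open>ga\<close> contribute corrections, and
  those of \<open>al\<close> cancel because \<open>lap p = P p\<close>.\<close>

lemma E1_jets: "lap p = P p" "pd i lap p = pd i P p" "pd i (pd j lap) p = pd i (pd j P) p - pd i (pd j ga) p"
proof -
  have eq: "(\<lambda>y. lap y * (1 - al y) + ga y) = (\<lambda>y. P y * (1 - al y))" using E1 by blast
  show 0: "lap p = P p" using E1[of p] by (simp add: jets_al jets_ga)
  show "pd i lap p = pd i P p" using arg_cong[OF eq, of "\<lambda>f. pd i f p"] by (simp add: jets_al jets_ga)
  show "pd i (pd j lap) p = pd i (pd j P) p - pd i (pd j ga) p"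
    using arg_cong[OF eq, of "\<lambda>f. pd i (pd j f) p"] by (simp add: jets_al(1,2) jets_ga(1,2) 0)
qed

lemma E2_jets:
  defines "c \<equiv> 1 / real CARD('n)"
  shows "k = tr p - c * (P p)\<^sup>2" "pd i tr p = 2 * c * P p * pd i P p"
  "pd l (pd l tr) p + 2 * pd l (pd l be) p - 2 * c * ((pd l P p)\<^sup>2 + P p * pd l (pd l P) p)
     = - k * pd l (pd l al) p"
proof -
  have eq: "(\<lambda>y. tr y * ((1 - al y) * (1 - al y)) + 2 * be y * (1 - al y) + ga y * ga y
    - (P y * (1 - al y)) * (P y * (1 - al y)) * c) = (\<lambda>y. k * ((1 - al y) * (1 - al y) * (1 - al y)))"
    using E2 unfolding c_def by blast
  show 0: "k = tr p - c * (P p)\<^sup>2" using fun_cong[OF eq, of p]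
    by (simp add: jets_al jets_ga jets_be power2_eq_square mult_ac)
  show "pd i tr p = 2 * c * P p * pd i P p"
    using arg_cong[OF eq, of "\<lambda>f. pd i f p"] by (simp add: jets_al jets_ga jets_be algebra_simps)
  have "pd l (pd l tr) p - 2 * tr p * pd l (pd l al) p + 2 * pd l (pd l be) p
     - c * (2 * (pd l P p)\<^sup>2 + 2 * P p * pd l (pd l P) p - 2 * (P p)\<^sup>2 * pd l (pd l al) p) = - 3 * k * pd l (pd l al) p"
    using arg_cong[OF eq, of "\<lambda>f. pd l (pd l f) p"]
    by (simp add: jets_al(1,2) jets_ga(1,2) jets_be(1,2) algebra_simps power2_eq_square)
  \<comment> \<open>By the value of \<open>k\<close> at \<open>p\<close>, the second derivatives of
    \<open>al\<close> on the left carry the factor - 2 k in total; moved across, they leave - k of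
    the - 3 k.\<close>
  then show "pd l (pd l tr) p + 2 * pd l (pd l be) p - 2 * c * ((pd l P p)\<^sup>2 + P p * pd l (pd l P) p)
     = - k * pd l (pd l al) p"
    unfolding 0 by (simp add: algebra_simps)
qed

lemma jets_P:
  "pd i (pd j P) p = - 2 * w p * (if i = j then 1 else 0) + (2 * (w p)\<^sup>2 + sg p) * h i j p
     + 2 * (p $ j * (\<Sum>m\<in>UNIV. h i m p * p $ m) + p $ i * (\<Sum>m\<in>UNIV. h j m p * p $ m))
     + sg p * (\<Sum>m\<in>UNIV. p $ m * pd i (h j m) p)"
proof -
  have "pd i (pd j P) p = pd i (pd j sg) p * ta p + pd j sg p * pd i ta p + pd i sg p * pd j ta p + sg p * pd i (pd j ta) p"
    unfolding P_def[abs_def] by (simp add: algebra_simps)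
  then show ?thesis
    by (cases "i = j") (simp_all add: jets_sg jets_ta algebra_simps power2_eq_square)
qed

text \<open>The sum over \<open>l\<close> of the second order jets of \<open>traceless\<close>, with the Laplacian of \<open>h\<close> expressed
  by the Hessian of \<open>shrinker\<close>; the quartic terms \<open>tr h\<^sup>4\<close> cancel.\<close>

lemma bochner:
  defines "c \<equiv> 1 / real CARD('n)"
  shows "(\<Sum>l\<in>UNIV. (\<Sum>i\<in>UNIV. \<Sum>j\<in>UNIV. (pd l (h i j) p)\<^sup>2) - c * (\<Sum>i\<in>UNIV. pd l (h i i) p)\<^sup>2)
    + 4 * ((\<Sum>i\<in>UNIV. (\<Sum>j\<in>UNIV. h i j p * p $ j)\<^sup>2) - c * P p * (\<Sum>i\<in>UNIV. p $ i * (\<Sum>j\<in>UNIV. h i j p * p $ j)))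
    + k * (\<Sum>i\<in>UNIV. (p $ i)\<^sup>2) + k * (w p)\<^sup>2 + k * tr p = 0"
proof -
  \<comment> \<open>The tangent space at the critical point is horizontal, so \<open>p\<close> is
    the tangential part of the position vector and \<open>hy\<close> is the Hessian applied to it.
    The number \<open>q\<close> is the trace of the fourth power of the Hessian.\<close>
  define hy where "hy i = (\<Sum>j\<in>UNIV. h i j p * p $ j)" for i
  define nab where "nab l = (\<Sum>i\<in>UNIV. \<Sum>j\<in>UNIV. (pd l (h i j) p)\<^sup>2)" for l
  define q where "q = (\<Sum>l\<in>UNIV. \<Sum>i\<in>UNIV. (\<Sum>j\<in>UNIV. h i j p * h l j p)\<^sup>2)"
  define Pl where "Pl = (\<Sum>l\<in>UNIV. (pd l P p)\<^sup>2)"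
  have al: "(\<Sum>l\<in>UNIV. pd l (pd l al) p) = 2 * tr p"
    by (simp add: jets_al tr_def sum_distrib_left)
  have be: "(\<Sum>l\<in>UNIV. pd l (pd l be) p) = 2 * q"
    by (simp add: jets_be q_def sum_distrib_left)
  have lapij: "(\<Sum>l\<in>UNIV. pd i (pd j (h l l)) p) = pd i (pd j lap) p" for i j
    unfolding lap_def[abs_def] by simp
  have ga: "(\<Sum>i\<in>UNIV. \<Sum>j\<in>UNIV. h i j p * pd i (pd j ga) p) = 2 * q"
  proof -
    have "(\<Sum>m\<in>UNIV. \<Sum>l\<in>UNIV. h i m p * h m l p * h l j p) = (\<Sum>l\<in>UNIV. (\<Sum>m\<in>UNIV. h i m p * h l m p) * h j l p)" for i j
      by (subst sum.swap) (simp add: sum_distrib_right h_sym)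
    then have "(\<Sum>i\<in>UNIV. \<Sum>j\<in>UNIV. h i j p * pd i (pd j ga) p)
       = 2 * (\<Sum>i\<in>UNIV. \<Sum>j\<in>UNIV. \<Sum>l\<in>UNIV. (\<Sum>m\<in>UNIV. h i m p * h l m p) * (h i j p * h l j p))"
      by (simp add: jets_ga sum_distrib_left mult_ac h_sym)
    also have "(\<Sum>i\<in>UNIV. \<Sum>j\<in>UNIV. \<Sum>l\<in>UNIV. (\<Sum>m\<in>UNIV. h i m p * h l m p) * (h i j p * h l j p)) = 
        (\<Sum>i\<in>UNIV. \<Sum>l\<in>UNIV. \<Sum>j\<in>UNIV. (\<Sum>m\<in>UNIV. h i m p * h l m p) * (h i j p * h l j p))"
      by (intro sum.cong refl sum.swap)
    also have "\<dots> = (\<Sum>i\<in>UNIV. \<Sum>l\<in>UNIV. (\<Sum>m\<in>UNIV. h i m p * h l m p)\<^sup>2)"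
      by (simp add: sum_distrib_left[symmetric] power2_eq_square)
    also have "\<dots> = q" unfolding q_def by (subst sum.swap) simp
    finally show ?thesis .
  qed
  have "(\<Sum>l\<in>UNIV. pd l (pd l tr) p) = 2 * (\<Sum>l\<in>UNIV. nab l)
      + 2 * (\<Sum>l\<in>UNIV. \<Sum>i\<in>UNIV. \<Sum>j\<in>UNIV. h i j p * pd i (pd j (h l l)) p)"
    by (simp add: jets_tr nab_def sum.distrib sum_distrib_left)
  also have "(\<Sum>l\<in>UNIV. \<Sum>i\<in>UNIV. \<Sum>j\<in>UNIV. h i j p * pd i (pd j (h l l)) p)
     = (\<Sum>i\<in>UNIV. \<Sum>l\<in>UNIV. \<Sum>j\<in>UNIV. h i j p * pd i (pd j (h l l)) p)"
    by (rule sum.swap)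
  also have "\<dots> = (\<Sum>i\<in>UNIV. \<Sum>j\<in>UNIV. \<Sum>l\<in>UNIV. h i j p * pd i (pd j (h l l)) p)"
    by (intro sum.cong refl sum.swap)
  also have "\<dots> = (\<Sum>i\<in>UNIV. \<Sum>j\<in>UNIV. h i j p * pd i (pd j lap) p)"
    by (simp only: sum_distrib_left[symmetric] lapij)
  also have "\<dots> = (\<Sum>i\<in>UNIV. \<Sum>j\<in>UNIV. h i j p * pd i (pd j P) p) - 2 * q"
    unfolding ga[symmetric] by (simp add: E1_jets right_diff_distrib sum_subtractf)
  finally have tr: "(\<Sum>l\<in>UNIV. pd l (pd l tr) p) = 2 * (\<Sum>l\<in>UNIV. nab l)
    + 2 * (\<Sum>i\<in>UNIV. \<Sum>j\<in>UNIV. h i j p * pd i (pd j P) p) - 4 * q" by simp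
  have "(\<Sum>l\<in>UNIV. pd l (pd l tr) p + 2 * pd l (pd l be) p - 2 * c * ((pd l P p)\<^sup>2 + P p * pd l (pd l P) p))
     = (\<Sum>l\<in>UNIV. - k * pd l (pd l al) p)"
    unfolding c_def using E2_jets(3) by (intro sum.cong refl) blast
  then have "(\<Sum>l\<in>UNIV. pd l (pd l tr) p) + 2 * (\<Sum>l\<in>UNIV. pd l (pd l be) p) 
      - 2 * c * (Pl + P p * (\<Sum>l\<in>UNIV. pd l (pd l P) p)) = - k * (\<Sum>l\<in>UNIV. pd l (pd l al) p)"
    by (simp add: Pl_def sum.distrib sum_subtractf sum_distrib_left distrib_left mult.assoc sum_negf)
  then have main: "(\<Sum>l\<in>UNIV. nab l) + (\<Sum>i\<in>UNIV. \<Sum>j\<in>UNIV. h i j p * pd i (pd j P) p)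
      - c * (Pl + P p * (\<Sum>l\<in>UNIV. pd l (pd l P) p)) + k * tr p = 0"
    unfolding al be tr by (simp add: algebra_simps)
  have Py: "(\<Sum>i\<in>UNIV. h i i p) = P p" using E1_jets(1) by (simp add: lap_def)
  have Pm: "(\<Sum>i\<in>UNIV. pd m (h i i) p) = pd m P p" for m
    using E1_jets(2)[of m] unfolding lap_def[abs_def] by simp
  have PP: "pd i (pd j P) p = - 2 * w p * (if i = j then 1 else 0) + (2 * (w p)\<^sup>2 + sg p) * h i j p
     + 2 * (p $ j * hy i + p $ i * hy j) + sg p * (\<Sum>m\<in>UNIV. p $ m * pd m (h i j) p)" for i j
    unfolding jets_P hy_def using pd3_sym[of i j] h_sym by (simp add: pd3_sym(1)[of i j] h_sym pd3_sym)
  \<comment> \<open>This is the constancy of |T|^2 to first order. It turns the derivative of the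
    Hessian along \<open>p\<close> into a derivative of \<open>P\<close>, which then cancels between
    \<open>S1\<close> and \<open>S3\<close>.\<close>
  have gr: "(\<Sum>i\<in>UNIV. \<Sum>j\<in>UNIV. h i j p * pd m (h i j) p) = c * P p * pd m P p" for m
    using jets_tr(1)[of m] E2_jets(2)[of m] unfolding c_def by simp
  have split: "h i j p * pd i (pd j P) p = - 2 * w p * (h i j p * (if i = j then 1 else 0))
     + (2 * (w p)\<^sup>2 + sg p) * (h i j p * h i j p)
     + (2 * (hy i * (h i j p * p $ j)) + 2 * (p $ i * (h i j p * hy j)))
     + sg p * (\<Sum>m\<in>UNIV. p $ m * (h i j p * pd m (h i j) p))" for i j
    unfolding PP by (simp add: algebra_simps sum_distrib_left)
  have swap: "(\<Sum>i\<in>UNIV. \<Sum>j\<in>UNIV. p $ i * (h i j p * hy j)) = (\<Sum>i\<in>UNIV. (hy i)\<^sup>2)"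
    by (subst sum.swap) (simp add: hy_def h_sym sum_distrib_right power2_eq_square mult_ac)
  have "(\<Sum>i\<in>UNIV. \<Sum>j\<in>UNIV. \<Sum>m\<in>UNIV. p $ m * (h i j p * pd m (h i j) p))
      = (\<Sum>i\<in>UNIV. \<Sum>m\<in>UNIV. \<Sum>j\<in>UNIV. p $ m * (h i j p * pd m (h i j) p))"
    by (intro sum.cong refl sum.swap)
  also have "\<dots> = (\<Sum>m\<in>UNIV. \<Sum>i\<in>UNIV. \<Sum>j\<in>UNIV. p $ m * (h i j p * pd m (h i j) p))"
    by (rule sum.swap)
  also have "\<dots> = (\<Sum>m\<in>UNIV. p $ m * (c * P p * pd m P p))"
    by (simp only: sum_distrib_left[symmetric] gr)
  also have "\<dots> = c * P p * (\<Sum>m\<in>UNIV. p $ m * pd m P p)" by (simp add: sum_distrib_left mult_ac)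
  finally have sw3: "(\<Sum>i\<in>UNIV. \<Sum>j\<in>UNIV. \<Sum>m\<in>UNIV. p $ m * (h i j p * pd m (h i j) p)) = \<dots>" .
  have "(\<Sum>i\<in>UNIV. \<Sum>j\<in>UNIV. h i j p * pd i (pd j P) p) = - 2 * w p * P p + (2 * (w p)\<^sup>2 + sg p) * tr p
     + 2 * (\<Sum>i\<in>UNIV. hy i * hy i) + 2 * (\<Sum>i\<in>UNIV. \<Sum>j\<in>UNIV. p $ i * (h i j p * hy j))
     + sg p * (\<Sum>i\<in>UNIV. \<Sum>j\<in>UNIV. \<Sum>m\<in>UNIV. p $ m * (h i j p * pd m (h i j) p))"
    unfolding split by (simp only: sum.distrib sum_distrib_left[symmetric] sum_delta_mult Py tr_def hy_def[symmetric])
  then have S1: "(\<Sum>i\<in>UNIV. \<Sum>j\<in>UNIV. h i j p * pd i (pd j P) p) = - 2 * w p * P p + (2 * (w p)\<^sup>2 + sg p) * tr p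
     + 4 * (\<Sum>i\<in>UNIV. (hy i)\<^sup>2) + sg p * (c * P p * (\<Sum>m\<in>UNIV. p $ m * pd m P p))"
    unfolding swap sw3 by (simp add: power2_eq_square)
  have "(\<Sum>l\<in>UNIV. \<Sum>m\<in>UNIV. p $ m * pd m (h l l) p) = (\<Sum>m\<in>UNIV. p $ m * pd m P p)"
    by (subst sum.swap) (simp only: sum_distrib_left[symmetric] Pm)
  moreover have "(\<Sum>l\<in>UNIV. pd l (pd l P) p) = - 2 * w p * real CARD('n) + (2 * (w p)\<^sup>2 + sg p) * P p
     + 4 * (\<Sum>i\<in>UNIV. p $ i * hy i) + sg p * (\<Sum>l\<in>UNIV. \<Sum>m\<in>UNIV. p $ m * pd m (h l l) p)"
    unfolding PP Py[symmetric] by (simp add: sum.distrib sum_subtractf sum_distrib_left[symmetric] mult.commute[of "hy _" "p $ _"])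
  ultimately have S2: "(\<Sum>l\<in>UNIV. pd l (pd l P) p) = - 2 * w p * real CARD('n) + (2 * (w p)\<^sup>2 + sg p) * P p
     + 4 * (\<Sum>i\<in>UNIV. p $ i * hy i) + sg p * (\<Sum>m\<in>UNIV. p $ m * pd m P p)" by simp
  have cn: "c * real CARD('n) = 1" by (simp add: c_def)
  have S3: "c * (Pl + P p * (\<Sum>l\<in>UNIV. pd l (pd l P) p)) = c * Pl - 2 * w p * P p + (2 * (w p)\<^sup>2 + sg p) * (c * (P p)\<^sup>2)
     + 4 * (c * P p * (\<Sum>i\<in>UNIV. p $ i * hy i)) + sg p * (c * P p * (\<Sum>m\<in>UNIV. p $ m * pd m P p))"
    unfolding S2 using cn by (simp add: algebra_simps power2_eq_square)
  have kk: "k = tr p - c * (P p)\<^sup>2" unfolding c_def by (rule E2_jets(1))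
  have sgp: "sg p = (\<Sum>i\<in>UNIV. (p $ i)\<^sup>2) - (w p)\<^sup>2" by (simp add: sg_def power2_eq_square)
  \<comment> \<open>The terms with the derivative of \<open>P\<close> along \<open>p\<close> and
    those linear in \<open>w p\<close> drop out, and \<open>kk\<close> collects what is multiplied
    by \<open>2 * (w p)\<^sup>2 + sg p\<close>. That factor is |p|^2 + w(p)^2: the first summand
    joins the terms covered by the operator inequality, the second is u^2.\<close>
  have "(\<Sum>l\<in>UNIV. nab l) - c * Pl + (2 * (w p)\<^sup>2 + sg p) * k
     + 4 * ((\<Sum>i\<in>UNIV. (hy i)\<^sup>2) - c * P p * (\<Sum>i\<in>UNIV. p $ i * hy i)) + k * tr p = 0"
    using main unfolding S1 S3 by (subst (1) kk) (simp add: algebra_simps)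
  then show ?thesis
    unfolding sgp hy_def[symmetric] Pl_def Pm nab_def
    by (simp add: sum_subtractf sum_distrib_left[symmetric] algebra_simps)
qed

text \<open>The hypothesis is the operator inequality tested on the single vector \<open>p\<close>.
  Comparing trace and norm by Cauchy-Schwarz serves twice: for the Hessian it gives \<open>k\<close>
  nonnegative, for its derivatives it gives the sign of |grad T|^2. What remains of
  \<open>bochner\<close> bounds \<open>k * tr p\<close>, hence k^2, by zero.\<close>

lemma umbilic_at_p:
  assumes pos: "4 * (\<Sum>i\<in>UNIV. (\<Sum>j\<in>UNIV. h i j p * p $ j)\<^sup>2)
      - 4 * (\<Sum>i\<in>UNIV. h i i p) / real CARD('n) * (\<Sum>i\<in>UNIV. p $ i * (\<Sum>j\<in>UNIV. h i j p * p $ j))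
      + k * (\<Sum>i\<in>UNIV. (p $ i)\<^sup>2) \<ge> 0"
  shows "k = 0"
proof -
  define c where "c = 1 / real CARD('n)"
  have c: "c \<ge> 0" by (simp add: c_def)
  have Py: "(\<Sum>i\<in>UNIV. h i i p) = P p" using E1_jets(1) by (simp add: lap_def)
  have trace_le: "c * (\<Sum>i\<in>UNIV. B i i)\<^sup>2 \<le> (\<Sum>i\<in>UNIV. \<Sum>j\<in>UNIV. (B i j)\<^sup>2)" for B :: "'n \<Rightarrow> 'n \<Rightarrow> real"
  proof -
    have "(\<Sum>i\<in>UNIV. B i i * 1)\<^sup>2 \<le> (\<Sum>i\<in>UNIV. (B i i)\<^sup>2) * (\<Sum>i\<in>(UNIV::'n set). 1\<^sup>2)"
      by (rule Cauchy_Schwarz_ineq_sum)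
    then have "c * (\<Sum>i\<in>UNIV. B i i)\<^sup>2 \<le> c * ((\<Sum>i\<in>UNIV. (B i i)\<^sup>2) * real CARD('n))"
      using c by (intro mult_left_mono) simp_all
    also have "\<dots> = (\<Sum>i\<in>UNIV. (B i i)\<^sup>2)" by (simp add: c_def)
    also have "\<dots> \<le> (\<Sum>i\<in>UNIV. \<Sum>j\<in>UNIV. (B i j)\<^sup>2)"
      by (intro sum_mono member_le_sum) auto
    finally show ?thesis .
  qed
  have k: "k \<ge> 0"
    using trace_le[of "\<lambda>i j. h i j p"] unfolding E2_jets(1) Py c_def[symmetric] by (simp add: tr_def power2_eq_square)
  have "0 \<le> (\<Sum>l\<in>UNIV. (\<Sum>i\<in>UNIV. \<Sum>j\<in>UNIV. (pd l (h i j) p)\<^sup>2) - c * (\<Sum>i\<in>UNIV. pd l (h i i) p)\<^sup>2)"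
    using trace_le by (intro sum_nonneg) (simp only: diff_ge_0_iff_ge)
  moreover have "0 \<le> 4 * ((\<Sum>i\<in>UNIV. (\<Sum>j\<in>UNIV. h i j p * p $ j)\<^sup>2) - c * P p * (\<Sum>i\<in>UNIV. p $ i * (\<Sum>j\<in>UNIV. h i j p * p $ j)))
    + k * (\<Sum>i\<in>UNIV. (p $ i)\<^sup>2)"
    using pos unfolding Py c_def by (simp add: algebra_simps)
  moreover have "0 \<le> k * (w p)\<^sup>2" using k by simp
  ultimately have "k * tr p \<le> 0" using bochner unfolding c_def[symmetric] by linarith
  moreover have "tr p \<ge> k" unfolding E2_jets(1) by simp
  then have "k * tr p \<ge> k * k" using k by (intro mult_left_mono)
  ultimately have "k * k \<le> 0" by linarith
  then show ?thesis using k by (simp add: mult_le_0_iff)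
qed

end

section \<open>Charts, parametrizations and curves\<close>

text \<open>Joint continuity in point and direction, again by a basis expansion. It serves
  velocities along curves and the minimum of the metric over a ball times the unit sphere.\<close>

lemma continuous_on_derivative_apply:
  fixes g :: "'a::euclidean_space \<Rightarrow> 'b::real_normed_vector"
  assumes g: "k_smooth_on 1 \<Omega> g" and q: "continuous_on S q" "q ` S \<subseteq> \<Omega>" and D: "continuous_on S D"
  shows "continuous_on S (\<lambda>t. frechet_derivative g (at (q t)) (D t))"
proof -
  have g1: "k_smooth_on (Suc 0) \<Omega> g" using g by simp
  have "frechet_derivative g (at (q t)) (D t) = (\<Sum>b\<in>Basis. (D t \<bullet> b) *\<^sub>R frechet_derivative g (at (q t)) b)" if "t \<in> S" for t
  proof -
    have "q t \<in> \<Omega>" using q(2) that by auto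
    then interpret linear "frechet_derivative g (at (q t))"
      using k_smooth_on_SucD(1)[OF g1] has_derivative_linear by blast
    show ?thesis by (subst (1) euclidean_representation[of "D t", symmetric]) (simp add: sum scale)
  qed
  moreover have "continuous_on S (\<lambda>t. \<Sum>b\<in>Basis. (D t \<bullet> b) *\<^sub>R frechet_derivative g (at (q t)) b)"
  proof (intro continuous_intros D)
    fix b
    have "continuous_on \<Omega> (dird b g)" using k_smooth_on_SucD(2)[OF g1] by simp
    then show "continuous_on S (\<lambda>t. frechet_derivative g (at (q t)) b)"
      using continuous_on_compose2[of \<Omega> "dird b g" S q] q by auto
  qed
  ultimately show ?thesis by (simp cong: continuous_on_cong)
qed

lemma lorentz_bilinear:
  "\<langle>a + b, c\<rangle>\<^sub>L = \<langle>a, c\<rangle>\<^sub>L + \<langle>b, c\<rangle>\<^sub>L" "\<langle>c, a + b\<rangle>\<^sub>L = \<langle>c, a\<rangle>\<^sub>L + \<langle>c, b\<rangle>\<^sub>L"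
  "\<langle>a - b, c\<rangle>\<^sub>L = \<langle>a, c\<rangle>\<^sub>L - \<langle>b, c\<rangle>\<^sub>L" "\<langle>c, a - b\<rangle>\<^sub>L = \<langle>c, a\<rangle>\<^sub>L - \<langle>c, b\<rangle>\<^sub>L"
  "\<langle>r *\<^sub>R a, c\<rangle>\<^sub>L = r * \<langle>a, c\<rangle>\<^sub>L" "\<langle>c, r *\<^sub>R a\<rangle>\<^sub>L = r * \<langle>c, a\<rangle>\<^sub>L"
  "\<langle>0, c\<rangle>\<^sub>L = 0" "\<langle>c, 0\<rangle>\<^sub>L = 0"
  by (simp_all add: lorentz_def inner_add_left inner_add_right inner_diff_left inner_diff_right algebra_simps)

lemma lorentz_commute: "\<langle>a, b\<rangle>\<^sub>L = \<langle>b, a\<rangle>\<^sub>L"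
  by (simp add: lorentz_def inner_commute)

locale spacelike_hypersurface =
  fixes M :: "'m topology" and \<A> :: "('m, 'n::finite) chart set" and x :: "'m \<Rightarrow> 'n lorentz_space"
  assumes mfd: "smooth_manifold M \<A>" and conn: "connected_space M" and ne: "topspace M \<noteq> {}"
    and imm: "spacelike_immersion M \<A> x"
begin

lemma hausdorff: "Hausdorff_space M" using mfd by (simp add: smooth_manifold_def)

lemma smooth_x: "smooth_map \<A> x" using imm by (simp add: spacelike_immersion_def)

lemma chart_atE:
  assumes "p \<in> topspace M"
  obtains U \<phi> where "chart_at \<A> p = (U, \<phi>)" "(U, \<phi>) \<in> \<A>" "p \<in> U"
proof -
  have "p \<in> (\<Union>(U, \<phi>)\<in>\<A>. U)" using assms mfd by (simp add: smooth_manifold_def smooth_atlas_def)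
  then have "\<exists>c. c \<in> \<A> \<and> p \<in> fst c" by force
  then have "chart_at \<A> p \<in> \<A> \<and> p \<in> fst (chart_at \<A> p)" unfolding chart_at_def by (rule someI_ex)
  then show ?thesis using that by (metis prod.collapse)
qed

lemma chartD:
  assumes "(U, \<phi>) \<in> \<A>"
  shows "openin M U" "open (\<phi> ` U)" "U \<subseteq> topspace M" "inj_on \<phi> U"
    "continuous_map (subtopology M U) euclidean \<phi>"
    "continuous_map (top_of_set (\<phi> ` U)) M (inv_into U \<phi>)"
    "openin M V \<Longrightarrow> V \<subseteq> U \<Longrightarrow> open (\<phi> ` V)"
    "open W \<Longrightarrow> W \<subseteq> \<phi> ` U \<Longrightarrow> openin M (inv_into U \<phi> ` W)"
proof -
  have c: "is_chart M (U, \<phi>)" using assms mfd unfolding smooth_manifold_def smooth_atlas_def by blast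
  then show U: "openin M U" and oU: "open (\<phi> ` U)" by (auto simp: is_chart_def)
  have hm: "homeomorphic_map (subtopology M U) (top_of_set (\<phi> ` U)) \<phi>" using c by (auto simp: is_chart_def)
  show sub: "U \<subseteq> topspace M" using U by (rule openin_subset)
  then have top: "topspace (subtopology M U) = U" by (simp add: inf.absorb2)
  show inj: "inj_on \<phi> U" using homeomorphic_imp_injective_map[OF hm] top by simp
  show "continuous_map (subtopology M U) euclidean \<phi>"
    using homeomorphic_imp_continuous_map[OF hm] continuous_map_in_subtopology by blast
  show V: "open (\<phi> ` V)" if "openin M V" "V \<subseteq> U" for V
  proof -
    have "openin (subtopology M U) V" using that openin_subset_topspace_eq openin_subtopology_alt
      by (metis inf.absorb1 openin_subtopology)
    then have "openin (top_of_set (\<phi> ` U)) (\<phi> ` V)"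
      using homeomorphic_imp_open_map[OF hm] by (simp add: open_map_def)
    then show ?thesis using oU openin_open_trans by blast
  qed
  have inv: "inv_into U \<phi> ` \<phi> ` B = B" if "B \<subseteq> U" for B
    using inj that by (simp add: inv_into_image_cancel)
  show ci: "continuous_map (top_of_set (\<phi> ` U)) M (inv_into U \<phi>)"
  proof -
    have "openin (top_of_set (\<phi> ` U)) {y \<in> \<phi> ` U. inv_into U \<phi> y \<in> B}" if "openin M B" for B
    proof -
      have "{y \<in> \<phi> ` U. inv_into U \<phi> y \<in> B} = \<phi> ` (U \<inter> B)" using inj by auto
      moreover have "open (\<phi> ` (U \<inter> B))" by (rule V) (use U that in auto)
      ultimately show ?thesis by (metis (no_types, lifting) image_mono inf_le1 open_subset)
    qed
    moreover have "inv_into U \<phi> y \<in> topspace M" if "y \<in> \<phi> ` U" for y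
      using that sub inv_into_into by (metis subsetD)
    ultimately show ?thesis by (auto simp: continuous_map_def)
  qed
  show "openin M (inv_into U \<phi> ` W)" if "open W" "W \<subseteq> \<phi> ` U" for W
  proof -
    have "openin (subtopology M U) {u \<in> U. \<phi> u \<in> W}"
      using homeomorphic_imp_continuous_map[OF hm] that
      unfolding continuous_map_def top by (metis (no_types, lifting) Collect_cong open_subset)
    moreover have "inv_into U \<phi> ` W = {u \<in> U. \<phi> u \<in> W}"
    proof -
      have "W = \<phi> ` {u \<in> U. \<phi> u \<in> W}" using that by auto
      then show ?thesis using inv[of "{u \<in> U. \<phi> u \<in> W}"] by auto
    qed
    ultimately show ?thesis using U openin_trans_full by metis
  qed
qed

lemma chart_inv:
  assumes "(U, \<phi>) \<in> \<A>"
  shows "p \<in> U \<Longrightarrow> inv_into U \<phi> (\<phi> p) = p" "z \<in> \<phi> ` U \<Longrightarrow> \<phi> (inv_into U \<phi> z) = z"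
    "z \<in> \<phi> ` U \<Longrightarrow> inv_into U \<phi> z \<in> U"
  using chartD(4)[OF assms] by (auto simp: f_inv_into_f)

lemma smooth_in_chart: "smooth_map \<A> f \<Longrightarrow> (U, \<phi>) \<in> \<A> \<Longrightarrow> smooth_on (\<phi> ` U) (f \<circ> inv_into U \<phi>)"
  by (auto simp: smooth_map_def)

section \<open>Parametrizations and their tangent maps\<close>

text \<open>One notion for inverse charts and for sections of the horizontal projection; the latter
  need not be inverse charts of \<open>\<A>\<close>, as the atlas need not be maximal.\<close>

definition smooth_param :: "(real ^ 'n) set \<Rightarrow> (real ^ 'n \<Rightarrow> 'm) \<Rightarrow> bool" where
  "smooth_param W \<xi> \<longleftrightarrow> open W \<and> continuous_map (top_of_set W) M \<xi> \<and>
     (\<forall>(U, \<phi>)\<in>\<A>. smooth_on {z \<in> W. \<xi> z \<in> U} (\<phi> \<circ> \<xi>))"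

lemma param_in: "smooth_param W \<xi> \<Longrightarrow> z \<in> W \<Longrightarrow> \<xi> z \<in> topspace M"
  by (auto simp: smooth_param_def continuous_map_def)

lemma param_smooth: "smooth_param W \<xi> \<Longrightarrow> (U, \<phi>) \<in> \<A> \<Longrightarrow> smooth_on {z \<in> W. \<xi> z \<in> U} (\<phi> \<circ> \<xi>)"
  by (auto simp: smooth_param_def)

lemma open_preimage:
  assumes "open W" "continuous_map (top_of_set W) M \<xi>" "openin M U" shows "open {z \<in> W. \<xi> z \<in> U}"
  using assms openin_open_trans unfolding continuous_map_def by auto

lemma param_open: "smooth_param W \<xi> \<Longrightarrow> openin M U \<Longrightarrow> open {z \<in> W. \<xi> z \<in> U}"
  unfolding smooth_param_def by (blast intro: open_preimage)

lemma chart_param: 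
  assumes "(U, \<phi>) \<in> \<A>" shows "smooth_param (\<phi> ` U) (inv_into U \<phi>)"
proof -
  have "smooth_on {z \<in> \<phi> ` U. inv_into U \<phi> z \<in> V} (\<psi> \<circ> inv_into U \<phi>)" if "(V, \<psi>) \<in> \<A>" for V \<psi>
  proof -
    have "{z \<in> \<phi> ` U. inv_into U \<phi> z \<in> V} = \<phi> ` (U \<inter> V)" using chartD(4)[OF assms] by auto
    then show ?thesis using mfd assms that unfolding smooth_manifold_def smooth_atlas_def by auto
  qed
  then show ?thesis using chartD[OF assms] by (auto simp: smooth_param_def)
qed

text \<open>\<open>differential\<close> expects its argument in the coordinates of
  \<open>chart_at\<close>. This map carries parameter vectors into those coordinates, so that the
  composite of the two is an ordinary derivative without any chosen chart.\<close>

definition tangent :: "(real ^ 'n \<Rightarrow> 'm) \<Rightarrow> real ^ 'n \<Rightarrow> real ^ 'n \<Rightarrow> real ^ 'n" where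
  "tangent \<xi> z = (case chart_at \<A> (\<xi> z) of (U, \<phi>) \<Rightarrow> frechet_derivative (\<phi> \<circ> \<xi>) (at z))"

lemma param_derivative:
  assumes \<xi>: "smooth_param W \<xi>" "z \<in> W" and f: "smooth_map \<A> f"
  shows "((f \<circ> \<xi>) has_derivative (\<lambda>v. differential \<A> f (\<xi> z) (tangent \<xi> z v))) (at z)"
    "linear (tangent \<xi> z)" "linear (differential \<A> f (\<xi> z))"
proof -
  obtain U \<phi> where c: "chart_at \<A> (\<xi> z) = (U, \<phi>)" "(U, \<phi>) \<in> \<A>" "\<xi> z \<in> U"
    using chart_atE[OF param_in[OF \<xi>]] by blast
  let ?T = "{z \<in> W. \<xi> z \<in> U}"
  have T: "open ?T" "z \<in> ?T" using param_open[OF \<xi>(1) chartD(1)[OF c(2)]] \<xi>(2) c(3) by auto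
  have s: "smooth_on ?T (\<phi> \<circ> \<xi>)" using \<xi>(1) c(2) by (auto simp: smooth_param_def)
  have d1: "((\<phi> \<circ> \<xi>) has_derivative tangent \<xi> z) (at z)"
    using smooth_imp_has_derivative[OF s T(2)] by (simp add: tangent_def c)
  have d2: "((f \<circ> inv_into U \<phi>) has_derivative differential \<A> f (\<xi> z)) (at (\<phi> (\<xi> z)))"
    using smooth_imp_has_derivative[OF smooth_in_chart[OF f c(2)], of "\<phi> (\<xi> z)"] c by (simp add: differential_def)
  show "linear (tangent \<xi> z)" "linear (differential \<A> f (\<xi> z))" using d1 d2 has_derivative_linear by blast+
  have "((\<lambda>u. (f \<circ> inv_into U \<phi>) ((\<phi> \<circ> \<xi>) u)) has_derivative (\<lambda>v. differential \<A> f (\<xi> z) (tangent \<xi> z v))) (at z)"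
    by (rule has_derivative_compose[OF d1]) (subst o_apply, rule d2)
  then show "((f \<circ> \<xi>) has_derivative (\<lambda>v. differential \<A> f (\<xi> z) (tangent \<xi> z v))) (at z)"
    by (rule has_derivative_transform_within_open[OF _ T]) (use chart_inv[OF c(2)] in auto)
qed

lemma differential_linear:
  assumes "p \<in> topspace M" "smooth_map \<A> f" shows "linear (differential \<A> f p)"
proof -
  obtain U \<phi> where c: "chart_at \<A> p = (U, \<phi>)" "(U, \<phi>) \<in> \<A>" "p \<in> U" using chart_atE[OF assms(1)] .
  have "((f \<circ> inv_into U \<phi>) has_derivative differential \<A> f p) (at (\<phi> p))"
    using smooth_imp_has_derivative[OF smooth_in_chart[OF assms(2) c(2)], of "\<phi> p"] c by (simp add: differential_def)
  then show ?thesis by (rule has_derivative_linear)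
qed

lemma smooth_on_param:
  assumes \<xi>: "smooth_param W \<xi>" and f: "smooth_map \<A> f" shows "smooth_on W (f \<circ> \<xi>)"
  unfolding smooth_on_def
proof (intro allI k_smooth_on_local)
  fix k z assume z: "z \<in> W"
  obtain U \<phi> where c: "chart_at \<A> (\<xi> z) = (U, \<phi>)" "(U, \<phi>) \<in> \<A>" "\<xi> z \<in> U"
    using chart_atE[OF param_in[OF \<xi> z]] by blast
  let ?T = "{z \<in> W. \<xi> z \<in> U}"
  have T: "open ?T" "z \<in> ?T" using param_open[OF \<xi>(1) chartD(1)[OF c(2)]] z c(3) by auto
  have "k_smooth_on k ?T (\<lambda>z. (f \<circ> inv_into U \<phi>) ((\<phi> \<circ> \<xi>) z))"
  proof (rule k_smooth_on_compose[OF T(1) chartD(2)[OF c(2)]])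
    show "k_smooth_on k ?T (\<phi> \<circ> \<xi>)" using \<xi>(1) c(2) by (auto simp: smooth_param_def smooth_on_def)
    show "k_smooth_on k (\<phi> ` U) (f \<circ> inv_into U \<phi>)" using smooth_in_chart[OF f c(2)] by (simp add: smooth_on_def)
  qed auto
  then have "k_smooth_on k ?T (f \<circ> \<xi>)"
    by (rule k_smooth_on_cong[OF T(1), rotated]) (use chart_inv[OF c(2)] in auto)
  then show "\<exists>T. open T \<and> z \<in> T \<and> k_smooth_on k T (f \<circ> \<xi>)" using T by blast
qed

lemma metric_pos:
  assumes "p \<in> topspace M" shows "v \<noteq> 0 \<Longrightarrow> induced_metric \<A> x p v v > 0" "induced_metric \<A> x p v v \<ge> 0"
proof -
  show *: "v \<noteq> 0 \<Longrightarrow> induced_metric \<A> x p v v > 0" for v using imm assms by (auto simp: spacelike_immersion_def)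
  show "induced_metric \<A> x p v v \<ge> 0"
    using *[of v] linear_0[OF differential_linear[OF assms smooth_x]]
    by (cases "v = 0") (auto simp: induced_metric_def lorentz_bilinear)
qed

text \<open>The tangent map is the derivative of a transition map, and the reverse transition
  provides a left inverse by the chain rule.\<close>

lemma chart_tangent_inj:
  assumes c: "(U, \<phi>) \<in> \<A>" and z: "z \<in> \<phi> ` U" shows "inj (tangent (inv_into U \<phi>) z)"
proof -
  let ?p = "inv_into U \<phi> z"
  have p: "?p \<in> U" using chart_inv(3)[OF c z] .
  obtain V \<psi> where d: "chart_at \<A> ?p = (V, \<psi>)" "(V, \<psi>) \<in> \<A>" "?p \<in> V"
    using chart_atE[of ?p] p chartD(3)[OF c] by blast
  let ?T = "{y \<in> \<phi> ` U. inv_into U \<phi> y \<in> V}" and ?T' = "{y \<in> \<psi> ` V. inv_into V \<psi> y \<in> U}"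
  have T: "open ?T" "z \<in> ?T"
    using param_open[OF chart_param[OF c] chartD(1)[OF d(2)]] z d(3) by auto
  have d1: "((\<psi> \<circ> inv_into U \<phi>) has_derivative tangent (inv_into U \<phi>) z) (at z)"
    using smooth_imp_has_derivative[of ?T, OF _ T(2)] chart_param[OF c] d by (auto simp: tangent_def smooth_param_def)
  have zz: "\<psi> ?p \<in> ?T'" using chart_inv(1)[OF d(2,3)] p d(3) by auto
  obtain G where d2: "((\<phi> \<circ> inv_into V \<psi>) has_derivative G) (at (\<psi> ?p))"
    using smooth_imp_has_derivative[OF param_smooth[OF chart_param[OF d(2)] c] zz] by blast
  have "((\<lambda>y. (\<phi> \<circ> inv_into V \<psi>) ((\<psi> \<circ> inv_into U \<phi>) y)) has_derivative (\<lambda>v. G (tangent (inv_into U \<phi>) z v))) (at z)"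
    by (rule has_derivative_compose[OF d1]) (subst o_apply, rule d2)
  then have "((\<lambda>y. y) has_derivative (\<lambda>v. G (tangent (inv_into U \<phi>) z v))) (at z)"
    by (rule has_derivative_transform_within_open[OF _ T]) (use chart_inv[OF c] chart_inv[OF d(2)] in auto)
  then have "(\<lambda>v. G (tangent (inv_into U \<phi>) z v)) = (\<lambda>v. v)"
    using has_derivative_unique has_derivative_ident by blast
  then show ?thesis by (metis injI)
qed

lemma chart_spacelike:
  assumes c: "(U, \<phi>) \<in> \<A>" and z: "z \<in> \<phi> ` U" and v: "v \<noteq> 0"
  shows "\<langle>frechet_derivative (x \<circ> inv_into U \<phi>) (at z) v, frechet_derivative (x \<circ> inv_into U \<phi>) (at z) v\<rangle>\<^sub>L > 0"
proof -
  note pd = param_derivative[OF chart_param[OF c] z smooth_x]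
  have "frechet_derivative (x \<circ> inv_into U \<phi>) (at z) v = differential \<A> x (inv_into U \<phi> z) (tangent (inv_into U \<phi>) z v)"
    using frechet_derivative_eqI[OF pd(1)] by simp
  moreover have "tangent (inv_into U \<phi>) z v \<noteq> 0"
    using v chart_tangent_inj[OF c z] linear_0[OF pd(2)] by (metis injD)
  ultimately show ?thesis
    using metric_pos(1)[OF param_in[OF chart_param[OF c] z]] by (simp add: induced_metric_def)
qed

lemma piece_derivative:
  assumes c: "(U, \<phi>) \<in> \<A>" and g: "\<gamma> ` {a..b} \<subseteq> U" and D: "continuous_on {a..b} D"
    and der: "\<And>t. t \<in> {a..b} \<Longrightarrow> ((\<phi> \<circ> \<gamma>) has_vector_derivative D t) (at t within {a..b})"
    and f: "smooth_map \<A> f"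
  shows "continuous_on {a..b} (\<lambda>t. frechet_derivative (f \<circ> inv_into U \<phi>) (at (\<phi> (\<gamma> t))) (D t))"
    "\<And>t. t \<in> {a..b} \<Longrightarrow> ((f \<circ> \<gamma>) has_vector_derivative frechet_derivative (f \<circ> inv_into U \<phi>) (at (\<phi> (\<gamma> t))) (D t)) (at t within {a..b})"
proof -
  have "continuous_on {a..b} (\<phi> \<circ> \<gamma>)"
    by (rule continuous_on_vector_derivative) (use der in auto)
  moreover have "(\<phi> \<circ> \<gamma>) ` {a..b} \<subseteq> \<phi> ` U" using g by auto
  moreover have "k_smooth_on 1 (\<phi> ` U) (f \<circ> inv_into U \<phi>)" using smooth_in_chart[OF f c] by (simp add: smooth_on_def)
  ultimately have "continuous_on {a..b} (\<lambda>t. frechet_derivative (f \<circ> inv_into U \<phi>) (at ((\<phi> \<circ> \<gamma>) t)) (D t))"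
    by (intro continuous_on_derivative_apply[where \<Omega> = "\<phi> ` U"] D)
  then show "continuous_on {a..b} (\<lambda>t. frechet_derivative (f \<circ> inv_into U \<phi>) (at (\<phi> (\<gamma> t))) (D t))" by simp
  fix t assume t: "t \<in> {a..b}"
  then have "\<phi> (\<gamma> t) \<in> \<phi> ` U" using g by blast
  then have d: "((f \<circ> inv_into U \<phi>) has_derivative frechet_derivative (f \<circ> inv_into U \<phi>) (at (\<phi> (\<gamma> t)))) (at ((\<phi> \<circ> \<gamma>) t) within (\<phi> \<circ> \<gamma>) ` {a..b})"
    using smooth_imp_has_derivative[OF smooth_in_chart[OF f c]] has_derivative_at_withinI by fastforce
  have "(((f \<circ> inv_into U \<phi>) \<circ> (\<phi> \<circ> \<gamma>)) has_vector_derivative frechet_derivative (f \<circ> inv_into U \<phi>) (at (\<phi> (\<gamma> t))) (D t)) (at t within {a..b})"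
    by (rule vector_derivative_diff_chain_within[OF der[OF t] d])
  then show "((f \<circ> \<gamma>) has_vector_derivative frechet_derivative (f \<circ> inv_into U \<phi>) (at (\<phi> (\<gamma> t))) (D t)) (at t within {a..b})"
    by (rule has_vector_derivative_transform[OF t, rotated]) (use chart_inv(1)[OF c] g in \<open>simp add: image_subset_iff\<close>)
qed

section \<open>Piecewise C1 curves and their speed\<close>

text \<open>The break points become a parameter, so that they can be avoided, transported by a
  reparametrization and united for concatenated curves.\<close>

definition C1_off :: "real set \<Rightarrow> (real \<Rightarrow> 'm) \<Rightarrow> bool" where
  "C1_off T \<gamma> \<longleftrightarrow> finite T \<and> continuous_map (top_of_set {0..1}) M \<gamma> \<and>
     (\<forall>(U, \<phi>)\<in>\<A>. \<forall>a b. 0 \<le> a \<and> a < b \<and> b \<le> 1 \<and> {a<..<b} \<inter> T = {} \<and> \<gamma> ` {a..b} \<subseteq> U \<longrightarrow>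
         (\<exists>D. continuous_on {a..b} D \<and>
           (\<forall>t\<in>{a..b}. ((\<phi> \<circ> \<gamma>) has_vector_derivative D t) (at t within {a..b}))))"

lemma C1_offD:
  assumes "C1_off T \<gamma>" "0 \<le> a" "a < b" "b \<le> 1" "{a<..<b} \<inter> T = {}" "(U, \<phi>) \<in> \<A>" "\<gamma> ` {a..b} \<subseteq> U"
  obtains D where "continuous_on {a..b} D"
    "\<And>t. t \<in> {a..b} \<Longrightarrow> ((\<phi> \<circ> \<gamma>) has_vector_derivative D t) (at t within {a..b})"
proof -
  have "\<forall>(U, \<phi>)\<in>\<A>. \<forall>a b. 0 \<le> a \<and> a < b \<and> b \<le> 1 \<and> {a<..<b} \<inter> T = {} \<and> \<gamma> ` {a..b} \<subseteq> U \<longrightarrow>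
         (\<exists>D. continuous_on {a..b} D \<and>
           (\<forall>t\<in>{a..b}. ((\<phi> \<circ> \<gamma>) has_vector_derivative D t) (at t within {a..b})))"
    using assms(1) by (simp add: C1_off_def)
  from bspec[OF this assms(6), unfolded split_conv] show thesis using assms that by meson
qed

lemma piecewise_C1_curve_iff: "piecewise_C1_curve M \<A> \<gamma> \<longleftrightarrow> (\<exists>T. C1_off T \<gamma>)"
  unfolding piecewise_C1_curve_def C1_off_def by auto

lemma C1_off_in: "C1_off T \<gamma> \<Longrightarrow> t \<in> {0..1} \<Longrightarrow> \<gamma> t \<in> topspace M"
  by (auto simp: C1_off_def continuous_map_def)

lemma curve_near:
  assumes \<gamma>: "continuous_map (top_of_set {0..1}) M \<gamma>" and t: "t \<in> {0..1::real}" and U: "openin M U" "\<gamma> t \<in> U" and T: "finite T"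
  obtains d where "d > 0" "\<And>s. s \<in> {0..1} \<Longrightarrow> \<bar>s - t\<bar> < d \<Longrightarrow> \<gamma> s \<in> U" "ball t d \<inter> T \<subseteq> {t}"
proof -
  have "openin (top_of_set {0..1}) {s \<in> {0..1}. \<gamma> s \<in> U}" using \<gamma> U by (simp add: continuous_map_def)
  then have "\<forall>r\<in>{s \<in> {0..1}. \<gamma> s \<in> U}. \<exists>e>0. \<forall>s\<in>{0..1}. dist s r < e \<longrightarrow> s \<in> {s \<in> {0..1}. \<gamma> s \<in> U}"
    unfolding openin_euclidean_subtopology_iff by (rule conjunct2)
  moreover have "t \<in> {s \<in> {0..1}. \<gamma> s \<in> U}" using t U(2) by simp
  ultimately obtain d1 where d1: "d1 > 0" "\<And>s. s \<in> {0..1} \<Longrightarrow> dist s t < d1 \<Longrightarrow> \<gamma> s \<in> U"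
    by (metis (no_types, lifting) mem_Collect_eq)
  obtain d2 where d2: "d2 > 0" "\<forall>s\<in>T. s \<noteq> t \<longrightarrow> d2 \<le> dist t s"
    using finite_set_avoid[OF T, of t] by blast
  show thesis
    by (rule that[of "min d1 d2"]) (use d1 d2 in \<open>auto simp: dist_real_def\<close>)
qed

text \<open>Around \<open>t\<close> there is an interval inside [0, 1] and one chart, without break
  points; there the one-sided derivative at \<open>t\<close> is two-sided. A single coordinate
  velocity \<open>d\<close> serves all maps \<open>f\<close>.\<close>

lemma curve_interior:
  assumes \<gamma>: "C1_off T \<gamma>" and t: "0 < t" "t < 1" "t \<notin> T" and c: "(U, \<phi>) \<in> \<A>" "\<gamma> t \<in> U"
  obtains d where "((\<phi> \<circ> \<gamma>) has_vector_derivative d) (at t)"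
    "\<And>f :: 'm \<Rightarrow> 'n lorentz_space. smooth_map \<A> f \<Longrightarrow> ((f \<circ> \<gamma>) has_vector_derivative frechet_derivative (f \<circ> inv_into U \<phi>) (at (\<phi> (\<gamma> t))) d) (at t)"
proof -
  obtain d where d: "d > 0" "\<And>s. s \<in> {0..1} \<Longrightarrow> \<bar>s - t\<bar> < d \<Longrightarrow> \<gamma> s \<in> U" "ball t d \<inter> T \<subseteq> {t}"
    using curve_near[of \<gamma> t U T] \<gamma> t c chartD(1)[OF c(1)] by (auto simp: C1_off_def)
  define e where "e = min (d / 2) (min t (1 - t))"
  have e: "e > 0" "e \<le> d / 2" "e \<le> t" "e \<le> 1 - t"
    unfolding e_def using d(1) t by (simp, intro min.cobounded1, auto)
  let ?a = "t - e" and ?b = "t + e"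
  have sub: "\<gamma> ` {?a..?b} \<subseteq> U" using d(1,2) e by (auto simp: abs_if)
  have "s \<notin> T" if "s \<in> {?a<..<?b}" for s
  proof
    assume "s \<in> T"
    moreover have "s \<in> ball t d" using that e d(1) by (auto simp: dist_real_def)
    ultimately show False using d(3) t(3) by blast
  qed
  then have disj: "{?a<..<?b} \<inter> T = {}" by blast
  have z: "0 \<le> ?a" "?a < ?b" "?b \<le> 1" using e by auto
  obtain D where D: "continuous_on {?a..?b} D"
    "\<And>s. s\<in>{?a..?b} \<Longrightarrow> ((\<phi> \<circ> \<gamma>) has_vector_derivative D s) (at s within {?a..?b})"
    using C1_offD[OF \<gamma> z disj c(1) sub] by blast
  have w: "at t within {?a..?b} = at t" by (rule at_within_interior) (use e in auto)
  have t': "t \<in> {?a..?b}" using e by auto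
  show thesis
    by (rule that[of "D t"]) (use D(2)[OF t'] piece_derivative(2)[OF c(1) sub D _ t'] w in auto)
qed

definition speed :: "(real \<Rightarrow> 'm) \<Rightarrow> real \<Rightarrow> real" where
  "speed \<gamma> t = sqrt (induced_metric \<A> x (\<gamma> t) (velocity \<A> \<gamma> t) (velocity \<A> \<gamma> t))"

lemma curve_length_eq: "curve_length \<A> x \<gamma> = integral {0..1} (speed \<gamma>)"
  by (simp add: curve_length_def speed_def[abs_def])

text \<open>The speed is defined through the charts picked by \<open>chart_at\<close>, which jump
  along the curve. Off the break points it depends only on the derivative of the curve in Lorentz
  space, and every later estimate uses this form.\<close>

lemma speed_eq:
  assumes \<gamma>: "C1_off T \<gamma>" and t: "0 < t" "t < 1" "t \<notin> T" and d: "((x \<circ> \<gamma>) has_vector_derivative d) (at t)"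
  shows "speed \<gamma> t = sqrt \<langle>d, d\<rangle>\<^sub>L"
proof -
  have "\<gamma> t \<in> topspace M" using C1_off_in[OF \<gamma>] t by simp
  then obtain U \<phi> where c: "chart_at \<A> (\<gamma> t) = (U, \<phi>)" "(U, \<phi>) \<in> \<A>" "\<gamma> t \<in> U" by (rule chart_atE)
  obtain v where v: "((\<phi> \<circ> \<gamma>) has_vector_derivative v) (at t)"
    "((x \<circ> \<gamma>) has_vector_derivative frechet_derivative (x \<circ> inv_into U \<phi>) (at (\<phi> (\<gamma> t))) v) (at t)"
    using curve_interior[OF \<gamma> t c(2,3)] smooth_x by metis
  have "velocity \<A> \<gamma> t = v" using v(1) c by (simp add: velocity_def vector_derivative_at)
  moreover have "frechet_derivative (x \<circ> inv_into U \<phi>) (at (\<phi> (\<gamma> t))) v = d"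
    using vector_derivative_unique_at v(2) d by blast
  ultimately show ?thesis using c by (simp add: speed_def induced_metric_def differential_def)
qed

lemma curve_differentiable:
  assumes \<gamma>: "C1_off T \<gamma>" and t: "0 < t" "t < 1" "t \<notin> T"
  obtains d where "((x \<circ> \<gamma>) has_vector_derivative d) (at t)" "speed \<gamma> t = sqrt \<langle>d, d\<rangle>\<^sub>L"
proof -
  have "\<gamma> t \<in> topspace M" using C1_off_in[OF \<gamma>] t by simp
  then obtain U \<phi> where c: "chart_at \<A> (\<gamma> t) = (U, \<phi>)" "(U, \<phi>) \<in> \<A>" "\<gamma> t \<in> U" by (rule chart_atE)
  show thesis using curve_interior[OF \<gamma> t c(2,3)] smooth_x that speed_eq[OF \<gamma> t] by metis
qed

lemma speed_nonneg: "C1_off T \<gamma> \<Longrightarrow> t \<in> {0..1} \<Longrightarrow> speed \<gamma> t \<ge> 0"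
  unfolding speed_def by (intro real_sqrt_ge_zero metric_pos(2) C1_off_in)

text \<open>The one-sided derivatives make the Lorentz speed continuous up to both ends. At the ends
  themselves \<open>velocity\<close> is a two-sided derivative, which may not exist, so the two
  functions are compared off a finite set.\<close>

lemma speed_integrable_piece:
  assumes \<gamma>: "C1_off T \<gamma>" and ab: "0 \<le> a" "a \<le> b" "b \<le> 1" "{a<..<b} \<inter> T = {}" and c: "(U, \<phi>) \<in> \<A>" "\<gamma> ` {a..b} \<subseteq> U"
  shows "speed \<gamma> integrable_on {a..b}"
proof (cases "a = b")
  case False
  then have ab': "a < b" using ab by simp
  obtain D where D: "continuous_on {a..b} D"
    "\<And>t. t\<in>{a..b} \<Longrightarrow> ((\<phi> \<circ> \<gamma>) has_vector_derivative D t) (at t within {a..b})"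
    using C1_offD[OF \<gamma> ab(1) ab' ab(3,4) c] by blast
  let ?E = "\<lambda>t. frechet_derivative (x \<circ> inv_into U \<phi>) (at (\<phi> (\<gamma> t))) (D t)"
  have pE1: "continuous_on {a..b} ?E" by (rule piece_derivative(1)[OF c D(1) D(2) smooth_x])
  have pE2: "((x \<circ> \<gamma>) has_vector_derivative ?E t) (at t within {a..b})" if "t \<in> {a..b}" for t
    by (rule piece_derivative(2)[OF c D(1) D(2) smooth_x that])
  have "continuous_on {a..b} (\<lambda>t. sqrt \<langle>?E t, ?E t\<rangle>\<^sub>L)"
    unfolding lorentz_def by (intro continuous_intros pE1)
  then have "(\<lambda>t. sqrt \<langle>?E t, ?E t\<rangle>\<^sub>L) integrable_on {a..b}" by (rule integrable_continuous_real)
  moreover have "speed \<gamma> t = sqrt \<langle>?E t, ?E t\<rangle>\<^sub>L" if "t \<in> {a..b} - {a, b}" for t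
  proof -
    have w: "at t within {a..b} = at t" by (rule at_within_interior) (use that in auto)
    have t: "t \<in> {a..b}" "0 < t" "t < 1" "t \<in> {a<..<b}" using that ab by auto
    then have t4: "t \<notin> T" using ab(4) by blast
    show ?thesis using speed_eq[OF \<gamma> t(2,3) t4 pE2[OF t(1), unfolded w]] .
  qed
  ultimately show ?thesis by (intro integrable_spike_finite[of "{a, b}" _ "speed \<gamma>"]) auto
qed (use integrable_on_refl[of "speed \<gamma>" b] in simp)

lemma speed_integrable:
  assumes \<gamma>: "C1_off T \<gamma>" shows "speed \<gamma> integrable_on {0..1}"
proof -
  \<comment> \<open>Integrability is local. A short interval around \<open>t\<close> lies in one
    chart and contains no break point except possibly \<open>t\<close>, so it is cut there.\<close>
  have "\<forall>t\<in>cbox 0 1. \<exists>d>0. \<forall>u v. t \<in> cbox u v \<and> cbox u v \<subseteq> ball t d \<and> cbox u v \<subseteq> cbox 0 1 \<longrightarrow> speed \<gamma> integrable_on cbox u v"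
  proof
    fix t :: real assume "t \<in> cbox 0 1"
    then have t: "t \<in> {0..1}" by simp
    then obtain U \<phi> where c: "(U, \<phi>) \<in> \<A>" "\<gamma> t \<in> U" using chart_atE C1_off_in[OF \<gamma>] by metis
    obtain d where d: "d > 0" "\<And>s. s \<in> {0..1} \<Longrightarrow> \<bar>s - t\<bar> < d \<Longrightarrow> \<gamma> s \<in> U" "ball t d \<inter> T \<subseteq> {t}"
      using curve_near[of \<gamma> t U T] \<gamma> t c chartD(1)[OF c(1)] by (auto simp: C1_off_def)
    have "speed \<gamma> integrable_on cbox u v" if uv: "t \<in> cbox u v" "cbox u v \<subseteq> ball t d" "cbox u v \<subseteq> cbox 0 1" for u v
    proof -
      have uv': "u \<le> t" "t \<le> v" "{u..v} \<subseteq> ball t d" "0 \<le> u" "v \<le> 1" using uv by (auto simp: subset_iff)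
      have t01: "0 \<le> t" "t \<le> 1" using uv' by auto
      have U: "\<gamma> ` {u..v} \<subseteq> U"
      proof safe
        fix s assume s: "s \<in> {u..v}"
        then have "s \<in> ball t d" using uv' by blast
        then show "\<gamma> s \<in> U" using d(2)[of s] s uv' by (auto simp: dist_real_def abs_minus_commute)
      qed
      have T: "s \<notin> T" if "s \<in> {u..v}" "s \<noteq> t" for s using d(3) that uv'(3) by blast
      have sets: "{u<..<t} \<inter> T = {}" "{t<..<v} \<inter> T = {}" "\<gamma> ` {u..t} \<subseteq> U" "\<gamma> ` {t..v} \<subseteq> U"
        using T U uv'(1,2) by auto
      have "speed \<gamma> integrable_on {u..t}" "speed \<gamma> integrable_on {t..v}"
        using speed_integrable_piece[OF \<gamma> uv'(4,1) t01(2) sets(1) c(1) sets(3)]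
          speed_integrable_piece[OF \<gamma> t01(1) uv'(2,5) sets(2) c(1) sets(4)] by blast+
      from Henstock_Kurzweil_Integration.integrable_combine[OF uv'(1,2) this] show ?thesis by simp
    qed
    then show "\<exists>d>0. \<forall>u v. t \<in> cbox u v \<and> cbox u v \<subseteq> ball t d \<and> cbox u v \<subseteq> cbox 0 1 \<longrightarrow> speed \<gamma> integrable_on cbox u v"
      using d(1) by blast
  qed
  then show ?thesis using integrable_on_little_subintervals by (metis box_real(2))
qed

lemma curve_length_nonneg: "C1_off T \<gamma> \<Longrightarrow> curve_length \<A> x \<gamma> \<ge> 0"
  unfolding curve_length_eq by (intro integral_nonneg speed_integrable speed_nonneg) auto

end

section \<open>The induced distance\<close>

definition join_curve :: "(real \<Rightarrow> 'a) \<Rightarrow> (real \<Rightarrow> 'a) \<Rightarrow> real \<Rightarrow> 'a" where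
  "join_curve \<gamma> \<eta> = (\<lambda>t. if t \<le> 1 / 2 then \<gamma> (2 * t) else \<eta> (2 * t - 1))"

context spacelike_hypersurface
begin

section \<open>Reversal, concatenation and coordinate segments\<close>

lemma affine_image: 
  assumes "a \<le> b" "m \<noteq> (0::real)"
  shows "(\<lambda>t. m * t + c) ` {a..b} = {min (m * a + c) (m * b + c)..max (m * a + c) (m * b + c)}"
  using image_affinity_atLeastAtMost[of m c a b] assms by (auto simp: min_def max_def)

text \<open>The slope may be negative: reversal has \<open>m = -1\<close>, the halves of a
  concatenation have \<open>m = 2\<close>. The ends of the image interval are therefore a minimum
  and a maximum.\<close>

lemma affine_piece:
  assumes \<eta>: "C1_off T \<eta>" and m: "m \<noteq> 0" and ab: "a < b"
    and sub: "(\<lambda>t. m * t + c) ` {a..b} \<subseteq> {0..1}" and off: "\<And>t. t \<in> {a<..<b} \<Longrightarrow> m * t + c \<notin> T"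
    and eq: "\<And>t. t \<in> {a..b} \<Longrightarrow> \<gamma> t = \<eta> (m * t + c)"
    and U: "(U, \<phi>) \<in> \<A>" "\<gamma> ` {a..b} \<subseteq> U"
  shows "\<exists>D. continuous_on {a..b} D \<and> (\<forall>t\<in>{a..b}. ((\<phi> \<circ> \<gamma>) has_vector_derivative D t) (at t within {a..b}))"
proof -
  let ?s = "\<lambda>t. m * t + c"
  define a' b' where "a' = min (?s a) (?s b)" and "b' = max (?s a) (?s b)"
  have im: "?s ` {a..b} = {a'..b'}" unfolding a'_def b'_def by (rule affine_image) (use ab m in auto)
  have ab': "a' < b'" using ab m by (simp add: a'_def b'_def min_def max_def less_le)
  have "{a'..b'} \<subseteq> {0..1}" using sub im by simp
  then have bd: "0 \<le> a'" "b' \<le> 1" using ab' by auto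
  have disj: "{a'<..<b'} \<inter> T = {}"
  proof -
    have "s \<notin> T" if s: "s \<in> {a'<..<b'}" for s
    proof -
      have "s \<in> ?s ` {a..b}" using s im by auto
      then obtain t where t: "t \<in> {a..b}" "s = ?s t" by blast
      have "t \<noteq> a" "t \<noteq> b" using s t(2) by (auto simp: a'_def b'_def min_def max_def split: if_splits)
      then show ?thesis using off[of t] t by auto
    qed
    then show ?thesis by blast
  qed
  have "\<eta> ` {a'..b'} \<subseteq> U" unfolding im[symmetric] using U(2) eq by auto
  then obtain D where D: "continuous_on {a'..b'} D"
    "\<And>t. t \<in> {a'..b'} \<Longrightarrow> ((\<phi> \<circ> \<eta>) has_vector_derivative D t) (at t within {a'..b'})"
    using C1_offD[OF \<eta> bd(1) ab' bd(2) disj U(1)] by blast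
  show ?thesis
  proof (intro exI conjI ballI)
    show "continuous_on {a..b} (\<lambda>t. m *\<^sub>R D (?s t))"
      by (intro continuous_intros continuous_on_compose2[OF D(1)]) (use im in auto)
    fix t assume t: "t \<in> {a..b}"
    have "(?s has_vector_derivative m) (at t within {a..b})" by (auto intro!: derivative_eq_intros)
    moreover have "?s t \<in> {a'..b'}" unfolding im[symmetric] using t by (rule imageI)
    then have "((\<phi> \<circ> \<eta>) has_vector_derivative D (?s t)) (at (?s t) within ?s ` {a..b})"
      unfolding im by (rule D(2))
    ultimately have "(((\<phi> \<circ> \<eta>) \<circ> ?s) has_vector_derivative m *\<^sub>R D (?s t)) (at t within {a..b})"
      by (rule vector_diff_chain_within)
    then show "((\<phi> \<circ> \<gamma>) has_vector_derivative m *\<^sub>R D (?s t)) (at t within {a..b})"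
      by (rule has_vector_derivative_transform[OF t, rotated]) (use eq in simp)
  qed
qed

text \<open>The speed is multiplied by |m| and the parameter interval divided by it. The exceptional
  set \<open>E\<close> holds the ends and the break points of both curves.\<close>

lemma affine_length:
  assumes \<gamma>: "C1_off T' \<gamma>" and \<eta>: "C1_off T \<eta>" and m: "m \<noteq> 0" and ab: "0 \<le> a" "a < b" "b \<le> 1"
    and im: "(\<lambda>t. m * t + c) ` {a..b} = {0..1}"
    and eq: "\<And>t. t \<in> {a..b} \<Longrightarrow> \<gamma> t = \<eta> (m * t + c)"
  shows "(speed \<gamma> has_integral curve_length \<A> x \<eta>) {a..b}"
proof -
  let ?s = "\<lambda>t. m * t + c"
  have "(speed \<eta> has_integral curve_length \<A> x \<eta>) (cbox 0 1)"
    unfolding curve_length_eq using integrable_integral[OF speed_integrable[OF \<eta>]] by simp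
  from has_integral_affinity[OF this m, of c]
  have "((\<lambda>t. speed \<eta> (?s t)) has_integral (1 / \<bar>m\<bar>) * curve_length \<A> x \<eta>) ((\<lambda>x. (1 / m) * x + - ((1 / m) * c)) ` {0..1})"
    by simp
  moreover have "(\<lambda>x. (1 / m) * x + - ((1 / m) * c)) ` {0..1} = {a..b}"
    unfolding im[symmetric] image_image using m by (simp add: field_simps)
  ultimately have "((\<lambda>t. speed \<eta> (?s t)) has_integral (1 / \<bar>m\<bar>) * curve_length \<A> x \<eta>) {a..b}" by simp
  from has_integral_mult_right[OF this, of "\<bar>m\<bar>"]
  have I: "((\<lambda>t. \<bar>m\<bar> * speed \<eta> (?s t)) has_integral curve_length \<A> x \<eta>) {a..b}" using m by simp
  define E where "E = T' \<union> {a, b} \<union> (\<lambda>u. (u - c) / m) ` T"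
  have "finite E" using \<gamma> \<eta> by (simp add: E_def C1_off_def)
  moreover have "speed \<gamma> t = \<bar>m\<bar> * speed \<eta> (?s t)" if t: "t \<in> {a..b} - E" for t
  proof -
    have t1: "a < t" "t < b" "t \<notin> T'" using t by (auto simp: E_def)
    have "?s t \<notin> T"
    proof
      assume "?s t \<in> T"
      moreover have "t = (?s t - c) / m" using m by simp
      ultimately have "t \<in> E" unfolding E_def by blast
      then show False using t by blast
    qed
    moreover have "?s t \<in> {0..1}" "?s a \<in> {0..1}" "?s b \<in> {0..1}"
      unfolding im[symmetric] by (rule imageI; use t ab in simp)+
    moreover have "m * t \<noteq> m * a" "m * t \<noteq> m * b" using m t1 by auto
    moreover have "m * a < m * t \<and> m * t < m * b \<or> m * b < m * t \<and> m * t < m * a"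
      using m t1 by (cases "m > 0") auto
    ultimately have s: "0 < ?s t" "?s t < 1" "?s t \<notin> T" by auto
    obtain d where d: "((x \<circ> \<eta>) has_vector_derivative d) (at (?s t))" "speed \<eta> (?s t) = sqrt \<langle>d, d\<rangle>\<^sub>L"
      using curve_differentiable[OF \<eta> s] by blast
    have "(?s has_vector_derivative m) (at t)" by (auto intro!: derivative_eq_intros)
    from vector_diff_chain_at[OF this d(1)]
    have "((x \<circ> \<gamma>) has_vector_derivative m *\<^sub>R d) (at t)"
      by (rule has_vector_derivative_transform_within_open[where S = "{a<..<b}"]) (use t1 eq in auto)
    from speed_eq[OF \<gamma> _ _ t1(3) this] t1 ab
    have "speed \<gamma> t = sqrt (m\<^sup>2 * \<langle>d, d\<rangle>\<^sub>L)" by (simp add: lorentz_bilinear power2_eq_square mult.assoc)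
    then show ?thesis by (simp add: d(2) real_sqrt_mult)
  qed
  ultimately show ?thesis by (rule has_integral_spike_finite[OF _ _ I])
qed

lemma C1_off_reverse: 
  assumes \<gamma>: "C1_off T \<gamma>"
  shows "C1_off ((\<lambda>t. 1 - t) ` T) (\<gamma> \<circ> (\<lambda>t. 1 - t))" "curve_length \<A> x (\<gamma> \<circ> (\<lambda>t. 1 - t)) = curve_length \<A> x \<gamma>"
proof -
  have c: "continuous_map (top_of_set {0..1}) M (\<gamma> \<circ> (\<lambda>t. 1 - t))"
  proof (rule continuous_map_compose)
    show "continuous_map (top_of_set {0..1}) (top_of_set {0..1}) (\<lambda>t::real. 1 - t)"
      by (auto simp: continuous_map_in_subtopology intro!: continuous_intros)
    show "continuous_map (top_of_set {0..1}) M \<gamma>" using \<gamma> by (simp add: C1_off_def)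
  qed
  have "\<exists>D. continuous_on {a..b} D \<and> (\<forall>t\<in>{a..b}. ((\<phi> \<circ> (\<gamma> \<circ> (\<lambda>t. 1 - t))) has_vector_derivative D t) (at t within {a..b}))"
    if U: "(U, \<phi>) \<in> \<A>" and ab: "0 \<le> a" "a < b" "b \<le> 1" "{a<..<b} \<inter> (\<lambda>t. 1 - t) ` T = {}" and sub: "(\<gamma> \<circ> (\<lambda>t. 1 - t)) ` {a..b} \<subseteq> U" for U \<phi> a b
  proof (rule affine_piece[OF \<gamma>, of "-1" a b 1, OF _ ab(2) _ _ _ U sub])
    fix t assume "t \<in> {a<..<b}"
    then have "t \<notin> (\<lambda>t. 1 - t) ` T" using ab(4) by blast
    then show "-1 * t + 1 \<notin> T" by (metis (no_types, lifting) add.commute diff_diff_eq2 image_eqI mult_minus1 uminus_add_conv_diff add_diff_cancel_left')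
  qed (use ab in auto)
  then show 1: "C1_off ((\<lambda>t. 1 - t) ` T) (\<gamma> \<circ> (\<lambda>t. 1 - t))"
    using c \<gamma> unfolding C1_off_def by auto
  have "(speed (\<gamma> \<circ> (\<lambda>t. 1 - t)) has_integral curve_length \<A> x \<gamma>) {0..1}"
    by (rule affine_length[OF 1 \<gamma>, of "-1" 0 1 1]) (auto simp: affine_image[of 0 1 "-1" 1])
  then show "curve_length \<A> x (\<gamma> \<circ> (\<lambda>t. 1 - t)) = curve_length \<A> x \<gamma>"
    unfolding curve_length_eq by (rule integral_unique)
qed

lemma C1_off_join:
  assumes \<gamma>: "C1_off T \<gamma>" and \<eta>: "C1_off T' \<eta>" and j: "\<gamma> 1 = \<eta> 0"
  shows "\<exists>E. C1_off E (join_curve \<gamma> \<eta>)" "curve_length \<A> x (join_curve \<gamma> \<eta>) = curve_length \<A> x \<gamma> + curve_length \<A> x \<eta>"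
proof -
  let ?j = "join_curve \<gamma> \<eta>"
  \<comment> \<open>Making the junction 1/2 a break point confines every smooth piece to one
    half.\<close>
  define E where "E = (\<lambda>t. t / 2) ` T \<union> (\<lambda>t. (t + 1) / 2) ` T' \<union> {1 / 2}"
  have l: "?j t = \<gamma> (2 * t + 0)" if "t \<in> {a..b}" "b \<le> 1 / 2" for t a b using that by (auto simp: join_curve_def)
  \<comment> \<open>At 1/2 itself \<open>join_curve\<close> uses the first curve; the matching
    condition \<open>j\<close> extends the second formula to its closed half.\<close>
  have r: "?j t = \<eta> (2 * t + - 1)" if "t \<in> {a..b}" "1 / 2 \<le> a" for t a b
  proof (cases "t = 1 / 2")
    case True
    have "?j (1 / 2) = \<gamma> 1" by (simp add: join_curve_def)
    then show ?thesis unfolding True using j by simp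
  qed (use that in \<open>auto simp: join_curve_def\<close>)
  have cont: "continuous_map (top_of_set {0..1}) M ?j"
  proof -
    have "continuous_map (top_of_set {0..1}) M (\<lambda>t. if t \<le> 1 / 2 then (\<gamma> \<circ> (\<lambda>t. 2 * t)) t else (\<eta> \<circ> (\<lambda>t. 2 * t - 1)) t)"
    proof (rule continuous_map_cases_le)
      show "continuous_map (subtopology (top_of_set {0..1}) {t \<in> topspace (top_of_set {0..1}). t \<le> 1 / 2}) M (\<gamma> \<circ> (\<lambda>t::real. 2 * t))"
        by (rule continuous_map_compose[of _ "top_of_set {0..1}"])
           (use \<gamma> in \<open>auto simp: C1_off_def continuous_map_in_subtopology subtopology_subtopology intro!: continuous_intros\<close>)
      show "continuous_map (subtopology (top_of_set {0..1}) {t \<in> topspace (top_of_set {0..1}). 1 / 2 \<le> t}) M (\<eta> \<circ> (\<lambda>t::real. 2 * t - 1))"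
        by (rule continuous_map_compose[of _ "top_of_set {0..1}"])
           (use \<eta> in \<open>auto simp: C1_off_def continuous_map_in_subtopology subtopology_subtopology intro!: continuous_intros\<close>)
      show "(\<gamma> \<circ> (\<lambda>t. 2 * t)) t = (\<eta> \<circ> (\<lambda>t. 2 * t - 1)) t" if "t = 1 / 2" for t :: real
        unfolding that using j by simp
    qed auto
    then show ?thesis by (simp only: join_curve_def o_def)
  qed
  have "\<exists>D. continuous_on {a..b} D \<and> (\<forall>t\<in>{a..b}. ((\<phi> \<circ> ?j) has_vector_derivative D t) (at t within {a..b}))"
    if U: "(U, \<phi>) \<in> \<A>" and ab: "0 \<le> a" "a < b" "b \<le> 1" "{a<..<b} \<inter> E = {}" and sub: "?j ` {a..b} \<subseteq> U" for U \<phi> a b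
  proof (cases "b \<le> 1 / 2")
    case True
    show ?thesis
    proof (rule affine_piece[OF \<gamma>, of 2 a b 0, OF _ ab(2) _ _ _ U sub])
      fix t assume t: "t \<in> {a<..<b}"
      show "2 * t + 0 \<notin> T"
      proof
        assume "2 * t + 0 \<in> T"
        then have "(2 * t + 0) / 2 \<in> E" unfolding E_def by blast
        then show False using t ab(4) by auto
      qed
    qed (use ab True l in auto)
  next
    case False
    have "1 / 2 \<notin> {a<..<b}" using ab(4) by (auto simp: E_def)
    then have a: "1 / 2 \<le> a" using False by auto
    show ?thesis
    proof (rule affine_piece[OF \<eta>, of 2 a b "-1", OF _ ab(2) _ _ _ U sub])
      fix t assume t: "t \<in> {a<..<b}"
      show "2 * t + - 1 \<notin> T'"
      proof
        assume "2 * t + - 1 \<in> T'"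
        then have "(2 * t + - 1 + 1) / 2 \<in> E" unfolding E_def by blast
        then show False using t ab(4) by auto
      qed
    qed (use ab a r in auto)
  qed
  moreover have "finite E" using \<gamma> \<eta> by (simp add: E_def C1_off_def)
  ultimately have 1: "C1_off E ?j" using cont unfolding C1_off_def by auto
  then show "\<exists>E. C1_off E ?j" by blast
  have "(speed ?j has_integral curve_length \<A> x \<gamma>) {0..1/2}"
    by (rule affine_length[OF 1 \<gamma>, of 2 0 "1/2" 0]) (use l in \<open>auto simp: affine_image[of 0 "1/2" 2 0, simplified]\<close>)
  moreover have "(speed ?j has_integral curve_length \<A> x \<eta>) {1/2..1}"
    by (rule affine_length[OF 1 \<eta>, of 2 "1/2" 1 "-1"]) (use r in \<open>auto simp: affine_image[of "1/2" 1 2 "-1", simplified]\<close>)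
  ultimately have "(speed ?j has_integral curve_length \<A> x \<gamma> + curve_length \<A> x \<eta>) {0..1}"
    by (rule has_integral_combine[rotated 2]) auto
  then show "curve_length \<A> x ?j = curve_length \<A> x \<gamma> + curve_length \<A> x \<eta>"
    unfolding curve_length_eq by (rule integral_unique)
qed

lemma C1_off_param:
  assumes \<xi>: "smooth_param W \<xi>" and W: "closed_segment u v \<subseteq> W"
  shows "C1_off {} (\<lambda>t. \<xi> (u + t *\<^sub>R (v - u)))"
proof -
  let ?l = "\<lambda>t. u + t *\<^sub>R (v - u)"
  have lW: "?l t \<in> W" if "t \<in> {0..1}" for t
  proof -
    have "?l t = (1 - t) *\<^sub>R u + t *\<^sub>R v" by (simp add: algebra_simps)
    then have "?l t \<in> closed_segment u v" using that unfolding in_segment by auto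
    then show ?thesis using W by blast
  qed
  have "continuous_map (top_of_set {0..1}) M (\<xi> \<circ> ?l)"
    by (rule continuous_map_compose[of _ "top_of_set W"])
       (use \<xi> lW in \<open>auto simp: smooth_param_def continuous_map_in_subtopology intro!: continuous_intros\<close>)
  moreover have "\<exists>D. continuous_on {a..b} D \<and> (\<forall>t\<in>{a..b}. ((\<phi> \<circ> (\<xi> \<circ> ?l)) has_vector_derivative D t) (at t within {a..b}))"
    if U: "(U, \<phi>) \<in> \<A>" and ab: "0 \<le> a" "a < b" "b \<le> 1" and sub: "(\<xi> \<circ> ?l) ` {a..b} \<subseteq> U" for U \<phi> a b
  proof (intro exI conjI ballI)
    let ?T = "{z \<in> W. \<xi> z \<in> U}"
    have s: "smooth_on ?T (\<phi> \<circ> \<xi>)" by (rule param_smooth[OF \<xi> U])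
    have lT: "?l t \<in> ?T" if "t \<in> {a..b}" for t using lW[of t] sub that ab by auto
    show "continuous_on {a..b} (\<lambda>t. frechet_derivative (\<phi> \<circ> \<xi>) (at (?l t)) (v - u))"
      by (rule continuous_on_derivative_apply[where \<Omega> = ?T]) (use s lT in \<open>auto simp: smooth_on_def intro!: continuous_intros\<close>)
    fix t assume t: "t \<in> {a..b}"
    have "(?l has_vector_derivative (v - u)) (at t within {a..b})" by (auto intro!: derivative_eq_intros)
    moreover have "((\<phi> \<circ> \<xi>) has_derivative frechet_derivative (\<phi> \<circ> \<xi>) (at (?l t))) (at (?l t) within ?l ` {a..b})"
      by (rule has_derivative_at_withinI[OF smooth_imp_has_derivative[OF s lT[OF t]]])
    ultimately have "(((\<phi> \<circ> \<xi>) \<circ> ?l) has_vector_derivative frechet_derivative (\<phi> \<circ> \<xi>) (at (?l t)) (v - u)) (at t within {a..b})"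
      by (rule vector_derivative_diff_chain_within)
    then show "((\<phi> \<circ> (\<xi> \<circ> ?l)) has_vector_derivative frechet_derivative (\<phi> \<circ> \<xi>) (at (?l t)) (v - u)) (at t within {a..b})"
      by (simp add: o_assoc)
  qed
  ultimately have "C1_off {} (\<xi> \<circ> ?l)" unfolding C1_off_def by auto
  then show ?thesis by (simp add: o_def)
qed

lemma chart_ball:
  assumes "p \<in> topspace M" "openin M V" "p \<in> V"
  obtains U \<phi> \<rho> where "(U, \<phi>) \<in> \<A>" "p \<in> U" "\<rho> > 0" "cball (\<phi> p) \<rho> \<subseteq> \<phi> ` (U \<inter> V)"
proof -
  obtain U \<phi> where c: "(U, \<phi>) \<in> \<A>" "p \<in> U" using chart_atE[OF assms(1)] by metis
  have "open (\<phi> ` (U \<inter> V))" by (rule chartD(7)[OF c(1)]) (use chartD(1)[OF c(1)] assms in auto)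
  then obtain \<rho> where "\<rho> > 0" "cball (\<phi> p) \<rho> \<subseteq> \<phi> ` (U \<inter> V)" using open_contains_cball c(2) assms(3) by blast
  then show ?thesis using that c by blast
qed

text \<open>Any two points of a coordinate ball are joined by the image of a segment, so the points
  reachable from \<open>p\<close> form an open and closed set. This makes the set of lengths
  nonempty, hence the infimum in the distance meaningful.\<close>

lemma curve_connected:
  assumes "p \<in> topspace M" "q \<in> topspace M"
  obtains T \<gamma> where "C1_off T \<gamma>" "\<gamma> 0 = p" "\<gamma> 1 = q"
proof -
  define R where "R p q \<longleftrightarrow> (\<exists>T \<gamma>. C1_off T \<gamma> \<and> \<gamma> 0 = p \<and> \<gamma> 1 = q)" for p q
  have trans: "R p r" if "R p q" "R q r" for p q r
  proof -
    obtain T \<gamma> T' \<eta> where c: "C1_off T \<gamma>" "\<gamma> 0 = p" "\<gamma> 1 = q" "C1_off T' \<eta>" "\<eta> 0 = q" "\<eta> 1 = r"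
      using \<open>R p q\<close> \<open>R q r\<close> unfolding R_def by metis
    moreover have "(join_curve \<gamma> \<eta>) 0 = p" "(join_curve \<gamma> \<eta>) 1 = r" using c by (auto simp: join_curve_def)
    ultimately show ?thesis using C1_off_join(1)[OF c(1,4)] unfolding R_def by metis
  qed
  have nb: "\<exists>V. openin M V \<and> q \<in> V \<and> (\<forall>a\<in>V. \<forall>b\<in>V. R a b)" if q: "q \<in> topspace M" for q
  proof -
    obtain U \<phi> \<rho> where c: "(U, \<phi>) \<in> \<A>" "q \<in> U" "\<rho> > 0" "cball (\<phi> q) \<rho> \<subseteq> \<phi> ` (U \<inter> topspace M)"
      using chart_ball[OF q openin_topspace q] by blast
    then have sub: "ball (\<phi> q) \<rho> \<subseteq> \<phi> ` U" using ball_subset_cball by blast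
    let ?V = "inv_into U \<phi> ` ball (\<phi> q) \<rho>"
    have "R a b" if ab: "a \<in> ?V" "b \<in> ?V" for a b
    proof -
      obtain u v where uv: "u \<in> ball (\<phi> q) \<rho>" "v \<in> ball (\<phi> q) \<rho>" "a = inv_into U \<phi> u" "b = inv_into U \<phi> v"
        using ab by blast
      have "closed_segment u v \<subseteq> \<phi> ` U" using closed_segment_subset[OF uv(1,2) convex_ball] sub by blast
      from C1_off_param[OF chart_param[OF c(1)] this] show ?thesis
        unfolding R_def using uv by (intro exI[of _ "{}"] exI[of _ "\<lambda>t. inv_into U \<phi> (u + t *\<^sub>R (v - u))"]) auto
    qed
    moreover have "q \<in> ?V" using chart_inv(1)[OF c(1,2)] c(3) by (metis centre_in_ball image_eqI)
    ultimately show ?thesis using chartD(8)[OF c(1) open_ball sub] by blast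
  qed
  let ?C = "{q \<in> topspace M. R p q}"
  have o1: "openin M ?C"
  proof (subst openin_subopen, safe)
    fix q assume q: "q \<in> topspace M" "R p q"
    obtain V where V: "openin M V" "q \<in> V" "\<forall>a\<in>V. \<forall>b\<in>V. R a b" using nb[OF q(1)] by blast
    then show "\<exists>T. openin M T \<and> q \<in> T \<and> T \<subseteq> ?C"
      using trans[OF q(2)] openin_subset[OF V(1)] by blast
  qed
  have o2: "openin M (topspace M - ?C)"
  proof (subst openin_subopen, intro ballI)
    fix q assume "q \<in> topspace M - ?C"
    then have q: "q \<in> topspace M" "q \<notin> ?C" by blast+
    obtain V where V: "openin M V" "q \<in> V" "\<forall>a\<in>V. \<forall>b\<in>V. R a b" using nb[OF q(1)] by blast
    have "a \<notin> ?C" if "a \<in> V" for a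
      using trans[of p a q] V(2,3) that q by blast
    then show "\<exists>T. openin M T \<and> q \<in> T \<and> T \<subseteq> topspace M - ?C"
      using V openin_subset[OF V(1)] by blast
  qed
  have "p \<in> ?C" using nb[OF assms(1)] assms(1) by blast
  moreover have "closedin M ?C" using o2 by (auto simp: closedin_def)
  ultimately have "?C = topspace M" using conn o1 unfolding connected_space_clopen_in by blast
  then have "R p q" using assms(2) by blast
  then show ?thesis using that unfolding R_def by blast
qed

text \<open>A curve that leaves \<open>V\<close> first crosses a coordinate ball of some radius
  \<open>\<rho>\<close>, and on the closed ball the induced metric dominates a multiple
  \<open>\<mu>\<close> of the Euclidean one. This yields both the definiteness of the distance and
  the passage from metric to topological convergence.\<close>

lemma length_escape:
  assumes p: "p \<in> topspace M" and V: "openin M V" "p \<in> V"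
  obtains \<delta> where "\<delta> > 0" "\<And>T \<gamma>. C1_off T \<gamma> \<Longrightarrow> \<gamma> 0 = p \<Longrightarrow> \<gamma> 1 \<notin> V \<Longrightarrow> \<delta> \<le> curve_length \<A> x \<gamma>"
proof -
  obtain U \<phi> \<rho> where c: "(U, \<phi>) \<in> \<A>" "p \<in> U" "\<rho> > 0" "cball (\<phi> p) \<rho> \<subseteq> \<phi> ` (U \<inter> V)"
    using chart_ball[OF p V] .
  let ?\<psi> = "inv_into U \<phi>" and ?K = "cball (\<phi> p) \<rho>" and ?B = "ball (\<phi> p) \<rho>"
  have KU: "?K \<subseteq> \<phi> ` U" using c(4) by blast
  have \<psi>V: "?\<psi> z \<in> V" if "z \<in> ?K" for z using c(4) that chartD(4)[OF c(1)] by auto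
  define G where "G z v = frechet_derivative (x \<circ> ?\<psi>) (at z) v" for z v
  define E where "E z v = \<langle>G z v, G z v\<rangle>\<^sub>L" for z v
  have linG: "linear (G z)" if "z \<in> \<phi> ` U" for z
    using smooth_imp_has_derivative[OF smooth_in_chart[OF smooth_x c(1)] that] has_derivative_linear
    unfolding G_def by blast
  have "continuous_on (?K \<times> sphere 0 1) (\<lambda>y. G (fst y) (snd y))"
    unfolding G_def by (rule continuous_on_derivative_apply[where \<Omega> = "\<phi> ` U"])
      (use KU smooth_in_chart[OF smooth_x c(1)] in \<open>auto simp: smooth_on_def intro!: continuous_intros\<close>)
  then have "continuous_on (?K \<times> sphere 0 1) (\<lambda>y. E (fst y) (snd y))"
    unfolding E_def lorentz_def by (intro continuous_intros)
  moreover have "compact (?K \<times> sphere (0::real^'n) 1)" by (intro compact_Times compact_cball compact_sphere)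
  moreover have "(\<phi> p, axis undefined 1) \<in> ?K \<times> sphere (0::real^'n) 1" using c(3) by simp
  ultimately obtain y where y: "y \<in> ?K \<times> sphere 0 1" "\<And>z. z \<in> ?K \<times> sphere 0 1 \<Longrightarrow> E (fst y) (snd y) \<le> E (fst z) (snd z)"
    using continuous_attains_inf[of "?K \<times> sphere (0::real^'n) 1" "\<lambda>y. E (fst y) (snd y)"] by blast
  \<comment> \<open>The minimum of the metric over the compact set of unit vectors above the ball;
    it is positive because it is attained at a nonzero vector.\<close>
  define \<mu> where "\<mu> = E (fst y) (snd y)"
  have mu: "\<mu> > 0"
  proof -
    have "fst y \<in> \<phi> ` U" "snd y \<noteq> 0" using y(1) KU by auto
    then show ?thesis unfolding \<mu>_def E_def G_def by (rule chart_spacelike[OF c(1)])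
  qed
  have low: "\<mu> * (norm v)\<^sup>2 \<le> E z v" if z: "z \<in> ?K" for z v
  proof (cases "v = 0")
    case True
    then show ?thesis using linear_0[OF linG] KU z by (auto simp: E_def lorentz_bilinear)
  next
    case False
    let ?u = "v /\<^sub>R norm v"
    have "(z, ?u) \<in> ?K \<times> sphere 0 1" using z False by simp
    from y(2)[OF this] have "\<mu> \<le> E z ?u" by (simp add: \<mu>_def)
    moreover have "G z v = norm v *\<^sub>R G z ?u" using linear_scale[OF linG, of z "norm v" ?u] KU z False by auto
    then have "E z v = (norm v)\<^sup>2 * E z ?u" by (simp add: E_def lorentz_bilinear power2_eq_square)
    ultimately show ?thesis by (metis mult.commute mult_left_mono zero_le_power2)
  qed
  have "sqrt \<mu> * \<rho> \<le> curve_length \<A> x \<gamma>" if \<gamma>: "C1_off T \<gamma>" "\<gamma> 0 = p" "\<gamma> 1 \<notin> V" for T \<gamma>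
  proof -
    have cont: "continuous_map (top_of_set {0..1}) M \<gamma>" using \<gamma>(1) by (simp add: C1_off_def)
    \<comment> \<open>The times outside the open coordinate ball; their infimum \<open>s\<close> is
      the first exit time.\<close>
    define Z where "Z = {t \<in> {0..1}. \<gamma> t \<notin> ?\<psi> ` ?B}"
    have oB: "openin M (?\<psi> ` ?B)" by (rule chartD(8)[OF c(1)]) (use KU in auto)
    have "openin (top_of_set {0..1}) {t \<in> {0..1}. \<gamma> t \<in> ?\<psi> ` ?B}"
      using cont oB by (simp add: continuous_map_def)
    then have "closedin (top_of_set {0..1}) ({0..1} - {t \<in> {0..1}. \<gamma> t \<in> ?\<psi> ` ?B})"
      by (simp add: closedin_diff)
    moreover have "{0..1} - {t \<in> {0..1}. \<gamma> t \<in> ?\<psi> ` ?B} = Z" by (auto simp: Z_def)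
    ultimately have cZ: "closed Z" using closedin_closed_trans closed_real_atLeastAtMost by metis
    have "1 \<in> Z" using \<gamma>(3) \<psi>V by (auto simp: Z_def)
    then have Zne: "Z \<noteq> {}" by blast
    have Zb: "bdd_below Z" by (rule bdd_belowI[of _ 0]) (auto simp: Z_def)
    define s where "s = Inf Z"
    have sZ: "s \<in> Z" unfolding s_def by (rule closed_contains_Inf[OF Zne Zb cZ])
    have before: "\<gamma> t \<in> ?\<psi> ` ?B" if "0 \<le> t" "t < s" for t
    proof (rule ccontr)
      assume "\<gamma> t \<notin> ?\<psi> ` ?B"
      then have "t \<in> Z" using that sZ by (auto simp: Z_def)
      from cInf_lower[OF this Zb] show False using that by (simp add: s_def)
    qed
    have s01: "s \<in> {0..1}" using sZ by (auto simp: Z_def)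
    have "\<gamma> 0 \<in> ?\<psi> ` ?B" using \<gamma>(2) chart_inv(1)[OF c(1,2)] c(3) by (metis centre_in_ball image_eqI)
    then have s0: "0 < s" using sZ s01 by (cases "s = 0") (auto simp: Z_def)
    \<comment> \<open>The compact ball is closed in \<open>M\<close> because \<open>M\<close> is
      Hausdorff. So the exit point still lies on the closed ball and has coordinates in the same
      chart.\<close>
    have "compactin M (?\<psi> ` ?K)"
    proof (rule image_compactin[of "top_of_set (\<phi> ` U)"])
      show "compactin (top_of_set (\<phi> ` U)) ?K" using KU by (simp add: compactin_subtopology)
    qed (rule chartD(6)[OF c(1)])
    then have clK: "closedin M (?\<psi> ` ?K)" by (rule compactin_imp_closedin[OF hausdorff])
    then have "closedin (top_of_set {0..1}) {t \<in> {0..1}. \<gamma> t \<in> ?\<psi> ` ?K}"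
      using closedin_continuous_map_preimage[OF cont] by auto
    then have cl: "closed {t \<in> {0..1}. \<gamma> t \<in> ?\<psi> ` ?K}" using closedin_closed_trans closed_real_atLeastAtMost by metis
    have "{0..<s} \<subseteq> {t \<in> {0..1}. \<gamma> t \<in> ?\<psi> ` ?K}" using before s01 ball_subset_cball by fastforce
    then have "closure {0..<s} \<subseteq> {t \<in> {0..1}. \<gamma> t \<in> ?\<psi> ` ?K}" using cl closure_minimal by blast
    then have inK: "\<gamma> t \<in> ?\<psi> ` ?K" if "t \<in> {0..s}" for t using that s0 by auto
    have gU: "\<gamma> t \<in> U" "\<phi> (\<gamma> t) \<in> ?K" if "t \<in> {0..s}" for t
    proof -
      obtain z where z: "z \<in> ?K" "\<gamma> t = ?\<psi> z" using inK[OF \<open>t \<in> {0..s}\<close>] by blast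
      then have "z \<in> \<phi> ` U" using KU by blast
      then show "\<gamma> t \<in> U" "\<phi> (\<gamma> t) \<in> ?K" using z chart_inv(2,3)[OF c(1)] by simp_all
    qed
    have far: "norm (\<phi> (\<gamma> s) - \<phi> (\<gamma> 0)) \<ge> \<rho>"
    proof (rule ccontr)
      assume "\<not> norm (\<phi> (\<gamma> s) - \<phi> (\<gamma> 0)) \<ge> \<rho>"
      then have "\<phi> (\<gamma> s) \<in> ?B" using \<gamma>(2) by (simp add: dist_norm norm_minus_commute)
      moreover have "?\<psi> (\<phi> (\<gamma> s)) = \<gamma> s" by (rule chart_inv(1)[OF c(1) gU(1)]) (use s0 in simp)
      ultimately show False using sZ by (metis (mono_tags, lifting) Z_def image_eqI mem_Collect_eq)
    qed
    have cs: "continuous_on {0..s} (\<lambda>t. \<phi> (\<gamma> t))"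
    proof -
      have "continuous_map (top_of_set {0..s}) (subtopology M U) \<gamma>"
        using continuous_map_from_subtopology_mono[OF cont, of "{0..s}"] s01 gU(1)
        by (auto simp: continuous_map_in_subtopology)
      from continuous_map_compose[OF this chartD(5)[OF c(1)]] show ?thesis by (simp add: o_def)
    qed
    define \<sigma> where "\<sigma> t = vector_derivative (\<lambda>t. \<phi> (\<gamma> t)) (at t)" for t
    have der: "((\<lambda>t. \<phi> (\<gamma> t)) has_vector_derivative \<sigma> t) (at t)" "sqrt \<mu> * norm (\<sigma> t) \<le> speed \<gamma> t"
      if t: "t \<in> {0<..<s} - T" for t
    proof -
      have t': "0 < t" "t < 1" "t \<notin> T" using t s01 by auto
      have tU: "\<gamma> t \<in> U" using gU(1) t by simp
      obtain d where d: "((\<phi> \<circ> \<gamma>) has_vector_derivative d) (at t)"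
        "((x \<circ> \<gamma>) has_vector_derivative G (\<phi> (\<gamma> t)) d) (at t)"
        using curve_interior[OF \<gamma>(1) t' c(1) tU] smooth_x unfolding G_def by metis
      have "\<sigma> t = d" unfolding \<sigma>_def using vector_derivative_at[OF d(1)] by (simp add: o_def)
      then show "((\<lambda>t. \<phi> (\<gamma> t)) has_vector_derivative \<sigma> t) (at t)" using d(1) by (simp add: o_def)
      have "speed \<gamma> t = sqrt (E (\<phi> (\<gamma> t)) d)" unfolding E_def by (rule speed_eq[OF \<gamma>(1) t' d(2)])
      moreover have "sqrt (\<mu> * (norm d)\<^sup>2) \<le> sqrt (E (\<phi> (\<gamma> t)) d)"
        using low[of "\<phi> (\<gamma> t)" d] gU(2)[of t] t by simp
      ultimately show "sqrt \<mu> * norm (\<sigma> t) \<le> speed \<gamma> t" using \<open>\<sigma> t = d\<close> by (simp add: real_sqrt_mult)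
    qed
    have fT: "finite T" using \<gamma>(1) by (simp add: C1_off_def)
    have I: "(\<sigma> has_integral \<phi> (\<gamma> s) - \<phi> (\<gamma> 0)) {0..s}"
      by (rule fundamental_theorem_of_calculus_interior_strong[OF fT _ der(1) cs]) (use s0 in auto)
    \<comment> \<open>The integral comparison needs its bound at every time, so the coordinate
      velocity is set to zero at the finitely many times where it may fail to exist.\<close>
    define \<sigma>' where "\<sigma>' t = (if t \<in> {0<..<s} - T then \<sigma> t else 0)" for t
    have I': "(\<sigma>' has_integral \<phi> (\<gamma> s) - \<phi> (\<gamma> 0)) {0..s}"
      by (rule has_integral_spike_finite[OF _ _ I, of "insert 0 (insert s T)"]) (auto simp: \<sigma>'_def fT)
    have int: "speed \<gamma> integrable_on {0..1}" by (rule speed_integrable[OF \<gamma>(1)])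
    then have int': "speed \<gamma> integrable_on {0..s}" using integrable_on_subinterval s01 by fastforce
    have "norm (sqrt \<mu> *\<^sub>R \<sigma>' t) \<le> speed \<gamma> t" if "t \<in> {0..s}" for t
      using der(2)[of t] speed_nonneg[OF \<gamma>(1), of t] that s01 mu by (auto simp: \<sigma>'_def)
    then have "norm (integral {0..s} (\<lambda>t. sqrt \<mu> *\<^sub>R \<sigma>' t)) \<le> integral {0..s} (speed \<gamma>)"
      by (intro integral_norm_bound_integral int' integrable_cmul has_integral_integrable[OF I']) 
    also have "integral {0..s} (\<lambda>t. sqrt \<mu> *\<^sub>R \<sigma>' t) = sqrt \<mu> *\<^sub>R (\<phi> (\<gamma> s) - \<phi> (\<gamma> 0))"
      by (rule integral_unique[OF has_integral_cmul[OF I']])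
    also have "integral {0..s} (speed \<gamma>) \<le> curve_length \<A> x \<gamma>"
      unfolding curve_length_eq by (rule integral_subset_le) (use s01 int int' speed_nonneg[OF \<gamma>(1)] in auto)
    finally have "sqrt \<mu> * norm (\<phi> (\<gamma> s) - \<phi> (\<gamma> 0)) \<le> curve_length \<A> x \<gamma>" using mu by simp
    moreover have "sqrt \<mu> * \<rho> \<le> sqrt \<mu> * norm (\<phi> (\<gamma> s) - \<phi> (\<gamma> 0))" using far mu by (intro mult_left_mono) auto
    ultimately show ?thesis by linarith
  qed
  moreover have "sqrt \<mu> * \<rho> > 0" using mu c(3) by simp
  ultimately show ?thesis using that by blast
qed

section \<open>The induced distance as a metric, and completeness\<close>

abbreviation "d\<^sub>x \<equiv> induced_dist M \<A> x"

definition "lengths p q = {curve_length \<A> x \<gamma> |\<gamma>. piecewise_C1_curve M \<A> \<gamma> \<and> \<gamma> 0 = p \<and> \<gamma> 1 = q}"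

lemma dist_eq: "p \<in> topspace M \<Longrightarrow> q \<in> topspace M \<Longrightarrow> d\<^sub>x p q = Inf (lengths p q)"
  by (simp add: induced_dist_def lengths_def)

lemma lengths_bdd: "bdd_below (lengths p q)"
  by (rule bdd_belowI[of _ 0]) (auto simp: lengths_def piecewise_C1_curve_iff curve_length_nonneg)

lemma dist_le_length:
  assumes "C1_off T \<gamma>" shows "d\<^sub>x (\<gamma> 0) (\<gamma> 1) \<le> curve_length \<A> x \<gamma>"
proof -
  have "curve_length \<A> x \<gamma> \<in> lengths (\<gamma> 0) (\<gamma> 1)" using assms by (auto simp: lengths_def piecewise_C1_curve_iff)
  then show ?thesis using dist_eq C1_off_in[OF assms] cInf_lower[OF _ lengths_bdd] by simp
qed

lemma dist_approx:
  assumes "p \<in> topspace M" "q \<in> topspace M" "d\<^sub>x p q < r"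
  obtains T \<gamma> where "C1_off T \<gamma>" "\<gamma> 0 = p" "\<gamma> 1 = q" "curve_length \<A> x \<gamma> < r"
proof -
  obtain T \<gamma> where "C1_off T \<gamma>" "\<gamma> 0 = p" "\<gamma> 1 = q" using curve_connected[OF assms(1,2)] .
  then have "curve_length \<A> x \<gamma> \<in> lengths p q" unfolding lengths_def piecewise_C1_curve_iff by blast
  then have "lengths p q \<noteq> {}" by blast
  then obtain l where "l \<in> lengths p q" "l < r" using cInf_lessD assms dist_eq by metis
  then show ?thesis using that by (auto simp: lengths_def piecewise_C1_curve_iff)
qed

lemma dist_nonneg: "d\<^sub>x p q \<ge> 0"
proof (cases "p \<in> topspace M \<and> q \<in> topspace M")
  case True
  show ?thesis
  proof (rule ccontr)
    assume "\<not> d\<^sub>x p q \<ge> 0"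
    then have neg: "d\<^sub>x p q < 0" by simp
    obtain T \<gamma> where "C1_off T \<gamma>" "curve_length \<A> x \<gamma> < 0"
      by (rule dist_approx[OF conjunct1[OF True] conjunct2[OF True] neg])
    then show False using curve_length_nonneg by fastforce
  qed
qed (auto simp: induced_dist_def)

text \<open>Reversed curves give symmetry and concatenated ones the triangle inequality. Distinct
  points have disjoint neighbourhoods, so \<open>length_escape\<close> bounds the length of every
  curve between them away from zero.\<close>

lemma metric_space: "Metric_space (topspace M) d\<^sub>x"
proof
  have sym_le: "d\<^sub>x p q \<le> d\<^sub>x q p" if pq: "p \<in> topspace M" "q \<in> topspace M" for p q
  proof (rule ccontr)
    assume "\<not> ?thesis"
    then obtain T \<gamma> where g: "C1_off T \<gamma>" "\<gamma> 0 = q" "\<gamma> 1 = p" "curve_length \<A> x \<gamma> < d\<^sub>x p q"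
      using dist_approx[OF pq(2,1)] by (metis not_le)
    then show False using dist_le_length[OF C1_off_reverse(1)[OF g(1)]] C1_off_reverse(2)[OF g(1)] by simp
  qed
  show "0 \<le> d\<^sub>x p q" for p q by (rule dist_nonneg)
  show "d\<^sub>x p q = d\<^sub>x q p" for p q
    using sym_le[of p q] sym_le[of q p] by (auto simp: induced_dist_def)
  show "d\<^sub>x p q = 0 \<longleftrightarrow> p = q" if pq: "p \<in> topspace M" "q \<in> topspace M" for p q
  proof
    assume 0: "d\<^sub>x p q = 0"
    show "p = q"
    proof (rule ccontr)
      assume "p \<noteq> q"
      then obtain V V' where V: "openin M V" "p \<in> V" "openin M V'" "q \<in> V'" "disjnt V V'"
        using hausdorff pq unfolding Hausdorff_space_def by metis
      obtain \<delta> where d: "\<delta> > 0" "\<And>T \<gamma>. C1_off T \<gamma> \<Longrightarrow> \<gamma> 0 = p \<Longrightarrow> \<gamma> 1 \<notin> V \<Longrightarrow> \<delta> \<le> curve_length \<A> x \<gamma>"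
        using length_escape[OF pq(1) V(1,2)] by blast
      obtain T \<gamma> where "C1_off T \<gamma>" "\<gamma> 0 = p" "\<gamma> 1 = q" "curve_length \<A> x \<gamma> < \<delta>"
        using dist_approx[OF pq, of \<delta>] 0 d(1) by auto
      moreover have "q \<notin> V" using V(4,5) by (auto simp: disjnt_iff)
      ultimately show False using d(2) by (metis not_le)
    qed
  next
    assume "p = q"
    obtain U \<phi> where c: "(U, \<phi>) \<in> \<A>" "p \<in> U" using chart_atE[OF pq(1)] by metis
    have "C1_off {} (\<lambda>t. inv_into U \<phi> (\<phi> p + t *\<^sub>R (\<phi> p - \<phi> p)))"
      by (rule C1_off_param[OF chart_param[OF c(1)]]) (use c in auto)
    then have g: "C1_off {} (\<lambda>t::real. p)" using chart_inv(1)[OF c] by simp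
    have "speed (\<lambda>t. p) t = 0" if "0 < t" "t < 1" for t
    proof -
      have "((x \<circ> (\<lambda>t::real. p)) has_vector_derivative 0) (at t)" by (simp add: o_def)
      from speed_eq[OF g that _ this] show ?thesis by (simp add: lorentz_bilinear)
    qed
    then have "(speed (\<lambda>t. p) has_integral 0) {0..1}"
      by (intro has_integral_spike_finite[OF _ _ has_integral_0, of "{0, 1}"]) auto
    then have "curve_length \<A> x (\<lambda>t. p) = 0" unfolding curve_length_eq by (rule integral_unique)
    then show "d\<^sub>x p q = 0" using dist_le_length[OF g] dist_nonneg[of p p] \<open>p = q\<close> by simp
  qed
  show "d\<^sub>x p r \<le> d\<^sub>x p q + d\<^sub>x q r" if pq: "p \<in> topspace M" "q \<in> topspace M" "r \<in> topspace M" for p q r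
  proof (rule field_le_epsilon)
    fix e :: real assume e: "e > 0"
    obtain T \<gamma> where g: "C1_off T \<gamma>" "\<gamma> 0 = p" "\<gamma> 1 = q" "curve_length \<A> x \<gamma> < d\<^sub>x p q + e / 2"
      using dist_approx[OF pq(1,2), of "d\<^sub>x p q + e / 2"] e by auto
    obtain T' \<eta> where h: "C1_off T' \<eta>" "\<eta> 0 = q" "\<eta> 1 = r" "curve_length \<A> x \<eta> < d\<^sub>x q r + e / 2"
      using dist_approx[OF pq(2,3), of "d\<^sub>x q r + e / 2"] e by auto
    obtain E where "C1_off E (join_curve \<gamma> \<eta>)" using C1_off_join(1)[OF g(1) h(1)] g(3) h(2) by auto
    from dist_le_length[OF this] C1_off_join(2)[OF g(1) h(1)] g h
    show "d\<^sub>x p r \<le> d\<^sub>x p q + d\<^sub>x q r + e" by (simp add: join_curve_def)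
  qed
qed

text \<open>Completeness speaks of limits for the induced distance only. By
  \<open>length_escape\<close>, a point at small distance from \<open>m\<close> must lie in a
  prescribed neighbourhood of \<open>m\<close>.\<close>

lemma complete_limit:
  assumes complete: "complete_hypersurface M \<A> x" and \<sigma>: "\<And>k. \<sigma> k \<in> topspace M"
    and cauchy: "\<And>e. e > 0 \<Longrightarrow> \<exists>K. \<forall>k\<ge>K. \<forall>l\<ge>K. d\<^sub>x (\<sigma> k) (\<sigma> l) < e"
  obtains m where "m \<in> topspace M" "\<And>V. openin M V \<Longrightarrow> m \<in> V \<Longrightarrow> \<forall>\<^sub>F k in sequentially. \<sigma> k \<in> V"
proof -
  interpret Metric_space "topspace M" "d\<^sub>x" by (rule metric_space)
  have "MCauchy \<sigma>" unfolding MCauchy_def using \<sigma> cauchy by blast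
  then obtain m where m: "limitin mtopology \<sigma> m sequentially"
    using complete by (auto simp: complete_hypersurface_def mcomplete_def)
  have mM: "m \<in> topspace M" using m limitin_topspace by fastforce
  show thesis
  proof (rule that[OF mM])
    fix V assume V: "openin M V" "m \<in> V"
    obtain \<delta> where d: "\<delta> > 0" "\<And>T \<gamma>. C1_off T \<gamma> \<Longrightarrow> \<gamma> 0 = m \<Longrightarrow> \<gamma> 1 \<notin> V \<Longrightarrow> \<delta> \<le> curve_length \<A> x \<gamma>"
      using length_escape[OF mM V] by blast
    have "\<forall>\<^sub>F k in sequentially. \<sigma> k \<in> topspace M \<and> d\<^sub>x (\<sigma> k) m < \<delta>"
      using m d(1) unfolding limitin_metric by blast
    then show "\<forall>\<^sub>F k in sequentially. \<sigma> k \<in> V"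
    proof (rule eventually_mono)
      fix k assume k: "\<sigma> k \<in> topspace M \<and> d\<^sub>x (\<sigma> k) m < \<delta>"
      then have "d\<^sub>x m (\<sigma> k) < \<delta>" using commute by metis
      then obtain T \<gamma> where "C1_off T \<gamma>" "\<gamma> 0 = m" "\<gamma> 1 = \<sigma> k" "curve_length \<A> x \<gamma> < \<delta>"
        using dist_approx[OF mM] k by blast
      then show "\<sigma> k \<in> V" using d(2) by (metis not_le)
    qed
  qed
qed

end

section \<open>Complete space-like hypersurfaces are entire graphs\<close>

context spacelike_hypersurface
begin

definition proj :: "'m \<Rightarrow> real ^ 'n" where "proj p = fst (x p)"

lemma smooth_on_fst: "open S \<Longrightarrow> smooth_on S f \<Longrightarrow> smooth_on S (\<lambda>z. fst (f z))"
  unfolding smooth_on_def using k_smooth_on_linear_comp[OF _ bounded_linear_fst] by blast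

lemma smooth_proj: "smooth_map \<A> proj"
proof -
  have "smooth_on (\<phi> ` U) (proj \<circ> inv_into U \<phi>)" if "(U, \<phi>) \<in> \<A>" for U \<phi>
    using smooth_on_fst[OF chartD(2)[OF that] smooth_in_chart[OF smooth_x that]] by (simp add: o_def proj_def[abs_def])
  then show ?thesis by (auto simp: smooth_map_def)
qed

text \<open>A vector in the kernel would have a vertical image, and the Lorentz square of a vertical
  vector is never positive.\<close>

lemma proj_chart_inj:
  assumes c: "(U, \<phi>) \<in> \<A>" and z: "z \<in> \<phi> ` U" shows "inj (frechet_derivative (proj \<circ> inv_into U \<phi>) (at z))"
proof -
  let ?G = "frechet_derivative (x \<circ> inv_into U \<phi>) (at z)"
  have G: "((x \<circ> inv_into U \<phi>) has_derivative ?G) (at z)"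
    by (rule smooth_imp_has_derivative[OF smooth_in_chart[OF smooth_x c] z])
  have F: "frechet_derivative (proj \<circ> inv_into U \<phi>) (at z) = (\<lambda>v. fst (?G v))"
    using frechet_derivative_eqI[OF has_derivative_fst[OF G]] by (simp add: o_def proj_def[abs_def])
  have "linear (\<lambda>v. fst (?G v))"
    using has_derivative_linear[OF has_derivative_fst[OF G]] by simp
  moreover have "v = 0" if "fst (?G v) = 0" for v
  proof (rule ccontr)
    assume "v \<noteq> 0"
    from chart_spacelike[OF c z this] show False using that by (simp add: lorentz_def not_less)
  qed
  ultimately show ?thesis unfolding F by (simp add: linear_injective_0)
qed

lemma smooth_map_continuous:
  fixes f :: "'m \<Rightarrow> 'b::real_normed_vector"
  assumes "smooth_map \<A> f" shows "continuous_map M euclidean f"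
  unfolding continuous_map_def
proof (intro conjI allI impI)
  fix V :: "'b set" assume "openin euclidean V"
  then have V: "open V" by simp
  show "openin M {p \<in> topspace M. f p \<in> V}"
  proof (subst openin_subopen, intro ballI)
    fix p assume p: "p \<in> {p \<in> topspace M. f p \<in> V}"
    then obtain U \<phi> where c: "(U, \<phi>) \<in> \<A>" "p \<in> U" using chart_atE by blast
    have "continuous_on (\<phi> ` U) (f \<circ> inv_into U \<phi>)"
      using smooth_in_chart[OF assms c(1)] k_smooth_on.simps(1) unfolding smooth_on_def by blast
    then have o: "open ((f \<circ> inv_into U \<phi>) -` V \<inter> \<phi> ` U)"
      using chartD(2)[OF c(1)] V continuous_on_open_vimage by blast
    let ?W = "inv_into U \<phi> ` ((f \<circ> inv_into U \<phi>) -` V \<inter> \<phi> ` U)"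
    have "openin M ?W" by (rule chartD(8)[OF c(1) o]) simp
    moreover have "p \<in> ?W" using p c chart_inv(1)[OF c] by (intro image_eqI[of _ _ "\<phi> p"]) auto
    moreover have "?W \<subseteq> {p \<in> topspace M. f p \<in> V}"
      using chart_inv(3)[OF c(1)] chartD(3)[OF c(1)] by auto
    ultimately show "\<exists>T. openin M T \<and> p \<in> T \<and> T \<subseteq> {p \<in> topspace M. f p \<in> V}" by blast
  qed
qed auto

text \<open>Sections of the projection, i.e. local inverses of it. They are continued along rays by
  completeness until one is defined on all of \<open>\<real>\<^sup>n\<close>.\<close>

definition sect :: "(real ^ 'n) set \<Rightarrow> (real ^ 'n \<Rightarrow> 'm) \<Rightarrow> bool" where
  "sect W g \<longleftrightarrow> open W \<and> continuous_map (top_of_set W) M g \<and> (\<forall>z\<in>W. proj (g z) = z)"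

lemma sectD: "sect W g \<Longrightarrow> z \<in> W \<Longrightarrow> g z \<in> topspace M" "sect W g \<Longrightarrow> z \<in> W \<Longrightarrow> proj (g z) = z"
  by (auto simp: sect_def continuous_map_def)

lemma sect_preimage: "sect W g \<Longrightarrow> openin M V \<Longrightarrow> open {z \<in> W. g z \<in> V}"
  unfolding sect_def by (blast intro: open_preimage)

lemma sect_subset: "sect W g \<Longrightarrow> open T \<Longrightarrow> T \<subseteq> W \<Longrightarrow> sect T g"
  using continuous_map_from_subtopology_mono by (fastforce simp: sect_def)

lemma sect_glue:
  assumes "\<And>z. z \<in> W \<Longrightarrow> \<exists>T h. T \<subseteq> W \<and> z \<in> T \<and> sect T h \<and> (\<forall>y\<in>T. g y = h y)"
  shows "sect W g"
proof -
  have oW: "open W"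
  proof (subst open_subopen, intro ballI)
    fix z assume "z \<in> W"
    from assms[OF this] show "\<exists>T. open T \<and> z \<in> T \<and> T \<subseteq> W" by (auto simp: sect_def)
  qed
  have "openin (top_of_set W) {z \<in> W. g z \<in> V}" if V: "openin M V" for V
  proof -
    have "\<exists>T. open T \<and> z \<in> T \<and> T \<subseteq> {z \<in> W. g z \<in> V}" if z: "z \<in> {z \<in> W. g z \<in> V}" for z
    proof -
      obtain T h where T: "T \<subseteq> W" "z \<in> T" "sect T h" "\<forall>y\<in>T. g y = h y" using assms[of z] z by blast
      then have "open {y \<in> T. h y \<in> V}" "z \<in> {y \<in> T. h y \<in> V}" "{y \<in> T. h y \<in> V} \<subseteq> {z \<in> W. g z \<in> V}"
        using sect_preimage[OF T(3) V] z by auto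
      then show ?thesis by blast
    qed
    then have "open {z \<in> W. g z \<in> V}" by (subst open_subopen) blast
    then show ?thesis by (metis (no_types, lifting) mem_Collect_eq open_subset subsetI)
  qed
  moreover have "g z \<in> topspace M \<and> proj (g z) = z" if "z \<in> W" for z
    using assms[OF that] sectD by metis
  ultimately show ?thesis using oW by (auto simp: sect_def continuous_map_def)
qed

text \<open>In a chart a section is a continuous right inverse of a smooth map with injective
  derivatives, hence smooth.\<close>

lemma sect_param:
  assumes g: "sect W g" shows "smooth_param W g"
proof -
  have "smooth_on {z \<in> W. g z \<in> U} (\<phi> \<circ> g)" if c: "(U, \<phi>) \<in> \<A>" for U \<phi>
  proof -
    let ?T = "{z \<in> W. g z \<in> U}"
    have T: "open ?T" by (rule sect_preimage[OF g chartD(1)[OF c]])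
    have "continuous_map (top_of_set ?T) (subtopology M U) g"
      using sect_subset[OF g T] by (auto simp: sect_def continuous_map_in_subtopology)
    from continuous_map_compose[OF this chartD(5)[OF c]] have cont: "continuous_on ?T (\<phi> \<circ> g)" by simp
    have "k_smooth_on k ?T (\<phi> \<circ> g)" for k
    proof (rule k_smooth_on_right_inverse[OF T chartD(2)[OF c] cont])
      show "(proj \<circ> inv_into U \<phi>) ((\<phi> \<circ> g) y) = y" if "y \<in> ?T" for y
        using that chart_inv(1)[OF c] sectD(2)[OF g] by simp
      show "k_smooth_on (Suc k) (\<phi> ` U) (proj \<circ> inv_into U \<phi>)"
        using smooth_in_chart[OF smooth_proj c] by (simp only: smooth_on_def)
      show "inj (frechet_derivative (proj \<circ> inv_into U \<phi>) (at z))" if "z \<in> \<phi> ` U" for z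
        by (rule proj_chart_inj[OF c that])
    qed auto
    then show ?thesis by (simp add: smooth_on_def)
  qed
  then show ?thesis using g by (auto simp: smooth_param_def sect_def)
qed

text \<open>The inverse function theorem in a chart. The set \<open>V\<close> records the converse
  inclusion, that all points of \<open>M\<close> near \<open>p\<close> lie on the section;
  uniqueness and continuation depend on it.\<close>

lemma local_sect:
  assumes p: "p \<in> topspace M"
  obtains \<rho> s V where "\<rho> > 0" "sect (ball (proj p) \<rho>) s" "openin M V" "p \<in> V"
    "\<And>q. q \<in> V \<Longrightarrow> proj q \<in> ball (proj p) \<rho> \<and> s (proj q) = q"
proof -
  obtain U \<phi> where c: "(U, \<phi>) \<in> \<A>" "p \<in> U" using chart_atE[OF p] by metis
  let ?\<psi> = "inv_into U \<phi>" and ?\<Omega> = "\<phi> ` U"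
  let ?F = "proj \<circ> ?\<psi>"
  have sF: "smooth_on ?\<Omega> ?F" by (rule smooth_in_chart[OF smooth_proj c(1)])
  have dF: "(?F has_derivative frechet_derivative ?F (at z)) (at z)" if "z \<in> ?\<Omega>" for z
    by (rule smooth_imp_has_derivative[OF sF that])
  define F' where "F' z = Blinfun (frechet_derivative ?F (at z))" for z
  have F': "blinfun_apply (F' z) = frechet_derivative ?F (at z)" if "z \<in> ?\<Omega>" for z
    unfolding F'_def by (rule bounded_linear_Blinfun_apply[OF has_derivative_bounded_linear[OF dF[OF that]]])
  have contF': "continuous_on ?\<Omega> F'"
  proof (rule continuous_on_blinfun_componentwise)
    fix i :: "real ^ 'n"
    have "k_smooth_on (Suc 0) ?\<Omega> ?F" using sF by (simp only: smooth_on_def)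
    from k_smooth_on_SucD(2)[OF this, of i] have "continuous_on ?\<Omega> (\<lambda>z. frechet_derivative ?F (at z) i)" by simp
    then show "continuous_on ?\<Omega> (\<lambda>z. blinfun_apply (F' z) i)" using F' by (simp cong: continuous_on_cong)
  qed
  have z0: "\<phi> p \<in> ?\<Omega>" using c by simp
  have F0: "?F (\<phi> p) = proj p" using chart_inv(1)[OF c] by simp
  obtain L where L: "linear L" "L \<circ> frechet_derivative ?F (at (\<phi> p)) = id"
    using linear_injective_left_inverse[OF has_derivative_linear[OF dF[OF z0]] proj_chart_inj[OF c(1) z0]] by blast
  have "Blinfun L o\<^sub>L F' (\<phi> p) = id_blinfun"
    using L by (intro blinfun_eqI) (simp add: F'[OF z0] bounded_linear_Blinfun_apply linear_conv_bounded_linear pointfree_idE)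
  note inv = this
  have dF2: "(?F has_derivative blinfun_apply (F' z)) (at z)" if "z \<in> ?\<Omega>" for z
    unfolding F'[OF that] by (rule dF[OF that])
  obtain U' V h where hom: "open U'" "U' \<subseteq> ?\<Omega>" "\<phi> p \<in> U'" "open V" "?F (\<phi> p) \<in> V" "homeomorphism U' V ?F h"
  proof (rule inverse_function_theorem[of ?\<Omega> ?F F' "\<phi> p" "Blinfun L"])
    show "open ?\<Omega>" by (rule chartD(2)[OF c(1)])
    show "(?F has_derivative blinfun_apply (F' z)) (at z)" if "z \<in> ?\<Omega>" for z by (rule dF2[OF that])
    show "continuous_on ?\<Omega> F'" by (rule contF')
    show "\<phi> p \<in> ?\<Omega>" by (rule z0)
    show "Blinfun L o\<^sub>L F' (\<phi> p) = id_blinfun" by (rule inv)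
  next
    fix U' V h assume "open U'" "U' \<subseteq> ?\<Omega>" "\<phi> p \<in> U'" "open V" "?F (\<phi> p) \<in> V" "homeomorphism U' V ?F h"
    then show thesis by (rule that)
  qed
  have "proj p \<in> V" using hom(5) unfolding F0 .
  with hom(4) obtain \<rho> where \<rho>: "\<rho> > 0" "ball (proj p) \<rho> \<subseteq> V" by (rule openE)
  let ?B = "ball (proj p) \<rho>"
  have Fh: "?F (h y) = y" "h y \<in> U'" if "y \<in> V" for y
    using homeomorphism_apply2[OF hom(6) that] homeomorphism_image2[OF hom(6)] that by auto
  have hF: "h (?F z) = z" if "z \<in> U'" for z
    by (rule homeomorphism_apply1[OF hom(6) that])
  have "continuous_on V h" using hom(6) by (rule homeomorphism_cont2)
  then have "continuous_on ?B h" using \<rho>(2) by (rule continuous_on_subset)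
  moreover have "h ` ?B \<subseteq> ?\<Omega>" using Fh(2) \<rho>(2) hom(2) by blast
  ultimately have "continuous_map (top_of_set ?B) (top_of_set ?\<Omega>) h" by (auto simp: continuous_map_in_subtopology)
  from continuous_map_compose[OF this chartD(6)[OF c(1)]]
  have s: "sect ?B (?\<psi> \<circ> h)" unfolding sect_def using Fh(1) \<rho>(2) by auto
  have "continuous_on U' ?F" using hom(6) by (rule homeomorphism_cont1)
  then have oW: "open (?F -` ?B \<inter> U')" using continuous_on_open_vimage[OF hom(1)] open_ball by blast
  have "openin M (?\<psi> ` (?F -` ?B \<inter> U'))" by (rule chartD(8)[OF c(1) oW]) (use hom(2) in blast)
  moreover have "p \<in> ?\<psi> ` (?F -` ?B \<inter> U')"
    using \<rho>(1) hom(3) F0 chart_inv(1)[OF c] by (intro image_eqI[of _ _ "\<phi> p"]) auto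
  moreover have "proj q \<in> ?B \<and> (?\<psi> \<circ> h) (proj q) = q" if "q \<in> ?\<psi> ` (?F -` ?B \<inter> U')" for q
    using that hF by auto
  ultimately show thesis using that[OF \<rho>(1) s] by blast
qed

text \<open>The set where two sections agree is closed because \<open>M\<close> is Hausdorff, and
  open because near a common value both coincide with the local section through it.\<close>

lemma sect_unique:
  assumes g: "sect W g" and h: "sect W h" and W: "connected W" and z: "z \<in> W" "g z = h z" and y: "y \<in> W"
  shows "g y = h y"
proof -
  let ?E = "{y \<in> W. g y = h y}"
  have "closedin (top_of_set W) ?E"
    using closedin_continuous_maps_eq[OF hausdorff, of "top_of_set W" g h] g h by (simp add: sect_def)
  moreover have "openin (top_of_set W) ?E"
  proof -
    have "\<exists>T. open T \<and> y \<in> T \<and> T \<subseteq> ?E" if y: "y \<in> ?E" for y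
    proof -
      have "g y \<in> topspace M" using sectD(1)[OF g] y by blast
      then obtain \<rho> s V where s: "openin M V" "g y \<in> V" "\<And>q. q \<in> V \<Longrightarrow> s (proj q) = q" by (rule local_sect) blast
      let ?N = "{z \<in> W. g z \<in> V} \<inter> {z \<in> W. h z \<in> V}"
      have oN: "open ?N" using sect_preimage[OF g s(1)] sect_preimage[OF h s(1)] by (rule open_Int)
      have "g z = h z" if "z \<in> ?N" for z
        using s(3)[of "g z"] s(3)[of "h z"] sectD(2)[OF g, of z] sectD(2)[OF h, of z] that by simp
      then have sub: "?N \<subseteq> ?E" by blast
      have "y \<in> W" "h y \<in> V" using y s(2) by simp_all
      then have "y \<in> ?N" using s(2) by simp
      then show ?thesis using oN sub by blast
    qed
    then have "open ?E" by (subst open_subopen) blast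
    then show ?thesis by (metis (no_types, lifting) mem_Collect_eq open_subset subsetI)
  qed
  ultimately have "?E = {} \<or> ?E = W" using W unfolding connected_clopen by blast
  then show ?thesis using z y by blast
qed

text \<open>A curve in a space-like hypersurface is at most as long as its Euclidean shadow, so sections of
  the projection do not increase distances.\<close>

lemma sect_dist_le:
  assumes g: "sect W g" and seg: "closed_segment u v \<subseteq> W"
  shows "d\<^sub>x (g u) (g v) \<le> norm (v - u)"
proof -
  let ?\<gamma> = "\<lambda>t. g (u + t *\<^sub>R (v - u))"
  have \<gamma>: "C1_off {} ?\<gamma>" by (rule C1_off_param[OF sect_param[OF g] seg])
  have pr: "proj (?\<gamma> t) = u + t *\<^sub>R (v - u)" if "t \<in> {0..1}" for t
  proof (rule sectD(2)[OF g])
    have "u + t *\<^sub>R (v - u) = (1 - t) *\<^sub>R u + t *\<^sub>R v" by (simp add: algebra_simps)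
    then have "u + t *\<^sub>R (v - u) \<in> closed_segment u v" using that unfolding in_segment by auto
    then show "u + t *\<^sub>R (v - u) \<in> W" using seg by blast
  qed
  have le: "norm (speed ?\<gamma> t) \<le> norm (v - u)" if t: "0 < t" "t < 1" for t
  proof -
    obtain d where d: "((x \<circ> ?\<gamma>) has_vector_derivative d) (at t)" "speed ?\<gamma> t = sqrt \<langle>d, d\<rangle>\<^sub>L"
      using curve_differentiable[OF \<gamma> t] by blast
    have "((\<lambda>t. fst ((x \<circ> ?\<gamma>) t)) has_vector_derivative fst d) (at t)"
      using has_derivative_fst[OF d(1)[unfolded has_vector_derivative_def]] by (simp add: has_vector_derivative_def)
    then have "((\<lambda>t. u + t *\<^sub>R (v - u)) has_vector_derivative fst d) (at t)"
      by (rule has_vector_derivative_transform_within_open[where S = "{0<..<1}"]) (use t pr in \<open>auto simp: proj_def\<close>)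
    moreover have "((\<lambda>t. u + t *\<^sub>R (v - u)) has_vector_derivative (v - u)) (at t)" by (auto intro!: derivative_eq_intros)
    ultimately have "fst d = v - u" by (rule vector_derivative_unique_at)
    then have "\<langle>d, d\<rangle>\<^sub>L \<le> (norm (v - u))\<^sup>2" by (simp add: lorentz_def power2_norm_eq_inner)
    then have "sqrt \<langle>d, d\<rangle>\<^sub>L \<le> norm (v - u)" using real_le_lsqrt real_sqrt_le_iff
      by (metis abs_of_nonneg norm_ge_zero real_sqrt_abs real_sqrt_le_mono)
    moreover have "speed ?\<gamma> t \<ge> 0" using speed_nonneg[OF \<gamma>] t by simp
    ultimately show ?thesis using d(2) by simp
  qed
  have "(speed ?\<gamma> has_integral curve_length \<A> x ?\<gamma>) (cbox 0 1)"
    unfolding curve_length_eq using integrable_integral[OF speed_integrable[OF \<gamma>]] by simp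
  from has_integral_bound_spike_finite[OF norm_ge_zero _ this, of "{0, 1}" "v - u"]
  have "curve_length \<A> x ?\<gamma> \<le> norm (v - u)" using le by auto
  then show ?thesis using dist_le_length[OF \<gamma>] by simp
qed

section \<open>Continuation of sections by completeness\<close>

context
  assumes complete: "complete_hypersurface M \<A> x"
begin

lemma radial_limit:
  assumes r: "r > 0" and g: "sect (ball q r) g" and w: "dist q w = r"
  obtains m where "m \<in> topspace M" "proj m = w"
    "\<And>V e. openin M V \<Longrightarrow> m \<in> V \<Longrightarrow> e > 0 \<Longrightarrow> \<exists>z\<in>ball q r \<inter> ball w e. g z \<in> V"
proof -
  \<comment> \<open>Points of the radius from \<open>q\<close> to the boundary point
    \<open>w\<close>, converging to \<open>w\<close>. Sections do not increase distances, so the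
    lifts form a Cauchy sequence.\<close>
  define z where "z k = w + inverse (real (Suc k)) *\<^sub>R (q - w)" for k
  have "(\<lambda>k. inverse (real (Suc k)) *\<^sub>R (q - w)) \<longlonglongrightarrow> 0 *\<^sub>R (q - w)"
    by (intro tendsto_scaleR LIMSEQ_inverse_real_of_nat tendsto_const)
  then have lim: "z \<longlonglongrightarrow> w" unfolding z_def[abs_def] using tendsto_add[OF tendsto_const[of w]] by fastforce
  have zB: "z k \<in> ball q r" for k
  proof -
    have "q - z k = (1 - inverse (real (Suc k))) *\<^sub>R (q - w)" by (simp add: z_def algebra_simps)
    then have "dist q (z k) = \<bar>1 - inverse (real (Suc k))\<bar> * r" using w by (simp add: dist_norm)
    also have "\<bar>1 - inverse (real (Suc k))\<bar> = 1 - inverse (real (Suc k))"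
      by (simp add: field_simps)
    also have "(1 - inverse (real (Suc k))) * r < 1 * r" using r by (intro mult_strict_right_mono) auto
    finally show ?thesis by simp
  qed
  have "\<exists>K. \<forall>k\<ge>K. \<forall>l\<ge>K. d\<^sub>x (g (z k)) (g (z l)) < e" if "e > 0" for e
  proof -
    obtain K where K: "\<And>k l. k \<ge> K \<Longrightarrow> l \<ge> K \<Longrightarrow> dist (z k) (z l) < e"
      using LIMSEQ_imp_Cauchy[OF lim] \<open>e > 0\<close> unfolding Cauchy_def by blast
    have "d\<^sub>x (g (z k)) (g (z l)) < e" if "k \<ge> K" "l \<ge> K" for k l
      using sect_dist_le[OF g closed_segment_subset[OF zB zB convex_ball], of k l] K[OF that]
      by (simp add: dist_norm norm_minus_commute)
    then show ?thesis by blast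
  qed
  from complete_limit[OF complete sectD(1)[OF g zB] this]
  obtain m where m: "m \<in> topspace M" "\<And>V. openin M V \<Longrightarrow> m \<in> V \<Longrightarrow> \<forall>\<^sub>F k in sequentially. g (z k) \<in> V" by blast
  show thesis
  proof (rule that[OF m(1)])
    have "z \<longlonglongrightarrow> proj m"
    proof (rule topological_tendstoI)
      fix S assume S: "open S" "proj m \<in> S"
      have "openin M {p \<in> topspace M. proj p \<in> S}"
        using smooth_map_continuous[OF smooth_proj] S(1) by (simp add: continuous_map_def)
      from m(2)[OF this] m(1) S(2) have "\<forall>\<^sub>F k in sequentially. proj (g (z k)) \<in> S" by (simp add: eventually_conj_iff)
      then show "\<forall>\<^sub>F k in sequentially. z k \<in> S" using sectD(2)[OF g zB] by simp
    qed
    then show "proj m = w" using lim LIMSEQ_unique by blast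
    fix V and e :: real assume V: "openin M V" "m \<in> V" "e > 0"
    have "\<forall>\<^sub>F k in sequentially. g (z k) \<in> V \<and> dist (z k) w < e"
      using m(2)[OF V(1,2)] tendstoD[OF lim V(3)] by (rule eventually_conj)
    then obtain k where "g (z k) \<in> V" "dist (z k) w < e" by (auto simp: eventually_sequentially)
    then show "\<exists>z\<in>ball q r \<inter> ball w e. g z \<in> V" using zB[of k] by (intro bexI[of _ "z k"]) (auto simp: dist_commute)
  qed
qed

text \<open>The limit of a lifted radius has a local section around it. That section shares a value
  with \<open>g\<close> at some point of the overlap of the two balls, and the overlap is
  convex.\<close>

lemma boundary_sect:
  assumes r: "r > 0" and g: "sect (ball q r) g" and w: "dist q w = r"
  shows "\<exists>\<rho> s. \<rho> > 0 \<and> sect (ball w \<rho>) s \<and> (\<forall>z\<in>ball q r \<inter> ball w \<rho>. g z = s z)"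
proof -
  obtain m where m: "m \<in> topspace M" "proj m = w"
    "\<And>V e. openin M V \<Longrightarrow> m \<in> V \<Longrightarrow> e > 0 \<Longrightarrow> \<exists>z\<in>ball q r \<inter> ball w e. g z \<in> V"
    using radial_limit[OF r g w] by blast
  obtain \<rho> s V where s: "\<rho> > 0" "sect (ball (proj m) \<rho>) s" "openin M V" "m \<in> V"
    "\<And>q. q \<in> V \<Longrightarrow> proj q \<in> ball (proj m) \<rho> \<and> s (proj q) = q" using local_sect[OF m(1)] by blast
  let ?I = "ball q r \<inter> ball w \<rho>"
  have oI: "open ?I" by (intro open_Int open_ball)
  obtain z where z: "z \<in> ?I" "g z \<in> V" using m(3)[OF s(3,4,1)] by blast
  have "g z = s z" using s(5)[OF z(2)] sectD(2)[OF g, of z] z(1) by simp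
  moreover have "sect ?I g" by (rule sect_subset[OF g oI]) simp
  moreover have "sect ?I s" by (rule sect_subset[OF s(2) oI]) (simp add: m(2))
  moreover have "connected ?I" by (intro convex_connected convex_Int convex_ball)
  ultimately have "g y = s y" if "y \<in> ?I" for y using sect_unique[of ?I g s z y] z(1) that by blast
  then show ?thesis using s(1,2) unfolding m(2) by (intro exI[of _ \<rho>] exI[of _ s]) auto
qed

text \<open>Two balls centred on the sphere that meet also meet in a point of the chord between their
  centres. That point lies inside the sphere, where the local sections agree with \<open>g\<close>.\<close>

lemma extend_sect:
  assumes r: "r > 0" and g: "sect (ball q r) g"
  obtains r' g' where "r' > r" "sect (ball q r') g'" "g' q = g q"
proof -
  obtain \<rho> s where s: "\<And>w. w \<in> sphere q r \<Longrightarrow> \<rho> w > 0 \<and> sect (ball w (\<rho> w)) (s w) \<and> (\<forall>z\<in>ball q r \<inter> ball w (\<rho> w). g z = s w z)"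
    using boundary_sect[OF r g] unfolding mem_sphere by metis
  define W where "W = ball q r \<union> (\<Union>w\<in>sphere q r. ball w (\<rho> w))"
  define G where "G z = (if z \<in> ball q r then g z else s (SOME w. w \<in> sphere q r \<and> z \<in> ball w (\<rho> w)) z)" for z
  have agree: "s w z = s w' z" if w: "w \<in> sphere q r" "w' \<in> sphere q r" and z: "z \<in> ball w (\<rho> w)" "z \<in> ball w' (\<rho> w')" for w w' z
  proof (cases "w = w'")
    case False
    let ?I = "ball w (\<rho> w) \<inter> ball w' (\<rho> w')"
    have pos: "\<rho> w > 0" "\<rho> w' > 0" using s w by auto
    have lt: "dist w w' < \<rho> w + \<rho> w'"
      using dist_triangle[of w w' z] z by (simp add: dist_commute)
    \<comment> \<open>Dividing the chord in the ratio of the radii puts \<open>c\<close> into both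
      balls as soon as the distance of the centres is less than the sum of the radii.\<close>
    define t where "t = \<rho> w / (\<rho> w + \<rho> w')"
    have t: "0 < t" "t < 1" "1 - t = \<rho> w' / (\<rho> w + \<rho> w')" using pos by (auto simp: t_def field_simps)
    define c where "c = (1 - t) *\<^sub>R w + t *\<^sub>R w'"
    have "w - c = t *\<^sub>R (w - w')" "w' - c = (1 - t) *\<^sub>R (w' - w)" by (simp_all add: c_def algebra_simps)
    moreover have "\<bar>t\<bar> = t" "\<bar>1 - t\<bar> = 1 - t" using t(1,2) by simp_all
    ultimately have "dist w c = t * dist w w'" "dist w' c = (1 - t) * dist w w'"
      by (simp_all only: dist_norm norm_scaleR norm_minus_commute[of w' w])
    moreover have "t * dist w w' < t * (\<rho> w + \<rho> w')" "(1 - t) * dist w w' < (1 - t) * (\<rho> w + \<rho> w')"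
      using lt t(1,2) by (intro mult_strict_left_mono; simp)+
    moreover have "t * (\<rho> w + \<rho> w') = \<rho> w" "(1 - t) * (\<rho> w + \<rho> w') = \<rho> w'" using pos by (simp_all add: t_def field_simps)
    ultimately have cI: "c \<in> ?I" by simp
    have "c \<in> open_segment w w'" unfolding in_segment c_def using False t by auto
    from dist_decreases_open_segment[OF this, of q] have cB: "c \<in> ball q r" using w by auto
    have "s w c = s w' c" using s[OF w(1)] s[OF w(2)] cI cB by (metis Int_iff)
    moreover have "sect ?I (s w)" "sect ?I (s w')" using s w by (auto intro: sect_subset)
    moreover have "connected ?I" by (intro convex_connected convex_Int convex_ball)
    ultimately show ?thesis using sect_unique[of ?I "s w" "s w'" c z] cI z by blast
  qed simp
  have Gs: "G z = s w z" if w: "w \<in> sphere q r" "z \<in> ball w (\<rho> w)" for w z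
  proof (cases "z \<in> ball q r")
    case True
    then show ?thesis using s[OF w(1)] w(2) by (simp add: G_def)
  next
    case False
    let ?w = "SOME w. w \<in> sphere q r \<and> z \<in> ball w (\<rho> w)"
    have "?w \<in> sphere q r \<and> z \<in> ball ?w (\<rho> ?w)" using w by (intro someI_ex[of "\<lambda>w. w \<in> sphere q r \<and> z \<in> ball w (\<rho> w)"]) blast
    then show ?thesis using agree[of ?w w z] w False by (simp add: G_def)
  qed
  have "sect W G"
  proof (rule sect_glue)
    fix z assume "z \<in> W"
    then consider "z \<in> ball q r" | w where "w \<in> sphere q r" "z \<in> ball w (\<rho> w)" unfolding W_def by blast
    then show "\<exists>T h. T \<subseteq> W \<and> z \<in> T \<and> sect T h \<and> (\<forall>y\<in>T. G y = h y)"
    proof cases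
      case 1
      then show ?thesis using g by (intro exI[of _ "ball q r"] exI[of _ g]) (auto simp: W_def G_def)
    next
      case (2 w)
      then show ?thesis using s[OF 2(1)] Gs[OF 2(1)] by (intro exI[of _ "ball w (\<rho> w)"] exI[of _ "s w"]) (auto simp: W_def)
    qed
  qed
  moreover have sub: "cball q r \<subseteq> W"
  proof
    fix z assume "z \<in> cball q r"
    then consider "z \<in> ball q r" | "z \<in> sphere q r" by fastforce
    then show "z \<in> W"
    proof cases
      case 2
      then have "z \<in> ball z (\<rho> z)" using s[OF 2] by simp
      then show ?thesis unfolding W_def using 2 by blast
    qed (simp add: W_def)
  qed
  \<comment> \<open>The radii at the boundary points were chosen pointwise; compactness of the
    closed ball turns them into a uniform margin.\<close>
  ultimately obtain e where e: "e > 0" "(\<Union>y\<in>cball q r. ball y e) \<subseteq> W"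
    using compact_subset_open_imp_ball_epsilon_subset[OF compact_cball, of W q r] by (auto simp: sect_def)
  have "ball q (r + e) \<subseteq> W"
  proof
    fix z assume z: "z \<in> ball q (r + e)"
    show "z \<in> W"
    proof (cases "dist q z \<le> r")
      case True
      then show ?thesis using sub by auto
    next
      case False
      \<comment> \<open>The radial projection of \<open>z\<close> to the sphere, at distance
        \<open>dist q z - r\<close> from \<open>z\<close>.\<close>
      define y where "y = q + (r / dist q z) *\<^sub>R (z - q)"
      have d: "dist q z > 0" using False r by linarith
      have "dist q y = \<bar>r / dist q z\<bar> * norm (z - q)" by (simp add: y_def dist_norm)
      then have dqy: "dist q y = r" using d r by (simp add: dist_norm norm_minus_commute)
      have "z - y = (1 - r / dist q z) *\<^sub>R (z - q)" by (simp add: y_def algebra_simps)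
      then have "dist y z = \<bar>1 - r / dist q z\<bar> * dist q z" by (metis dist_commute dist_norm norm_scaleR)
      moreover have "\<bar>1 - r / dist q z\<bar> = 1 - r / dist q z" using False d by (simp add: field_simps)
      moreover have "(1 - r / dist q z) * dist q z = dist q z - r" using d by (simp add: left_diff_distrib)
      ultimately have "dist y z = dist q z - r" by simp
      then have "z \<in> ball y e" "y \<in> cball q r" using z dqy by simp_all
      then show ?thesis using e(2) by blast
    qed
  qed
  then have "sect (ball q (r + e)) G" using sect_subset[OF \<open>sect W G\<close>] by blast
  then show thesis using that[of "r + e" G] e(1) r by (auto simp: G_def)
qed

text \<open>The sections are given for one radius at a time. Their common value at the centre makes
  them compatible by uniqueness, so they glue.\<close>

lemma union_sect:
  assumes I: "I \<noteq> {}" "\<And>r. r \<in> I \<Longrightarrow> r > 0" and P: "\<And>r. r \<in> I \<Longrightarrow> \<exists>g. sect (ball q r) g \<and> g q = p"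
  obtains G where "sect (\<Union>r\<in>I. ball q r) G" "G q = p"
proof -
  obtain g where g: "\<And>r. r \<in> I \<Longrightarrow> sect (ball q r) (g r) \<and> g r q = p" using P by metis
  define G where "G z = g (SOME r. r \<in> I \<and> z \<in> ball q r) z" for z
  have agree: "g r z = g r' z" if r: "r \<in> I" "r' \<in> I" "r \<le> r'" "z \<in> ball q r" for r r' z
  proof -
    have "sect (ball q r) (g r')" using g[OF r(2)] r(3) by (auto intro: sect_subset)
    then show ?thesis using sect_unique[of "ball q r" "g r" "g r'" q z] g[OF r(1)] g[OF r(2)] r I(2) by auto
  qed
  have Gg: "G z = g r z" if r: "r \<in> I" "z \<in> ball q r" for r z
  proof -
    let ?r = "SOME r. r \<in> I \<and> z \<in> ball q r"
    have r': "?r \<in> I \<and> z \<in> ball q ?r" using r by (intro someI_ex[of "\<lambda>r. r \<in> I \<and> z \<in> ball q r"]) blast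
    have Gz: "G z = g ?r z" by (rule G_def)
    show ?thesis
    proof (cases "r \<le> ?r")
      case True
      show ?thesis unfolding Gz by (rule agree[OF r(1) conjunct1[OF r'] True r(2), symmetric])
    next
      case False
      then have "?r \<le> r" by simp
      show ?thesis unfolding Gz by (rule agree[OF conjunct1[OF r'] r(1) \<open>?r \<le> r\<close> conjunct2[OF r']])
    qed
  qed
  have "sect (\<Union>r\<in>I. ball q r) G"
  proof (rule sect_glue)
    fix z assume "z \<in> (\<Union>r\<in>I. ball q r)"
    then obtain r where r: "r \<in> I" "z \<in> ball q r" by blast
    then show "\<exists>T h. T \<subseteq> (\<Union>r\<in>I. ball q r) \<and> z \<in> T \<and> sect T h \<and> (\<forall>y\<in>T. G y = h y)"
      using g[OF r(1)] Gg[OF r(1)] by (intro exI[of _ "ball q r"] exI[of _ "g r"]) auto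
  qed
  moreover obtain r where "r \<in> I" using I(1) by blast
  then have "G q = p" using Gg[of r q] g I(2) by auto
  ultimately show thesis by (rule that)
qed

lemma global_sect:
  assumes p: "p \<in> topspace M"
  obtains G where "sect UNIV G" "G (proj p) = p"
proof -
  let ?q = "proj p"
  define P where "P r \<longleftrightarrow> (\<exists>g. sect (ball ?q r) g \<and> g ?q = p)" for r
  define I where "I = {r. r > 0 \<and> P r}"
  obtain \<rho> s V where s: "\<rho> > 0" "sect (ball ?q \<rho>) s" "openin M V" "p \<in> V"
    "\<And>q. q \<in> V \<Longrightarrow> proj q \<in> ball ?q \<rho> \<and> s (proj q) = q" using local_sect[OF p] by blast
  have sp: "s ?q = p" using s(5)[OF s(4)] by simp
  have \<rho>: "\<rho> \<in> I" using s(1,2) sp unfolding I_def P_def by blast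
  then have Ine: "I \<noteq> {}" by blast
  obtain G where G: "sect (\<Union>r\<in>I. ball ?q r) G" "G ?q = p"
  proof (rule union_sect[OF Ine, of ?q p])
    fix r assume "r \<in> I"
    then have "r > 0 \<and> P r" unfolding I_def by (rule CollectD)
    then show "r > 0" "\<exists>g. sect (ball ?q r) g \<and> g ?q = p" unfolding P_def by (rule conjunct1, rule conjunct2)
  qed
  have unb: "\<not> bdd_above I"
  proof
    assume b: "bdd_above I"
    \<comment> \<open>The balls with radii in \<open>I\<close> exhaust the open ball of radius
      \<open>R\<close>, so the glued section lives on it and \<open>extend_sect\<close> would
      produce an element of \<open>I\<close> beyond the supremum.\<close>
    define R where "R = Sup I"
    have R: "R > 0" using cSup_upper[OF \<rho> b] s(1) by (simp add: R_def)
    have "ball ?q R \<subseteq> (\<Union>r\<in>I. ball ?q r)"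
    proof
      fix z assume "z \<in> ball ?q R"
      then obtain r where "r \<in> I" "dist ?q z < r" using less_cSup_iff[OF Ine b] by (auto simp: R_def)
      then show "z \<in> (\<Union>r\<in>I. ball ?q r)" by auto
    qed
    then have "sect (ball ?q R) G" using sect_subset[OF G(1)] by blast
    from extend_sect[OF R this] obtain r' g' where g': "r' > R" "sect (ball ?q r') g'" "g' ?q = G ?q" by blast
    then have "r' \<in> I" using G(2) R by (auto simp: I_def P_def)
    from cSup_upper[OF this b] show False using g'(1) by (simp add: R_def)
  qed
  have "(\<Union>r\<in>I. ball ?q r) = UNIV"
  proof -
    have "z \<in> (\<Union>r\<in>I. ball ?q r)" for z
    proof -
      obtain r where "r \<in> I" "dist ?q z < r" using unb unfolding bdd_above_def by (metis not_le)
      then show ?thesis by auto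
    qed
    then show ?thesis by blast
  qed
  then show thesis using that G by simp
qed

text \<open>A global section alone gives only one sheet over the horizontal space. Its image is open
  and closed in the connected \<open>M\<close>, so there are no other sheets and the projection is
  injective.\<close>

theorem complete_graph:
  "\<exists>\<xi>. smooth_param UNIV \<xi> \<and> (\<forall>z. proj (\<xi> z) = z) \<and> (\<forall>p\<in>topspace M. \<xi> (proj p) = p)"
proof -
  obtain p0 where "p0 \<in> topspace M" using ne by blast
  then obtain \<xi> where \<xi>: "sect UNIV \<xi>" by (rule global_sect)
  have eq: "\<xi> z = s z" if s: "sect (ball c \<rho>) s" and y: "y \<in> ball c \<rho>" "\<xi> y = s y" and z: "z \<in> ball c \<rho>" for s c \<rho> y z
    by (rule sect_unique[OF sect_subset[OF \<xi> open_ball] s connected_ball y z]) simp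
  have o1: "openin M (range \<xi>)"
  proof (subst openin_subopen, intro ballI)
    fix p assume p: "p \<in> range \<xi>"
    then obtain z where "p = \<xi> z" by blast
    then have \<xi>p: "\<xi> (proj p) = p" using sectD(2)[OF \<xi>, of z] by simp
    have "p \<in> topspace M" using p sectD(1)[OF \<xi>] by auto
    then obtain \<rho> s V where s: "\<rho> > 0" "sect (ball (proj p) \<rho>) s" "openin M V" "p \<in> V"
      "\<And>q. q \<in> V \<Longrightarrow> proj q \<in> ball (proj p) \<rho> \<and> s (proj q) = q" using local_sect by blast
    have "\<xi> (proj q) = q" if "q \<in> V" for q
      using eq[OF s(2), of "proj p" "proj q"] s(1) s(5)[OF s(4)] s(5)[OF that] \<xi>p by simp
    then have "V \<subseteq> range \<xi>" by (metis range_eqI subsetI)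
    then show "\<exists>T. openin M T \<and> p \<in> T \<and> T \<subseteq> range \<xi>" using s(3,4) by blast
  qed
  have o2: "openin M (topspace M - range \<xi>)"
  proof (subst openin_subopen, intro ballI)
    fix m assume m: "m \<in> topspace M - range \<xi>"
    then obtain \<rho> s V where s: "\<rho> > 0" "sect (ball (proj m) \<rho>) s" "openin M V" "m \<in> V"
      "\<And>q. q \<in> V \<Longrightarrow> proj q \<in> ball (proj m) \<rho> \<and> s (proj q) = q" using local_sect by blast
    \<comment> \<open>A nearby point on the image would make the global section coincide with the
      local one through \<open>m\<close>, and \<open>m\<close> would lie on the image too.\<close>
    have "q \<notin> range \<xi>" if q: "q \<in> V" for q
    proof
      assume "q \<in> range \<xi>"
      then obtain z where "q = \<xi> z" by blast
      then have "\<xi> (proj q) = q" using sectD(2)[OF \<xi>, of z] by simp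
      then have "\<xi> (proj m) = m"
        using eq[OF s(2), of "proj q" "proj m"] s(1) s(5)[OF s(4)] s(5)[OF q] by simp
      then show False using m by (metis DiffD2 range_eqI)
    qed
    then show "\<exists>T. openin M T \<and> m \<in> T \<and> T \<subseteq> topspace M - range \<xi>"
      using s(3,4) openin_subset[OF s(3)] by blast
  qed
  have sub: "range \<xi> \<subseteq> topspace M" using sectD(1)[OF \<xi>] by auto
  then have "closedin M (range \<xi>)" using o2 by (simp add: closedin_def)
  then have "range \<xi> = topspace M" using conn o1 unfolding connected_space_clopen_in by blast
  have "\<xi> (proj p) = p" if "p \<in> topspace M" for p
  proof -
    have "p \<in> range \<xi>" using that \<open>range \<xi> = topspace M\<close> by simp
    then obtain z where "p = \<xi> z" by (rule imageE)
    then show ?thesis using sectD(2)[OF \<xi>, of z] by simp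
  qed
  then show ?thesis using sect_param[OF \<xi>] sectD(2)[OF \<xi> UNIV_I] by blast
qed

end
end

section \<open>Curvature of a graph\<close>

lemma frechet_pd:
  assumes "smooth f" shows "frechet_derivative f (at z) v = (\<Sum>i\<in>UNIV. v $ i * pd i f z)"
proof -
  interpret linear "frechet_derivative f (at z)"
    using smooth_imp_has_derivative[OF assms UNIV_I] has_derivative_linear by blast
  have "v = (\<Sum>i\<in>UNIV. v $ i *\<^sub>R axis i 1)" by (simp add: basis_expansion flip: scalar_mult_eq_scaleR)
  then have "frechet_derivative f (at z) v = frechet_derivative f (at z) (\<Sum>i\<in>UNIV. v $ i *\<^sub>R axis i 1)" by simp
  then show ?thesis by (simp add: sum scale pd_def)
qed

section \<open>Orthonormal frames of a graph\<close>

text \<open>With \<open>a\<close> the gradient, \<open>G\<close> is the metric matrix and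
  \<open>Q\<close> its inverse by the Sherman-Morrison formula. If the columns of \<open>F\<close>
  are orthonormal for \<open>G\<close>, then \<open>F ** transpose F\<close> is the inverse of
  \<open>G\<close>; so sums over a frame depend on the metric alone.\<close>

lemma frame_completeness:
  fixes f :: "'n::finite \<Rightarrow> real ^ 'n" and a :: "real ^ 'n"
  assumes orth: "\<And>i j. f i \<bullet> f j - (a \<bullet> f i) * (a \<bullet> f j) = (if i = j then 1 else 0)" and a: "a \<bullet> a < 1"
  shows "(\<Sum>i\<in>UNIV. f i $ k * f i $ l) = (if k = l then 1 else 0) + a $ k * a $ l / (1 - a \<bullet> a)"
proof -
  define F where "F = (\<chi> k i. f i $ k)"
  define G where "G = ((\<chi> k l. (if k = l then 1 else 0) - a $ k * a $ l) :: real ^ 'n ^ 'n)"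
  define Q where "Q = ((\<chi> k l. (if k = l then 1 else 0) + a $ k * a $ l / (1 - a \<bullet> a)) :: real ^ 'n ^ 'n)"
  have GF: "(G ** F) $ k $ i = f i $ k - a $ k * (a \<bullet> f i)" for k i
    by (simp add: G_def F_def matrix_matrix_mult_def inner_vec_def left_diff_distrib sum_subtractf sum_delta_mult sum_distrib_left mult.assoc)
  have mm: "(A ** B) $ i $ j = (\<Sum>k\<in>UNIV. A $ i $ k * B $ k $ j)" for A B :: "real ^ 'n ^ 'n" and i j
    by (simp add: matrix_matrix_mult_def)
  have "(transpose F ** (G ** F)) $ i $ j = f i \<bullet> f j - (a \<bullet> f i) * (a \<bullet> f j)" for i j
  proof -
    have "(transpose F ** (G ** F)) $ i $ j = (\<Sum>k\<in>UNIV. f i $ k * (G ** F) $ k $ j)"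
      unfolding mm[of "transpose F"] by (simp add: transpose_def F_def)
    also have "\<dots> = (\<Sum>k\<in>UNIV. f i $ k * f j $ k - (a $ k * f i $ k) * (a \<bullet> f j))"
      by (simp add: GF algebra_simps)
    also have "\<dots> = f i \<bullet> f j - (a \<bullet> f i) * (a \<bullet> f j)"
      by (simp add: sum_subtractf inner_vec_def sum_distrib_right[symmetric])
    finally show ?thesis .
  qed
  then have "(transpose F ** G) ** F = mat 1"
    using orth by (simp add: matrix_mul_assoc[symmetric] vec_eq_iff mat_def)
  then have 1: "F ** (transpose F ** G) = mat 1" using matrix_left_right_inverse by blast
  have "(\<Sum>m\<in>UNIV. G $ k $ m * Q $ m $ l) = (if k = l then 1 else 0)" for k l
  proof -
    have "(\<Sum>m\<in>UNIV. G $ k $ m * Q $ m $ l) = (\<Sum>m\<in>UNIV. (if k = m then 1 else 0) * Q $ m $ l - a $ k * a $ m * (if m = l then 1 else 0)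
        - a $ k * (a $ m * a $ m) * (a $ l / (1 - a \<bullet> a)))"
      by (intro sum.cong) (auto simp: G_def Q_def algebra_simps)
    also have "\<dots> = Q $ k $ l - (\<Sum>m\<in>UNIV. a $ k * a $ m * (if m = l then 1 else 0)) - a $ k * (a \<bullet> a) * (a $ l / (1 - a \<bullet> a))"
      unfolding sum_subtractf sum_delta_mult inner_vec_def by (simp add: sum_distrib_left sum_distrib_right sum_divide_distrib)
    also have "(\<Sum>m\<in>UNIV. a $ k * a $ m * (if m = l then 1 else 0)) = a $ k * a $ l"
      using sum_delta_mult(1)[of "\<lambda>m. a $ k * a $ m" l] by (simp add: eq_commute)
    also have "Q $ k $ l - a $ k * a $ l - a $ k * (a \<bullet> a) * (a $ l / (1 - a \<bullet> a)) = (if k = l then 1 else 0)"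
    proof -
      have "y / (1 - t) - t * y / (1 - t) = y" if "t < 1" for y t :: real
      proof -
        have "y / (1 - t) - t * y / (1 - t) = (y * (1 - t)) / (1 - t)" by (simp add: diff_divide_distrib algebra_simps)
        then show ?thesis using that by simp
      qed
      from this[OF a, of "a $ k * a $ l"] show ?thesis by (simp add: Q_def mult_ac)
    qed
    finally show ?thesis .
  qed
  then have 2: "G ** Q = mat 1" by (simp add: vec_eq_iff matrix_matrix_mult_def mat_def)
  have "F ** transpose F = (F ** transpose F) ** (G ** Q)" unfolding 2 by simp
  also have "\<dots> = (F ** (transpose F ** G)) ** Q" by (simp add: matrix_mul_assoc)
  also have "\<dots> = Q" unfolding 1 by simp
  finally have "(F ** transpose F) $ k $ l = Q $ k $ l" by simp
  then show ?thesis by (simp add: F_def Q_def matrix_matrix_mult_def transpose_def)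
qed

text \<open>The frame is the positive square root of the inverse metric.\<close>

lemma frame_exists:
  fixes a :: "real ^ 'n::finite"
  assumes a: "a \<bullet> a < 1"
  shows "\<exists>f :: 'n \<Rightarrow> real ^ 'n. \<forall>i j. f i \<bullet> f j - (a \<bullet> f i) * (a \<bullet> f j) = (if i = j then 1 else 0)"
proof -
  define W where "W = sqrt (1 - a \<bullet> a)"
  have W: "W > 0" "a \<bullet> a = (1 - W) * (1 + W)" using a by (simp_all add: W_def algebra_simps)
  \<comment> \<open>Chosen so that \<open>1 + c * (a \<bullet> a) = 1 / W\<close>: the metric has
    eigenvalue W^2 in the direction \<open>a\<close>, and its inverse square root must have 1/W
    there.\<close>
  define c where "c = 1 / (W * (1 + W))"
  define f where "f i = axis i 1 + (c * a $ i) *\<^sub>R a" for i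
  have "c * ((1 - W) * (1 + W)) = ((1 - W) * (1 + W)) / (W * (1 + W))" by (simp add: c_def)
  also have "\<dots> = (1 - W) / W" using W(1) by (intro nonzero_mult_divide_mult_cancel_right) simp
  finally have c1: "1 + c * (a \<bullet> a) = 1 / W" unfolding W(2) using W(1) by (simp add: diff_divide_distrib)
  have nz: "W * W + W * (W * W) \<noteq> 0" using W(1) by (metis add_pos_pos mult_pos_pos less_irrefl)
  have "2 * c + c * (c * (a \<bullet> a)) = c * (1 + (1 + c * (a \<bullet> a)))" by (simp add: algebra_simps)
  also have "\<dots> = (1 / W)\<^sup>2" unfolding c1 unfolding c_def using W(1) nz by (simp add: field_simps power2_eq_square)
  finally have c2: "2 * c + c * (c * (a \<bullet> a)) = (1 + c * (a \<bullet> a))\<^sup>2" unfolding c1 .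
  have ax: "axis i 1 \<bullet> a = a $ i" "a \<bullet> axis i 1 = a $ i" for i by (simp_all add: inner_axis inner_axis')
  have af: "a \<bullet> f i = a $ i * (1 + c * (a \<bullet> a))" for i
    by (simp add: f_def inner_add_right inner_axis algebra_simps)
  have "f i \<bullet> f j = axis i 1 \<bullet> (axis j 1 :: real ^ 'n) + a $ i * a $ j * (2 * c + c * (c * (a \<bullet> a)))" for i j
    by (simp add: f_def inner_add_right inner_add_left ax algebra_simps)
  then have "f i \<bullet> f j - (a \<bullet> f i) * (a \<bullet> f j) = (if i = j then 1 else 0)" for i j
    unfolding c2 af by (simp add: inner_axis_axis power2_eq_square algebra_simps)
  then show ?thesis by blast
qed

locale immersion_normal = spacelike_hypersurface M \<A> x
  for M :: "'m topology" and \<A> :: "('m, 'n::finite) chart set" and x :: "'m \<Rightarrow> 'n lorentz_space" +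
  fixes N :: "'m \<Rightarrow> 'n lorentz_space"
  assumes normal: "unit_normal_field M \<A> x N"
begin

lemma smooth_N: "smooth_map \<A> N" using normal by (simp add: unit_normal_field_def)

lemma N_unit: "p \<in> topspace M \<Longrightarrow> \<langle>N p, N p\<rangle>\<^sub>L = - 1"
  and N_orth: "p \<in> topspace M \<Longrightarrow> \<langle>N p, differential \<A> x p v\<rangle>\<^sub>L = 0"
  using normal by (auto simp: unit_normal_field_def)

abbreviation "H \<equiv> mean_curvature \<A> x N"
abbreviation "S \<equiv> sq_norm_sff \<A> x N"

end

text \<open>The conclusion of \<open>complete_graph\<close> as assumptions. The locale is
  interpreted for \<open>x\<close> itself and for its image under a Lorentz reflection.\<close>

locale immersion_graph = immersion_normal M \<A> x N
  for M :: "'m topology" and \<A> :: "('m, 'n::finite) chart set" and x :: "'m \<Rightarrow> 'n lorentz_space" and N +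
  fixes \<xi> :: "real ^ 'n \<Rightarrow> 'm"
  assumes param: "smooth_param UNIV \<xi>" and proj_\<xi>: "\<And>z. proj (\<xi> z) = z"
    and \<xi>_proj: "\<And>p. p \<in> topspace M \<Longrightarrow> \<xi> (proj p) = p"
begin

section \<open>Height function, normal and second fundamental form\<close>

definition "w z = snd (x (\<xi> z))"
definition "n0 z = snd (N (\<xi> z))"
definition grad :: "real ^ 'n \<Rightarrow> real ^ 'n" where "grad z = (\<chi> i. pd i w z)"
abbreviation "h i j \<equiv> pd i (pd j w)"
abbreviation "\<Lambda> \<equiv> tangent \<xi>"

lemma grad_nth [simp]: "grad z $ i = pd i w z" by (simp add: grad_def)

lemma in_M: "\<xi> z \<in> topspace M" by (rule param_in[OF param UNIV_I])

lemma smooth_linear_param: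
  assumes "smooth_map \<A> f" "bounded_linear L" shows "smooth (\<lambda>z. L (f (\<xi> z)))"
  using smooth_on_param[OF param assms(1)] unfolding smooth_on_def o_def
  by (intro allI k_smooth_on_linear_comp[OF open_UNIV assms(2)]) blast

lemma smooth_w [simp]: "smooth w" and smooth_n0 [simp]: "smooth n0"
  using smooth_linear_param[OF smooth_x bounded_linear_snd] smooth_linear_param[OF smooth_N bounded_linear_snd]
  by (simp_all add: w_def[abs_def] n0_def[abs_def])

lemma x_eq: "x (\<xi> z) = (z, w z)"
  using proj_\<xi>[of z] by (simp add: proj_def w_def prod_eq_iff)

lemma frechet_w: "frechet_derivative w (at z) v = grad z \<bullet> v"
  by (simp add: frechet_pd inner_vec_def mult.commute)

lemma dx: "differential \<A> x (\<xi> z) (\<Lambda> z v) = (v, grad z \<bullet> v)"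
proof -
  have "((\<lambda>z. (z, w z)) has_derivative (\<lambda>v. (v, frechet_derivative w (at z) v))) (at z)"
    by (intro has_derivative_Pair has_derivative_ident smooth_imp_has_derivative[of UNIV]) auto
  moreover have "x \<circ> \<xi> = (\<lambda>z. (z, w z))" by (auto simp: x_eq)
  ultimately have "(\<lambda>v. differential \<A> x (\<xi> z) (\<Lambda> z v)) = (\<lambda>v. (v, frechet_derivative w (at z) v))"
    using has_derivative_unique[OF param_derivative(1)[OF param UNIV_I smooth_x]] by metis
  then show ?thesis unfolding frechet_w by metis
qed

lemma lin_\<Lambda>: "linear (\<Lambda> z)" by (rule param_derivative(2)[OF param UNIV_I smooth_x])

lemma inj_\<Lambda>: "inj (\<Lambda> z)" by (metis (no_types, lifting) dx fst_conv injI)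

lemma surj_\<Lambda>: "\<Lambda> z (inv (\<Lambda> z) u) = u"
  by (rule surj_f_inv_f[OF linear_injective_imp_surjective[OF lin_\<Lambda> inj_\<Lambda> refl]])

lemma metric: "induced_metric \<A> x (\<xi> z) (\<Lambda> z v) (\<Lambda> z u) = v \<bullet> u - (grad z \<bullet> v) * (grad z \<bullet> u)"
  by (simp add: induced_metric_def dx lorentz_def)

text \<open>The tangent vectors are the pairs \<open>(v, grad z \<bullet> v)\<close>, so
  orthogonality to all of them determines the horizontal part of the normal from its vertical part
  \<open>n0\<close>. The sign of \<open>n0\<close> is left open.\<close>

lemma normal_fst: "fst (N (\<xi> z)) = n0 z *\<^sub>R grad z"
proof -
  have "(fst (N (\<xi> z)) - n0 z *\<^sub>R grad z) \<bullet> v = 0" for v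
    using N_orth[OF in_M, of z "\<Lambda> z v"] unfolding dx by (simp add: lorentz_def n0_def inner_diff_left)
  then show ?thesis by (metis eq_iff_diff_eq_0 inner_eq_zero_iff)
qed

lemma n0_sq: "(n0 z)\<^sup>2 * (1 - grad z \<bullet> grad z) = 1"
  using N_unit[OF in_M, of z] unfolding lorentz_def normal_fst
  by (simp add: n0_def[symmetric] power2_eq_square algebra_simps)

lemma grad_lt: "grad z \<bullet> grad z < 1"
proof (rule ccontr)
  assume "\<not> ?thesis"
  then have "(n0 z)\<^sup>2 * (1 - grad z \<bullet> grad z) \<le> 0" by (intro mult_nonneg_nonpos) auto
  then show False using n0_sq[of z] by simp
qed

lemma dN: "fst (differential \<A> N (\<xi> z) (\<Lambda> z v)) $ i
     = frechet_derivative n0 (at z) v * pd i w z + n0 z * (\<Sum>j\<in>UNIV. v $ j * h j i z)"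
   "snd (differential \<A> N (\<xi> z) (\<Lambda> z v)) = frechet_derivative n0 (at z) v"
proof -
  have D: "((\<lambda>z. N (\<xi> z)) has_derivative (\<lambda>v. differential \<A> N (\<xi> z) (\<Lambda> z v))) (at z)"
    using param_derivative(1)[OF param UNIV_I smooth_N] by (simp add: o_def)
  have "((\<lambda>z. fst (N (\<xi> z)) $ i) has_derivative (\<lambda>v. fst (differential \<A> N (\<xi> z) (\<Lambda> z v)) $ i)) (at z)"
    by (rule bounded_linear.has_derivative[OF bounded_linear_vec_nth has_derivative_fst[OF D]])
  moreover have "(\<lambda>z. fst (N (\<xi> z)) $ i) = (\<lambda>z. n0 z * pd i w z)" by (simp add: normal_fst)
  moreover have "((\<lambda>z. n0 z * pd i w z) has_derivative
      (\<lambda>v. n0 z * frechet_derivative (pd i w) (at z) v + frechet_derivative n0 (at z) v * pd i w z)) (at z)"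
    by (intro has_derivative_mult smooth_imp_has_derivative[of UNIV]) auto
  ultimately have eq: "(\<lambda>v. fst (differential \<A> N (\<xi> z) (\<Lambda> z v)) $ i) =
     (\<lambda>v. n0 z * frechet_derivative (pd i w) (at z) v + frechet_derivative n0 (at z) v * pd i w z)"
    by (simp only: has_derivative_unique)
  have "frechet_derivative (pd i w) (at z) v = (\<Sum>j\<in>UNIV. v $ j * h j i z)" by (rule frechet_pd) simp
  with fun_cong[OF eq, of v] show "fst (differential \<A> N (\<xi> z) (\<Lambda> z v)) $ i
     = frechet_derivative n0 (at z) v * pd i w z + n0 z * (\<Sum>j\<in>UNIV. v $ j * h j i z)" by simp
  have "(n0 has_derivative (\<lambda>v. snd (differential \<A> N (\<xi> z) (\<Lambda> z v)))) (at z)"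
    unfolding n0_def[abs_def] by (rule has_derivative_snd[OF D])
  from frechet_derivative_eqI[OF this]
  show "snd (differential \<A> N (\<xi> z) (\<Lambda> z v)) = frechet_derivative n0 (at z) v" by simp
qed

definition hess :: "real ^ 'n \<Rightarrow> real ^ 'n \<Rightarrow> real ^ 'n \<Rightarrow> real" where
  "hess z v u = (\<Sum>i\<in>UNIV. \<Sum>j\<in>UNIV. v $ i * h i j z * u $ j)"

lemma h_sym: "h i j z = h j i z" by (metis pd_commute smooth_w)

text \<open>The normal is \<open>n0\<close> times (gradient, 1). Differentiating the factor gives a
  multiple of the normal, which is orthogonal to tangent vectors; what remains is \<open>n0\<close>
  times the Hessian.\<close>

lemma sff: "second_fundamental_form \<A> x N (\<xi> z) (\<Lambda> z v) (\<Lambda> z u) = n0 z * hess z v u"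
proof -
  let ?d = "frechet_derivative n0 (at z) v"
  have "fst (differential \<A> N (\<xi> z) (\<Lambda> z v)) \<bullet> u
     = (\<Sum>i\<in>UNIV. ?d * (pd i w z * u $ i) + n0 z * (\<Sum>j\<in>UNIV. v $ j * h j i z * u $ i))"
    by (simp add: inner_vec_def dN algebra_simps sum_distrib_left)
  also have "\<dots> = ?d * (grad z \<bullet> u) + n0 z * (\<Sum>i\<in>UNIV. \<Sum>j\<in>UNIV. v $ j * h j i z * u $ i)"
    by (simp add: sum.distrib sum_distrib_left inner_vec_def)
  also have "(\<Sum>i\<in>UNIV. \<Sum>j\<in>UNIV. v $ j * h j i z * u $ i) = hess z v u"
    unfolding hess_def by (rule sum.swap)
  finally show ?thesis unfolding second_fundamental_form_def dx lorentz_def by (simp add: dN)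
qed

text \<open>\<open>H\<close> and \<open>S\<close> use an unknown frame picked by
  \<open>SOME\<close>. Since a frame exists, the picked one is orthonormal, and that is all that is
  kept of it.\<close>

lemma frame_some:
  "\<exists>f :: 'n \<Rightarrow> real ^ 'n. (\<forall>i j. f i \<bullet> f j - (grad z \<bullet> f i) * (grad z \<bullet> f j) = (if i = j then 1 else 0)) \<and>
    H (\<xi> z) = (\<Sum>i\<in>UNIV. n0 z * hess z (f i) (f i)) \<and>
    S (\<xi> z) = (\<Sum>i\<in>UNIV. \<Sum>j\<in>UNIV. (n0 z * hess z (f i) (f j))\<^sup>2)"
proof -
  obtain f0 :: "'n \<Rightarrow> real ^ 'n" where f0: "\<And>i j. f0 i \<bullet> f0 j - (grad z \<bullet> f0 i) * (grad z \<bullet> f0 j) = (if i = j then 1 else 0)"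
    using frame_exists[OF grad_lt[of z]] by auto
  define e where "e = (SOME e. orthonormal_frame \<A> x (\<xi> z) e)"
  have "orthonormal_frame \<A> x (\<xi> z) (\<lambda>i. \<Lambda> z (f0 i))" using f0 by (simp add: orthonormal_frame_def metric)
  then have e: "orthonormal_frame \<A> x (\<xi> z) e" unfolding e_def by (rule someI[of "orthonormal_frame \<A> x (\<xi> z)"])
  define f where "f i = inv (\<Lambda> z) (e i)" for i
  have f: "e i = \<Lambda> z (f i)" for i unfolding f_def surj_\<Lambda> ..
  show ?thesis
  proof (intro exI[of _ f] conjI allI)
    show "f i \<bullet> f j - (grad z \<bullet> f i) * (grad z \<bullet> f j) = (if i = j then 1 else 0)" for i j
      using e unfolding orthonormal_frame_def f metric by blast
    show "H (\<xi> z) = (\<Sum>i\<in>UNIV. n0 z * hess z (f i) (f i))"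
      unfolding mean_curvature_def Let_def e_def[symmetric] f sff ..
    show "S (\<xi> z) = (\<Sum>i\<in>UNIV. \<Sum>j\<in>UNIV. (n0 z * hess z (f i) (f j))\<^sup>2)"
      unfolding sq_norm_sff_def Let_def e_def[symmetric] f sff ..
  qed
qed

section \<open>Mean curvature and squared norm through the height function\<close>

abbreviation "al z \<equiv> (\<Sum>i\<in>UNIV. pd i w z * pd i w z)"
abbreviation "ga z \<equiv> (\<Sum>i\<in>UNIV. \<Sum>j\<in>UNIV. pd i w z * h i j z * pd j w z)"
abbreviation "be z \<equiv> (\<Sum>i\<in>UNIV. (\<Sum>j\<in>UNIV. h i j z * pd j w z) * (\<Sum>j\<in>UNIV. h i j z * pd j w z))"
abbreviation "tr z \<equiv> (\<Sum>i\<in>UNIV. \<Sum>j\<in>UNIV. h i j z * h i j z)"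

lemma al_eq: "al z = grad z \<bullet> grad z" by (simp add: inner_vec_def)

text \<open>With the inverse metric Q = 1 + s a a^T from \<open>frame_completeness\<close> and the
  Hessian B, \<open>H\<close> is \<open>n0\<close> tr(Q B) and \<open>S\<close> is
  \<open>n0\<close>^2 tr(Q B Q B), expanded in powers of s.\<close>

lemma curvatures:
  defines "s z \<equiv> 1 / (1 - al z)"
  shows "H (\<xi> z) = n0 z * ((\<Sum>i\<in>UNIV. h i i z) + s z * ga z)"
    "S (\<xi> z) = (n0 z)\<^sup>2 * (tr z + 2 * s z * be z + (s z)\<^sup>2 * (ga z)\<^sup>2)"
proof -
  obtain f :: "'n \<Rightarrow> real ^ 'n" where f: "\<And>i j. f i \<bullet> f j - (grad z \<bullet> f i) * (grad z \<bullet> f j) = (if i = j then 1 else 0)"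
    "H (\<xi> z) = (\<Sum>i\<in>UNIV. n0 z * hess z (f i) (f i))"
    "S (\<xi> z) = (\<Sum>i\<in>UNIV. \<Sum>j\<in>UNIV. (n0 z * hess z (f i) (f j))\<^sup>2)" using frame_some[of z] by auto
  define a where "a k = pd k w z" for k
  define B where "B k l = h k l z" for k l
  define Q where "Q k l = (if k = l then 1 else 0) + s z * a k * a l" for k l
  have Bsym: "B k l = B l k" for k l unfolding B_def by (rule h_sym)
  have Q: "(\<Sum>i\<in>UNIV. f i $ k * f i $ l) = Q k l" for k l
    using frame_completeness[of f "grad z" k l, OF f(1) grad_lt] by (simp add: Q_def s_def al_eq a_def)
  have contrQ: "(\<Sum>l\<in>UNIV. Q k l * y l) = y k + s z * a k * (\<Sum>l\<in>UNIV. a l * y l)" for k y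
    by (simp add: Q_def distrib_right sum.distrib sum_delta_mult sum_distrib_left mult.assoc)
  have "(\<Sum>i\<in>UNIV. hess z (f i) (f i)) = (\<Sum>k\<in>UNIV. \<Sum>i\<in>UNIV. \<Sum>l\<in>UNIV. f i $ k * B k l * f i $ l)"
    unfolding hess_def B_def by (rule sum.swap)
  also have "\<dots> = (\<Sum>k\<in>UNIV. \<Sum>l\<in>UNIV. \<Sum>i\<in>UNIV. f i $ k * B k l * f i $ l)" by (intro sum.cong refl sum.swap)
  also have "\<dots> = (\<Sum>k\<in>UNIV. \<Sum>l\<in>UNIV. Q k l * B k l)" unfolding Q[symmetric] by (simp add: sum_distrib_left mult_ac)
  also have "\<dots> = (\<Sum>k\<in>UNIV. B k k) + s z * (\<Sum>k\<in>UNIV. \<Sum>l\<in>UNIV. a k * B k l * a l)"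
    unfolding contrQ by (simp add: sum.distrib sum_distrib_left mult_ac)
  finally have "(\<Sum>i\<in>UNIV. hess z (f i) (f i)) = \<dots>" .
  then show "H (\<xi> z) = n0 z * ((\<Sum>i\<in>UNIV. h i i z) + s z * ga z)"
    unfolding f(2) sum_distrib_left[symmetric] by (simp add: a_def B_def)
  define u where "u k = (\<Sum>l\<in>UNIV. B k l * a l)" for k
  define \<gamma> where "\<gamma> = (\<Sum>k\<in>UNIV. a k * u k)"
  have "(\<Sum>j\<in>UNIV. (hess z v (f j))\<^sup>2) = (\<Sum>l\<in>UNIV. \<Sum>m\<in>UNIV. Q l m * ((\<Sum>k\<in>UNIV. v $ k * B k l) * (\<Sum>k\<in>UNIV. v $ k * B k m)))" for v
  proof -
    let ?b = "\<lambda>l. \<Sum>k\<in>UNIV. v $ k * B k l"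
    have hv: "hess z v y = (\<Sum>l\<in>UNIV. ?b l * y $ l)" for y
      unfolding hess_def B_def[symmetric] by (subst sum.swap) (simp add: sum_distrib_right)
    have "(\<Sum>j\<in>UNIV. (hess z v (f j))\<^sup>2) = (\<Sum>j\<in>UNIV. \<Sum>l\<in>UNIV. \<Sum>m\<in>UNIV. (?b l * f j $ l) * (?b m * f j $ m))"
      unfolding hv power2_eq_square sum_product ..
    also have "\<dots> = (\<Sum>l\<in>UNIV. \<Sum>j\<in>UNIV. \<Sum>m\<in>UNIV. (?b l * f j $ l) * (?b m * f j $ m))" by (rule sum.swap)
    also have "\<dots> = (\<Sum>l\<in>UNIV. \<Sum>m\<in>UNIV. \<Sum>j\<in>UNIV. (?b l * f j $ l) * (?b m * f j $ m))" by (intro sum.cong refl sum.swap)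
    also have "\<dots> = (\<Sum>l\<in>UNIV. \<Sum>m\<in>UNIV. \<Sum>j\<in>UNIV. (f j $ l * f j $ m) * (?b l * ?b m))" by (simp only: mult_ac)
    also have "\<dots> = (\<Sum>l\<in>UNIV. \<Sum>m\<in>UNIV. Q l m * (?b l * ?b m))" unfolding sum_distrib_right[symmetric] Q ..
    finally show ?thesis .
  qed
  also have "(\<Sum>l\<in>UNIV. \<Sum>m\<in>UNIV. Q l m * ((\<Sum>k\<in>UNIV. v $ k * B k l) * (\<Sum>k\<in>UNIV. v $ k * B k m)))
     = (\<Sum>l\<in>UNIV. (\<Sum>k\<in>UNIV. v $ k * B k l)\<^sup>2) + s z * (\<Sum>k\<in>UNIV. v $ k * u k)\<^sup>2" for v
  proof -
    have e: "(\<Sum>l\<in>UNIV. a l * (\<Sum>k\<in>UNIV. v $ k * B k l)) = (\<Sum>k\<in>UNIV. v $ k * u k)"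
      unfolding sum_distrib_left u_def by (subst sum.swap) (simp add: mult_ac)
    have "(\<Sum>m\<in>UNIV. Q l m * ((\<Sum>k\<in>UNIV. v $ k * B k l) * (\<Sum>k\<in>UNIV. v $ k * B k m)))
       = (\<Sum>k\<in>UNIV. v $ k * B k l)\<^sup>2 + (s z * (\<Sum>k\<in>UNIV. v $ k * u k)) * (a l * (\<Sum>k\<in>UNIV. v $ k * B k l))" for l
    proof -
      have "(\<Sum>m\<in>UNIV. a m * (b * c m)) = b * (\<Sum>m\<in>UNIV. a m * c m)" for b and c :: "'n \<Rightarrow> real"
        by (simp add: sum_distrib_left mult_ac)
      then show ?thesis unfolding contrQ e[symmetric] by (simp add: power2_eq_square)
    qed
    then show ?thesis
      by (simp only: sum.distrib sum_distrib_left[symmetric] e) (simp add: power2_eq_square)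
  qed
  finally have row: "(\<Sum>j\<in>UNIV. (hess z v (f j))\<^sup>2) = (\<Sum>l\<in>UNIV. (\<Sum>k\<in>UNIV. v $ k * B k l)\<^sup>2) + s z * (\<Sum>k\<in>UNIV. v $ k * u k)\<^sup>2" for v .
  \<comment> \<open>\<open>row\<close> has contracted the second index of the Hessian with the
    inverse metric; \<open>sq\<close> contracts the first.\<close>
  have sq: "(\<Sum>i\<in>UNIV. (\<Sum>k\<in>UNIV. f i $ k * y k)\<^sup>2) = (\<Sum>k\<in>UNIV. (y k)\<^sup>2) + s z * (\<Sum>k\<in>UNIV. a k * y k)\<^sup>2" for y
  proof -
    have "(\<Sum>i\<in>UNIV. (\<Sum>k\<in>UNIV. f i $ k * y k)\<^sup>2) = (\<Sum>i\<in>UNIV. \<Sum>k\<in>UNIV. \<Sum>l\<in>UNIV. (f i $ k * y k) * (f i $ l * y l))"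
      unfolding power2_eq_square sum_product ..
    also have "\<dots> = (\<Sum>k\<in>UNIV. \<Sum>i\<in>UNIV. \<Sum>l\<in>UNIV. (f i $ k * y k) * (f i $ l * y l))" by (rule sum.swap)
    also have "\<dots> = (\<Sum>k\<in>UNIV. \<Sum>l\<in>UNIV. \<Sum>i\<in>UNIV. (f i $ k * y k) * (f i $ l * y l))" by (intro sum.cong refl sum.swap)
    also have "\<dots> = (\<Sum>k\<in>UNIV. \<Sum>l\<in>UNIV. \<Sum>i\<in>UNIV. (f i $ k * f i $ l) * (y k * y l))" by (simp only: mult_ac)
    also have "\<dots> = (\<Sum>k\<in>UNIV. \<Sum>l\<in>UNIV. Q k l * (y k * y l))" unfolding sum_distrib_right[symmetric] Q ..
    also have "\<dots> = (\<Sum>k\<in>UNIV. y k * y k + (s z * (\<Sum>l\<in>UNIV. a l * y l)) * (a k * y k))"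
    proof (intro sum.cong refl)
      fix k
      have "(\<Sum>l\<in>UNIV. a l * (y k * y l)) = y k * (\<Sum>l\<in>UNIV. a l * y l)"
        by (simp add: sum_distrib_left mult_ac)
      then show "(\<Sum>l\<in>UNIV. Q k l * (y k * y l)) = y k * y k + (s z * (\<Sum>l\<in>UNIV. a l * y l)) * (a k * y k)"
        unfolding contrQ by simp
    qed
    also have "\<dots> = (\<Sum>k\<in>UNIV. (y k)\<^sup>2) + s z * (\<Sum>k\<in>UNIV. a k * y k)\<^sup>2"
      unfolding sum.distrib sum_distrib_left[symmetric] by (simp add: power2_eq_square)
    finally show ?thesis .
  qed
  have "(\<Sum>i\<in>UNIV. \<Sum>j\<in>UNIV. (hess z (f i) (f j))\<^sup>2)
     = (\<Sum>i\<in>UNIV. \<Sum>l\<in>UNIV. (\<Sum>k\<in>UNIV. f i $ k * B k l)\<^sup>2) + s z * (\<Sum>i\<in>UNIV. (\<Sum>k\<in>UNIV. f i $ k * u k)\<^sup>2)"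
    unfolding row by (simp add: sum.distrib sum_distrib_left)
  also have "(\<Sum>i\<in>UNIV. \<Sum>l\<in>UNIV. (\<Sum>k\<in>UNIV. f i $ k * B k l)\<^sup>2) = (\<Sum>l\<in>UNIV. \<Sum>i\<in>UNIV. (\<Sum>k\<in>UNIV. f i $ k * B k l)\<^sup>2)"
    by (rule sum.swap)
  also have "\<dots> = (\<Sum>l\<in>UNIV. (\<Sum>k\<in>UNIV. (B k l)\<^sup>2) + s z * (u l)\<^sup>2)"
    unfolding sq u_def using Bsym by (simp add: mult.commute)
  also have "\<dots> = (\<Sum>l\<in>UNIV. \<Sum>k\<in>UNIV. (B k l)\<^sup>2) + s z * (\<Sum>l\<in>UNIV. (u l)\<^sup>2)"
    by (simp add: sum.distrib sum_distrib_left)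
  also have "(\<Sum>l\<in>UNIV. \<Sum>k\<in>UNIV. (B k l)\<^sup>2) = tr z" unfolding B_def by (subst sum.swap) (simp add: power2_eq_square)
  also have "(\<Sum>i\<in>UNIV. (\<Sum>k\<in>UNIV. f i $ k * u k)\<^sup>2) = (\<Sum>l\<in>UNIV. (u l)\<^sup>2) + s z * \<gamma>\<^sup>2" unfolding sq \<gamma>_def ..
  also have "(\<Sum>l\<in>UNIV. (u l)\<^sup>2) = be z" by (simp add: u_def B_def a_def power2_eq_square)
  also have "\<gamma> = ga z" unfolding \<gamma>_def u_def B_def a_def by (simp add: sum_distrib_left mult.assoc)
  finally show "S (\<xi> z) = (n0 z)\<^sup>2 * (tr z + 2 * s z * be z + (s z)\<^sup>2 * (ga z)\<^sup>2)"
    unfolding f(3) power_mult_distrib sum_distrib_left[symmetric] by (simp add: algebra_simps power2_eq_square)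
qed

end

section \<open>Vanishing of the traceless second fundamental form\<close>

context immersion_normal
begin

lemma metric_eqI:
  assumes p: "p \<in> topspace M" and eq: "\<And>u. induced_metric \<A> x p w u = induced_metric \<A> x p w' u"
  shows "w = w'"
proof -
  have "linear (differential \<A> x p)" by (rule differential_linear[OF p smooth_x])
  then have "induced_metric \<A> x p (w - w') (w - w') = 0"
    using eq[of "w - w'"] by (simp add: induced_metric_def linear_diff lorentz_bilinear)
  then show ?thesis using metric_pos(1)[OF p, of "w - w'"] by fastforce
qed

lemma shape_operator_eqI:
  assumes "p \<in> topspace M" "\<And>u. induced_metric \<A> x p w u = second_fundamental_form \<A> x N p v u"
  shows "shape_operator \<A> x N p v = w"
  unfolding shape_operator_def
proof (rule the_equality)
  show "\<forall>u. induced_metric \<A> x p w u = second_fundamental_form \<A> x N p v u" using assms(2) by blast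
  fix w' assume "\<forall>u. induced_metric \<A> x p w' u = second_fundamental_form \<A> x N p v u"
  then show "w' = w" using metric_eqI[OF assms(1), of w' w] assms(2) by simp
qed

end

context immersion_graph
begin

lemma shrinker_rhs: "\<langle>x (\<xi> z), x (\<xi> z)\<rangle>\<^sub>L * \<langle>x (\<xi> z), N (\<xi> z)\<rangle>\<^sub>L
    = n0 z * (((\<Sum>i\<in>UNIV. z $ i * z $ i) - w z * w z) * ((\<Sum>i\<in>UNIV. z $ i * pd i w z) - w z))"
proof -
  have "z \<bullet> grad z = (\<Sum>i\<in>UNIV. z $ i * pd i w z)" by (simp add: inner_vec_def)
  moreover have "z \<bullet> z = (\<Sum>i\<in>UNIV. z $ i * z $ i)" by (simp add: inner_vec_def)
  ultimately show ?thesis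
    unfolding lorentz_def x_eq normal_fst by (simp add: n0_def[symmetric] algebra_simps)
qed

lemma shrinker_graph:
  assumes "H (\<xi> z) = \<langle>x (\<xi> z), x (\<xi> z)\<rangle>\<^sub>L * \<langle>x (\<xi> z), N (\<xi> z)\<rangle>\<^sub>L"
  shows "(\<Sum>i\<in>UNIV. h i i z) * (1 - al z) + ga z
     = ((\<Sum>i\<in>UNIV. z $ i * z $ i) - w z * w z) * ((\<Sum>i\<in>UNIV. z $ i * pd i w z) - w z) * (1 - al z)"
proof -
  let ?P = "((\<Sum>i\<in>UNIV. z $ i * z $ i) - w z * w z) * ((\<Sum>i\<in>UNIV. z $ i * pd i w z) - w z)"
  have n: "n0 z \<noteq> 0" using n0_sq[of z] by auto
  then have "(\<Sum>i\<in>UNIV. h i i z) + 1 / (1 - al z) * ga z = ?P"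
    using assms unfolding curvatures(1) shrinker_rhs by simp
  moreover have "1 - al z \<noteq> 0" using grad_lt[of z] by (simp add: al_eq)
  moreover have "b + 1 / d * c = e \<Longrightarrow> d \<noteq> 0 \<Longrightarrow> b * d + c = e * d" for b c d e :: real
    by (auto simp: field_simps)
  ultimately show ?thesis by blast
qed

lemma traceless_graph:
  assumes H: "H (\<xi> z) = \<langle>x (\<xi> z), x (\<xi> z)\<rangle>\<^sub>L * \<langle>x (\<xi> z), N (\<xi> z)\<rangle>\<^sub>L"
    and k: "S (\<xi> z) - (H (\<xi> z))\<^sup>2 / real CARD('n) = k"
  shows "tr z * (1 - al z)\<^sup>2 + 2 * be z * (1 - al z) + (ga z)\<^sup>2
     - (((\<Sum>i\<in>UNIV. z $ i * z $ i) - w z * w z) * ((\<Sum>i\<in>UNIV. z $ i * pd i w z) - w z) * (1 - al z))\<^sup>2 / real CARD('n)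
     = k * (1 - al z) ^ 3"
proof -
  define D where "D = 1 - al z"
  define Pz where "Pz = ((\<Sum>i\<in>UNIV. z $ i * z $ i) - w z * w z) * ((\<Sum>i\<in>UNIV. z $ i * pd i w z) - w z)"
  have D: "D \<noteq> 0" using grad_lt[of z] by (simp add: D_def al_eq)
  have nD: "(n0 z)\<^sup>2 * D = 1" using n0_sq[of z] by (simp add: D_def al_eq)
  have HP: "H (\<xi> z) = n0 z * Pz"
    unfolding H Pz_def by (rule shrinker_rhs)
  have "(n0 z)\<^sup>2 * (tr z + 2 * (1 / D) * be z + (1 / D)\<^sup>2 * (ga z)\<^sup>2) - (n0 z)\<^sup>2 * Pz\<^sup>2 / real CARD('n) = k"
    using k unfolding HP curvatures(2) by (simp add: D_def power_mult_distrib)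
  note kD = this
  have "k * D ^ 3 = ((n0 z)\<^sup>2 * D) * (D\<^sup>2 * (tr z + 2 * (1 / D) * be z + (1 / D)\<^sup>2 * (ga z)\<^sup>2) - D\<^sup>2 * Pz\<^sup>2 / real CARD('n))"
  proof -
    have "c * E - c * q / m = k \<Longrightarrow> k * D ^ 3 = (c * D) * (D\<^sup>2 * E - D\<^sup>2 * q / m)" for c E q m k :: real
      by (auto simp: algebra_simps power2_eq_square power3_eq_cube)
    from this[of "(n0 z)\<^sup>2", OF kD] show ?thesis .
  qed
  also have "\<dots> = D\<^sup>2 * (tr z + 2 * (1 / D) * be z + (1 / D)\<^sup>2 * (ga z)\<^sup>2) - D\<^sup>2 * Pz\<^sup>2 / real CARD('n)" unfolding nD by simp
  also have "D\<^sup>2 * (tr z + 2 * (1 / D) * be z + (1 / D)\<^sup>2 * (ga z)\<^sup>2) = tr z * D\<^sup>2 + 2 * be z * D + (ga z)\<^sup>2"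
    using D by (simp add: field_simps power2_eq_square)
  finally show ?thesis unfolding D_def[symmetric] Pz_def[symmetric] by (simp add: power_mult_distrib mult.commute)
qed

text \<open>Where the gradient vanishes, the metric is Euclidean in the parameter and the shape
  operator is \<open>n0\<close> times the Hessian with \<open>n0\<close>^2 = 1. \<open>A\<close> and
  \<open>H\<close> both carry the factor \<open>n0\<close>, so its sign disappears. The test vector
  is \<open>z0\<close>, the tangential part of the position vector.\<close>

lemma traceless_zero_at_critical:
  fixes k :: real
  assumes H: "\<And>z. H (\<xi> z) = \<langle>x (\<xi> z), x (\<xi> z)\<rangle>\<^sub>L * \<langle>x (\<xi> z), N (\<xi> z)\<rangle>\<^sub>L"
    and k: "\<And>z. S (\<xi> z) - (H (\<xi> z))\<^sup>2 / real CARD('n) = k"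
    and crit: "grad z0 = 0"
    and nonneg: "endo_nonneg \<A> x (\<xi> z0) (\<lambda>v. 4 *\<^sub>R shape_operator \<A> x N (\<xi> z0) (shape_operator \<A> x N (\<xi> z0) v)
       - (4 * H (\<xi> z0) / real CARD('n)) *\<^sub>R shape_operator \<A> x N (\<xi> z0) v
       + (S (\<xi> z0) - (H (\<xi> z0))\<^sup>2 / real CARD('n)) *\<^sub>R v)"
  shows "k = 0"
proof -
  let ?A = "shape_operator \<A> x N (\<xi> z0)"
  have gs: "graph_shrinker w k z0"
  proof
    show "pd i w z0 = 0" for i using crit grad_nth[of z0 i] by simp
  qed (rule smooth_w, rule shrinker_graph[OF H], rule traceless_graph[OF H k])
  define B :: "real ^ 'n \<Rightarrow> real ^ 'n" where "B v = (\<chi> i. \<Sum>j\<in>UNIV. pd i (pd j w) z0 * v $ j)" for v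
  have met: "induced_metric \<A> x (\<xi> z0) (\<Lambda> z0 v) (\<Lambda> z0 u) = v \<bullet> u" for v u by (simp add: metric crit)
  have hB: "hess z0 v u = B v \<bullet> u" for v u
  proof -
    have "hess z0 v u = (\<Sum>j\<in>UNIV. \<Sum>i\<in>UNIV. pd j (pd i w) z0 * v $ i * u $ j)"
      unfolding hess_def by (subst sum.swap) (simp add: h_sym mult_ac)
    then show ?thesis by (simp add: B_def inner_vec_def sum_distrib_right)
  qed
  have A: "?A (\<Lambda> z0 v) = \<Lambda> z0 (n0 z0 *\<^sub>R B v)" for v
  proof (rule shape_operator_eqI[OF in_M])
    fix u
    have "induced_metric \<A> x (\<xi> z0) (\<Lambda> z0 (n0 z0 *\<^sub>R B v)) (\<Lambda> z0 (inv (\<Lambda> z0) u))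
      = second_fundamental_form \<A> x N (\<xi> z0) (\<Lambda> z0 v) (\<Lambda> z0 (inv (\<Lambda> z0) u))"
      unfolding met sff hB by simp
    then show "induced_metric \<A> x (\<xi> z0) (\<Lambda> z0 (n0 z0 *\<^sub>R B v)) u = second_fundamental_form \<A> x N (\<xi> z0) (\<Lambda> z0 v) u"
      unfolding surj_\<Lambda> .
  qed
  have "hess z0 v u = hess z0 u v" for v u
    unfolding hess_def by (subst sum.swap) (simp add: h_sym mult_ac)
  then have Bsym: "B v \<bullet> u = v \<bullet> B u" for v u unfolding hB by (simp add: inner_commute)
  have Bscale: "B (c *\<^sub>R v) = c *\<^sub>R B v" for c v by (simp add: B_def vec_eq_iff sum_distrib_left mult_ac)
  have n1: "n0 z0 * n0 z0 = 1" using n0_sq[of z0] by (simp add: crit power2_eq_square)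
  have HP: "H (\<xi> z0) = n0 z0 * (\<Sum>i\<in>UNIV. pd i (pd i w) z0)"
    unfolding curvatures(1) using crit grad_nth[of z0] by (simp add: grad_nth[symmetric] del: grad_nth)
  have scl: "c *\<^sub>R \<Lambda> z0 v = \<Lambda> z0 (c *\<^sub>R v)" "\<Lambda> z0 v + \<Lambda> z0 u = \<Lambda> z0 (v + u)" "\<Lambda> z0 v - \<Lambda> z0 u = \<Lambda> z0 (v - u)" for c v u
    using lin_\<Lambda>[of z0] by (simp_all add: linear_scale linear_add linear_diff)
  have "0 \<le> induced_metric \<A> x (\<xi> z0) (4 *\<^sub>R ?A (?A (\<Lambda> z0 z0)) - (4 * H (\<xi> z0) / real CARD('n)) *\<^sub>R ?A (\<Lambda> z0 z0) + k *\<^sub>R \<Lambda> z0 z0) (\<Lambda> z0 z0)"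
    using nonneg unfolding endo_nonneg_def k by blast
  also have "\<dots> = (4 *\<^sub>R (n0 z0 *\<^sub>R B (n0 z0 *\<^sub>R B z0)) - (4 * H (\<xi> z0) / real CARD('n)) *\<^sub>R (n0 z0 *\<^sub>R B z0) + k *\<^sub>R z0) \<bullet> z0"
    unfolding A scl met ..
  also have "\<dots> = 4 * ((n0 z0 * n0 z0) * (B (B z0) \<bullet> z0)) - 4 * ((n0 z0 * n0 z0) * (\<Sum>i\<in>UNIV. pd i (pd i w) z0)) / real CARD('n) * (B z0 \<bullet> z0) + k * (z0 \<bullet> z0)"
    unfolding Bscale HP by (simp add: inner_add_left inner_diff_left)
  also have "B (B z0) \<bullet> z0 = B z0 \<bullet> B z0" by (rule Bsym)
  finally have "0 \<le> 4 * (B z0 \<bullet> B z0) - 4 * (\<Sum>i\<in>UNIV. pd i (pd i w) z0) / real CARD('n) * (z0 \<bullet> B z0) + k * (z0 \<bullet> z0)"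
    unfolding n1 by (simp add: inner_commute)
  then show "k = 0"
    by (intro graph_shrinker.umbilic_at_p[OF gs]) (simp add: B_def inner_vec_def power2_eq_square)
qed

section \<open>Umbilic points of the graph\<close>

text \<open>Orthogonality to the tangent space makes \<open>Y\<close> a multiple of the normal, and
  the normal is not null.\<close>

lemma orth_zero:
  assumes tan: "\<And>u. \<langle>Y, differential \<A> x (\<xi> z) (\<Lambda> z u)\<rangle>\<^sub>L = 0" and YN: "\<langle>Y, N (\<xi> z)\<rangle>\<^sub>L = 0"
  shows "Y = 0"
proof -
  have "(fst Y - snd Y *\<^sub>R grad z) \<bullet> u = 0" for u
    using tan[of u] unfolding dx by (simp add: lorentz_def inner_diff_left)
  then have Yf: "fst Y = snd Y *\<^sub>R grad z" by (metis eq_iff_diff_eq_0 inner_eq_zero_iff)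
  have "snd Y * (n0 z * (1 - grad z \<bullet> grad z)) = 0"
    using YN unfolding lorentz_def normal_fst Yf by (simp add: n0_def[symmetric] algebra_simps)
  moreover have "n0 z * (1 - grad z \<bullet> grad z) \<noteq> 0" using n0_sq[of z] by auto
  ultimately have "snd Y = 0" by simp
  with Yf show "Y = 0" by (simp add: prod_eq_iff)
qed

lemma umbilic_derivative:
  assumes k: "S (\<xi> z) = (H (\<xi> z))\<^sup>2 / real CARD('n)"
  shows "differential \<A> N (\<xi> z) (\<Lambda> z v) = (H (\<xi> z) / real CARD('n)) *\<^sub>R differential \<A> x (\<xi> z) (\<Lambda> z v)"
proof -
  obtain f :: "'n \<Rightarrow> real ^ 'n" where f: "\<And>i j. f i \<bullet> f j - (grad z \<bullet> f i) * (grad z \<bullet> f j) = (if i = j then 1 else 0)"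
    "H (\<xi> z) = (\<Sum>i\<in>UNIV. n0 z * hess z (f i) (f i))"
    "S (\<xi> z) = (\<Sum>i\<in>UNIV. \<Sum>j\<in>UNIV. (n0 z * hess z (f i) (f j))\<^sup>2)" using frame_some[of z] by auto
  define l where "l = H (\<xi> z) / real CARD('n)"
  define b where "b i j = n0 z * hess z (f i) (f j)" for i j
  have Hl: "H (\<xi> z) = l * real CARD('n)" by (simp add: l_def)
  \<comment> \<open>The squared norm of the traceless part is S - H^2/n. As a sum of squares that
    vanishes, it gives \<open>b\<close> equal to \<open>l\<close> times the identity.\<close>
  have "(\<Sum>i\<in>UNIV. \<Sum>j\<in>UNIV. (b i j - l * (if i = j then 1 else 0))\<^sup>2)
     = (\<Sum>i\<in>UNIV. \<Sum>j\<in>UNIV. (b i j)\<^sup>2 - 2 * l * (b i j * (if i = j then 1 else 0)) + l\<^sup>2 * (if i = j then 1 else 0))"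
    by (intro sum.cong refl) (simp add: power2_eq_square algebra_simps)
  also have "\<dots> = S (\<xi> z) - 2 * l * H (\<xi> z) + l\<^sup>2 * real CARD('n)"
    unfolding f(2,3) b_def[symmetric] sum.distrib sum_subtractf sum_distrib_left[symmetric] sum_delta_mult by simp
  also have "\<dots> = 0" unfolding k Hl by (simp add: power2_eq_square algebra_simps)
  finally have "\<forall>i. (\<Sum>j\<in>UNIV. (b i j - l * (if i = j then 1 else 0))\<^sup>2) = 0"
    by (subst (asm) sum_nonneg_eq_0_iff) (auto intro: sum_nonneg)
  then have bl: "b i j = l * (if i = j then 1 else 0)" for i j
    by (simp add: sum_nonneg_eq_0_iff)
  define Y where "Y = differential \<A> N (\<xi> z) (\<Lambda> z v) - l *\<^sub>R differential \<A> x (\<xi> z) (\<Lambda> z v)"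
  have linx: "linear (differential \<A> x (\<xi> z))" and linN: "linear (differential \<A> N (\<xi> z))"
    by (rule differential_linear[OF in_M smooth_x], rule differential_linear[OF in_M smooth_N])
  have span: "\<exists>c. u = (\<Sum>i\<in>UNIV. c i *\<^sub>R f i)" for u
  proof -
    \<comment> \<open>The metric matrix applied to \<open>u\<close>, so that
      \<open>m \<bullet> f i\<close> is the induced product of \<open>u\<close> with the frame
      vector.\<close>
    define m where "m = u - (grad z \<bullet> u) *\<^sub>R grad z"
    have "(\<Sum>i\<in>UNIV. (m \<bullet> f i) *\<^sub>R f i) $ l = u $ l" for l
    proof -
      have "(\<Sum>i\<in>UNIV. (m \<bullet> f i) *\<^sub>R f i) $ l = (\<Sum>i\<in>UNIV. \<Sum>k\<in>UNIV. m $ k * (f i $ k * f i $ l))"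
        by (simp add: inner_vec_def sum_distrib_right mult.assoc)
      also have "\<dots> = (\<Sum>k\<in>UNIV. m $ k * (\<Sum>i\<in>UNIV. f i $ k * f i $ l))"
        by (subst sum.swap) (simp add: sum_distrib_left)
      also have "\<dots> = (\<Sum>k\<in>UNIV. m $ k * (if k = l then 1 else 0) + m $ k * grad z $ k * (grad z $ l / (1 - grad z \<bullet> grad z)))"
        using frame_completeness[OF f(1) grad_lt] by (simp add: algebra_simps)
      also have "\<dots> = m $ l + (m \<bullet> grad z) * (grad z $ l / (1 - grad z \<bullet> grad z))"
        using sum_delta_mult(1)[of "\<lambda>k. m $ k" l]
        by (simp add: sum.distrib sum_distrib_right sum_divide_distrib inner_vec_def eq_commute)
      also have "m \<bullet> grad z = (grad z \<bullet> u) * (1 - grad z \<bullet> grad z)"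
        by (simp add: m_def inner_diff_left inner_commute algebra_simps)
      finally show ?thesis using grad_lt[of z] by (simp add: m_def)
    qed
    then have "u = (\<Sum>i\<in>UNIV. (m \<bullet> f i) *\<^sub>R f i)" by (simp add: vec_eq_iff)
    then show ?thesis by (rule exI[of _ "\<lambda>i. m \<bullet> f i"])
  qed
  have lin0: "bounded_linear (\<lambda>u. hess z v' u)" "bounded_linear (\<lambda>u. hess z u v')" for v'
    unfolding hess_def by (auto intro!: bounded_linear_sum bounded_linear_intros bounded_linear_const_mult bounded_linear_mult_const bounded_linear_vec_nth)
  have "n0 z * hess z u u' = l * (u \<bullet> u' - (grad z \<bullet> u) * (grad z \<bullet> u'))" for u u'
  proof -
    obtain c d where c: "u = (\<Sum>i\<in>UNIV. c i *\<^sub>R f i)" and d: "u' = (\<Sum>j\<in>UNIV. d j *\<^sub>R f j)" using span by blast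
    interpret h1: bounded_linear "\<lambda>u. hess z u u'" by (rule lin0)
    have inner: "hess z (f i) u' = (\<Sum>j\<in>UNIV. d j * hess z (f i) (f j))" for i
    proof -
      interpret h2: bounded_linear "\<lambda>u. hess z (f i) u" by (rule lin0)
      show ?thesis by (subst d) (simp add: h2.sum h2.scaleR)
    qed
    have "n0 z * hess z u u' = n0 z * (\<Sum>i\<in>UNIV. c i * (\<Sum>j\<in>UNIV. d j * hess z (f i) (f j)))"
      by (subst c) (simp add: h1.sum h1.scaleR inner)
    also have "n0 z * (\<Sum>i\<in>UNIV. c i * (\<Sum>j\<in>UNIV. d j * hess z (f i) (f j))) = (\<Sum>i\<in>UNIV. \<Sum>j\<in>UNIV. c i * d j * b i j)"
      by (simp add: b_def sum_distrib_left mult_ac)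
    also have "\<dots> = l * (\<Sum>i\<in>UNIV. \<Sum>j\<in>UNIV. c i * d j * (f i \<bullet> f j - (grad z \<bullet> f i) * (grad z \<bullet> f j)))"
      unfolding bl f(1) by (simp add: sum_distrib_left mult_ac)
    also have "(\<Sum>i\<in>UNIV. \<Sum>j\<in>UNIV. c i * d j * (f i \<bullet> f j - (grad z \<bullet> f i) * (grad z \<bullet> f j)))
       = u \<bullet> u' - (grad z \<bullet> u) * (grad z \<bullet> u')"
    proof -
      have "u \<bullet> u' = (\<Sum>i\<in>UNIV. \<Sum>j\<in>UNIV. c i * d j * (f i \<bullet> f j))"
        unfolding c d by (subst inner_sum_left, intro sum.cong refl) (simp add: inner_sum_right sum_distrib_left mult_ac)
      moreover have "(grad z \<bullet> u) * (grad z \<bullet> u') = (\<Sum>i\<in>UNIV. \<Sum>j\<in>UNIV. c i * d j * ((grad z \<bullet> f i) * (grad z \<bullet> f j)))"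
        unfolding c d inner_sum_right sum_product by (simp add: mult_ac)
      ultimately show ?thesis by (simp add: right_diff_distrib sum_subtractf)
    qed
    finally show ?thesis .
  qed
  then have tan: "\<langle>Y, differential \<A> x (\<xi> z) (\<Lambda> z u)\<rangle>\<^sub>L = 0" for u
    using sff[of z v u] metric[of z v u]
    by (simp add: Y_def lorentz_bilinear second_fundamental_form_def induced_metric_def)
  \<comment> \<open>Differentiating the unit condition shows that the derivative of \<open>N\<close>
    is tangential.\<close>
  have YN: "\<langle>Y, N (\<xi> z)\<rangle>\<^sub>L = 0"
  proof -
    have D: "((\<lambda>z. N (\<xi> z)) has_derivative (\<lambda>v. differential \<A> N (\<xi> z) (\<Lambda> z v))) (at z)"
      using param_derivative(1)[OF param UNIV_I smooth_N] by (simp add: o_def)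
    note D1 = has_derivative_fst[OF D] and D2 = has_derivative_snd[OF D]
    have "((\<lambda>z. \<langle>N (\<xi> z), N (\<xi> z)\<rangle>\<^sub>L) has_derivative (\<lambda>v. 2 * \<langle>differential \<A> N (\<xi> z) (\<Lambda> z v), N (\<xi> z)\<rangle>\<^sub>L)) (at z)"
      unfolding lorentz_def
      by (rule has_derivative_eq_rhs[OF has_derivative_diff[OF has_derivative_inner[OF D1 D1] has_derivative_mult[OF D2 D2]]])
         (simp add: fun_eq_iff inner_commute algebra_simps)
    moreover have "(\<lambda>z. \<langle>N (\<xi> z), N (\<xi> z)\<rangle>\<^sub>L) = (\<lambda>z. - 1)" using N_unit[OF in_M] by auto
    ultimately have "((\<lambda>z. - 1 :: real) has_derivative (\<lambda>v. 2 * \<langle>differential \<A> N (\<xi> z) (\<Lambda> z v), N (\<xi> z)\<rangle>\<^sub>L)) (at z)" by simp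
    from fun_cong[OF has_derivative_unique[OF this has_derivative_const], of v]
    have "\<langle>differential \<A> N (\<xi> z) (\<Lambda> z v), N (\<xi> z)\<rangle>\<^sub>L = 0" by simp
    then show ?thesis unfolding Y_def using N_orth[OF in_M, of z "\<Lambda> z v"] by (simp add: lorentz_bilinear lorentz_commute)
  qed
  have "Y = 0" by (rule orth_zero[OF tan YN])
  then show ?thesis by (simp add: Y_def l_def)
qed

end

section \<open>Classification of umbilic shrinkers\<close>

text \<open>The reflection in the hyperplane orthogonal to \<open>V - (0, 1)\<close>. This vector is
  not null unless \<open>snd V = 1\<close>, and then \<open>V\<close> is already vertical. A
  past-pointing \<open>V\<close> is covered too, and being an involution the map is its own
  inverse.\<close>

lemma lorentz_reflection:
  fixes V :: "'n::finite lorentz_space"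
  assumes V: "\<langle>V, V\<rangle>\<^sub>L = - 1"
  shows "\<exists>L. linear L \<and> (\<forall>X Y. \<langle>L X, L Y\<rangle>\<^sub>L = \<langle>X, Y\<rangle>\<^sub>L) \<and> (\<forall>X. L (L X) = X) \<and> L V = (0, 1)"
proof (cases "snd V = 1")
  case True
  then have "fst V = 0" using V by (simp add: lorentz_def)
  then have "V = (0, 1)" using True by (simp add: prod_eq_iff)
  then show ?thesis by (intro exI[of _ "\<lambda>X. X"]) (simp add: linear_ident)
next
  case False
  define v where "v = V - (0, 1)"
  define q where "q = \<langle>v, v\<rangle>\<^sub>L"
  have Vv: "\<langle>V, v\<rangle>\<^sub>L = snd V - 1" using V by (simp add: v_def lorentz_bilinear) (simp add: lorentz_def)
  have q: "q = 2 * (snd V - 1)" using V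
    by (simp add: q_def v_def lorentz_bilinear) (simp add: lorentz_def algebra_simps)
  then have q0: "q \<noteq> 0" using False by simp
  define L where "L X = X - (2 * \<langle>X, v\<rangle>\<^sub>L / q) *\<^sub>R v" for X
  have "linear L"
    by (rule linearI) (simp_all add: L_def lorentz_bilinear algebra_simps add_divide_distrib)
  moreover have "\<langle>L X, L Y\<rangle>\<^sub>L = \<langle>X, Y\<rangle>\<^sub>L" for X Y
  proof -
    have "\<langle>L X, L Y\<rangle>\<^sub>L = \<langle>X, Y\<rangle>\<^sub>L - 2 * \<langle>Y, v\<rangle>\<^sub>L / q * \<langle>X, v\<rangle>\<^sub>L - 2 * \<langle>X, v\<rangle>\<^sub>L / q * (\<langle>v, Y\<rangle>\<^sub>L - 2 * \<langle>Y, v\<rangle>\<^sub>L / q * q)"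
      by (simp add: L_def lorentz_bilinear q_def[symmetric] algebra_simps diff_divide_distrib)
    also have "\<langle>v, Y\<rangle>\<^sub>L = \<langle>Y, v\<rangle>\<^sub>L" by (rule lorentz_commute)
    finally show ?thesis using q0 by (simp add: algebra_simps)
  qed
  moreover have "L (L X) = X" for X
  proof -
    have "\<langle>L X, v\<rangle>\<^sub>L = - \<langle>X, v\<rangle>\<^sub>L" using q0 by (simp add: L_def lorentz_bilinear q_def[symmetric])
    then show ?thesis by (simp add: L_def[of "L X"]) (simp add: L_def)
  qed
  moreover have "2 * \<langle>V, v\<rangle>\<^sub>L / q = 1" using q0 unfolding Vv q by simp
  then have "L V = (0, 1)" by (simp only: L_def scaleR_one) (simp add: v_def)
  ultimately show ?thesis by blast
qed

section \<open>Reduction to a vertical normal\<close>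

context immersion_normal
begin

lemma differential_linear_comp:
  assumes L: "bounded_linear L" and f: "smooth_map \<A> f"
  shows "smooth_map \<A> (L \<circ> f)" "p \<in> topspace M \<Longrightarrow> differential \<A> (L \<circ> f) p v = L (differential \<A> f p v)"
proof -
  have "smooth_on (\<phi> ` U) ((L \<circ> f) \<circ> inv_into U \<phi>)" if c: "(U, \<phi>) \<in> \<A>" for U \<phi>
    using k_smooth_on_linear_comp[OF chartD(2)[OF c] L] smooth_in_chart[OF f c]
    unfolding smooth_on_def o_def by blast
  then show "smooth_map \<A> (L \<circ> f)" by (auto simp: smooth_map_def)
  assume "p \<in> topspace M"
  then obtain U \<phi> where c: "chart_at \<A> p = (U, \<phi>)" "(U, \<phi>) \<in> \<A>" "p \<in> U" by (rule chart_atE)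
  have D: "((f \<circ> inv_into U \<phi>) has_derivative differential \<A> f p) (at (\<phi> p))"
    using smooth_imp_has_derivative[OF smooth_in_chart[OF f c(2)], of "\<phi> p"] c by (simp add: differential_def)
  have "(((L \<circ> f) \<circ> inv_into U \<phi>) has_derivative (\<lambda>v. L (differential \<A> f p v))) (at (\<phi> p))"
    using bounded_linear.has_derivative[OF L D] by (simp add: o_def)
  from frechet_derivative_eqI[OF this] show "differential \<A> (L \<circ> f) p v = L (differential \<A> f p v)"
    by (simp add: differential_def c)
qed

text \<open>All data of the hypothesis, including the distance, are unchanged when \<open>x\<close>
  and \<open>N\<close> are composed with the linear isometry \<open>L\<close>. Only the horizontal
  direction changes, so \<open>complete_graph\<close> is applied afresh to the reflected
  immersion.\<close>

lemma traceless_zero: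
  fixes k :: real
  assumes complete: "complete_hypersurface M \<A> x"
    and shrinker: "\<And>p. p \<in> topspace M \<Longrightarrow> H p = \<langle>x p, x p\<rangle>\<^sub>L * \<langle>x p, N p\<rangle>\<^sub>L"
    and k: "\<And>p. p \<in> topspace M \<Longrightarrow> S p - (H p)\<^sup>2 / real CARD('n) = k"
    and nonneg: "\<And>p. p \<in> topspace M \<Longrightarrow> endo_nonneg \<A> x p (\<lambda>v. 4 *\<^sub>R shape_operator \<A> x N p (shape_operator \<A> x N p v)
       - (4 * H p / real CARD('n)) *\<^sub>R shape_operator \<A> x N p v + (S p - (H p)\<^sup>2 / real CARD('n)) *\<^sub>R v)"
  shows "k = 0"
proof -
  obtain p where p: "p \<in> topspace M" using ne by blast
  obtain L :: "'n lorentz_space \<Rightarrow> 'n lorentz_space" where L0: "linear L" "\<forall>X Y. \<langle>L X, L Y\<rangle>\<^sub>L = \<langle>X, Y\<rangle>\<^sub>L" "L (N p) = (0, 1)"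
    using lorentz_reflection[OF N_unit[OF p]] by blast
  then have L: "linear L" "\<And>X Y. \<langle>L X, L Y\<rangle>\<^sub>L = \<langle>X, Y\<rangle>\<^sub>L" "L (N p) = (0, 1)" by blast+
  have bL: "bounded_linear L" using L(1) linear_conv_bounded_linear by blast
  let ?x = "L \<circ> x" and ?N = "L \<circ> N"
  note dx' = differential_linear_comp[OF bL smooth_x] and dN' = differential_linear_comp[OF bL smooth_N]
  have met: "induced_metric \<A> ?x q = induced_metric \<A> x q" if "q \<in> topspace M" for q
    by (intro ext) (simp add: induced_metric_def dx'(2)[OF that] L(2))
  have sff': "second_fundamental_form \<A> ?x ?N q = second_fundamental_form \<A> x N q" if "q \<in> topspace M" for q
    by (intro ext) (simp add: second_fundamental_form_def dx'(2)[OF that] dN'(2)[OF that] L(2))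
  have fr: "orthonormal_frame \<A> ?x q = orthonormal_frame \<A> x q" if "q \<in> topspace M" for q
    by (intro ext) (simp add: orthonormal_frame_def met[OF that])
  have H': "mean_curvature \<A> ?x ?N q = H q" if "q \<in> topspace M" for q
    by (simp add: mean_curvature_def fr[OF that] sff'[OF that])
  have S': "sq_norm_sff \<A> ?x ?N q = S q" if "q \<in> topspace M" for q
    by (simp add: sq_norm_sff_def fr[OF that] sff'[OF that])
  have A': "shape_operator \<A> ?x ?N q = shape_operator \<A> x N q" if "q \<in> topspace M" for q
    by (intro ext) (simp add: shape_operator_def met[OF that] sff'[OF that])
  interpret X: immersion_normal M \<A> ?x ?N
  proof
    have "inj (differential \<A> ?x q)" if q: "q \<in> topspace M" for q
    proof (rule linear_injective_0[THEN iffD2, OF differential_linear[OF q dx'(1)]], intro allI impI)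
      fix v assume "differential \<A> ?x q v = 0"
      then have "induced_metric \<A> ?x q v v = 0" by (simp add: induced_metric_def lorentz_bilinear)
      then show "v = 0" using metric_pos(1)[OF q, of v] met[OF q] by fastforce
    qed
    then show "spacelike_immersion M \<A> ?x"
      using dx'(1) met metric_pos(1) by (auto simp: spacelike_immersion_def)
    show "unit_normal_field M \<A> ?x ?N"
      using dN'(1) dx'(2) N_unit N_orth by (auto simp: unit_normal_field_def L(2))
  qed (rule mfd conn ne)+
  have len: "curve_length \<A> ?x \<gamma> = curve_length \<A> x \<gamma>" if "piecewise_C1_curve M \<A> \<gamma>" for \<gamma>
    unfolding curve_length_def
  proof (rule integral_cong)
    fix t :: real assume "t \<in> {0..1}"
    then have "\<gamma> t \<in> topspace M" using that C1_off_in unfolding piecewise_C1_curve_iff by blast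
    then show "sqrt (induced_metric \<A> ?x (\<gamma> t) (velocity \<A> \<gamma> t) (velocity \<A> \<gamma> t)) = sqrt (induced_metric \<A> x (\<gamma> t) (velocity \<A> \<gamma> t) (velocity \<A> \<gamma> t))"
      by (simp only: met)
  qed
  have "{curve_length \<A> ?x \<gamma> |\<gamma>. piecewise_C1_curve M \<A> \<gamma> \<and> \<gamma> 0 = a \<and> \<gamma> 1 = b}
      = {curve_length \<A> x \<gamma> |\<gamma>. piecewise_C1_curve M \<A> \<gamma> \<and> \<gamma> 0 = a \<and> \<gamma> 1 = b}" for a b
    by (rule Collect_cong, rule ex_cong1) (auto simp: len)
  then have "induced_dist M \<A> ?x = induced_dist M \<A> x" by (intro ext) (simp add: induced_dist_def)
  then have "complete_hypersurface M \<A> ?x" using complete by (simp add: complete_hypersurface_def)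
  then obtain \<xi> where \<xi>: "X.smooth_param UNIV \<xi>" "\<forall>z. X.proj (\<xi> z) = z" "\<forall>p\<in>topspace M. \<xi> (X.proj p) = p"
    using X.complete_graph by blast
  interpret G: immersion_graph M \<A> ?x ?N \<xi>
    by unfold_locales (use \<xi> in auto)
  define z0 where "z0 = X.proj p"
  have z0: "\<xi> z0 = p" using \<xi>(3) p by (simp add: z0_def)
  have "G.n0 z0 *\<^sub>R G.grad z0 = 0" "G.n0 z0 = 1"
    using G.normal_fst[of z0] by (simp_all add: z0 L(3) G.n0_def)
  then have crit: "G.grad z0 = 0" by simp
  show "k = 0"
  proof (rule G.traceless_zero_at_critical[OF _ _ crit])
    show "mean_curvature \<A> ?x ?N (\<xi> z) = \<langle>?x (\<xi> z), ?x (\<xi> z)\<rangle>\<^sub>L * \<langle>?x (\<xi> z), ?N (\<xi> z)\<rangle>\<^sub>L" for z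
      using shrinker[OF G.in_M] by (simp add: H'[OF G.in_M] L(2))
    show "sq_norm_sff \<A> ?x ?N (\<xi> z) - (mean_curvature \<A> ?x ?N (\<xi> z))\<^sup>2 / real CARD('n) = k" for z
      using k[OF G.in_M] by (simp add: H'[OF G.in_M] S'[OF G.in_M])
    show "endo_nonneg \<A> ?x (\<xi> z0)
     (\<lambda>v. 4 *\<^sub>R shape_operator \<A> ?x ?N (\<xi> z0) (shape_operator \<A> ?x ?N (\<xi> z0) v) -
           (4 * mean_curvature \<A> ?x ?N (\<xi> z0) / real CARD('n)) *\<^sub>R shape_operator \<A> ?x ?N (\<xi> z0) v +
           (sq_norm_sff \<A> ?x ?N (\<xi> z0) - (mean_curvature \<A> ?x ?N (\<xi> z0))\<^sup>2 / real CARD('n)) *\<^sub>R v)"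
      using nonneg[OF p] unfolding endo_nonneg_def z0 H'[OF p] S'[OF p] A'[OF p] met[OF p] .
  qed
qed

end

section \<open>Hyperplane or hyperboloid\<close>

context immersion_graph
begin

text \<open>As \<open>L\<close> is an involution, the inverse isometry is
  \<open>Y \<mapsto> L (Y - c)\<close>. Its horizontal part, lifted by \<open>\<xi>\<close>, inverts
  the map to \<open>P\<close>; the assumption \<open>onto\<close> says that points of
  \<open>P\<close> come back to the graph.\<close>

lemma isometric_toI:
  assumes L: "linear L" "\<And>X Y. \<langle>L X, L Y\<rangle>\<^sub>L = \<langle>X, Y\<rangle>\<^sub>L" "\<And>X. L (L X) = X"
    and into: "\<And>z. L (z, w z) + c \<in> P"
    and onto: "\<And>Y. Y \<in> P \<Longrightarrow> snd (L (Y - c)) = w (fst (L (Y - c)))"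
  shows "isometric_to M x P"
proof -
  let ?F = "\<lambda>X. L X + c" and ?F' = "\<lambda>Y. L (Y - c)"
  have bL: "bounded_linear L" using L(1) linear_conv_bounded_linear by blast
  have "lorentz_isometry ?F" unfolding lorentz_isometry_def using L(1,2) by blast
  moreover have "homeomorphic_maps M (top_of_set P) (?F \<circ> x) (\<xi> \<circ> (\<lambda>Y. fst (?F' Y)))"
    unfolding homeomorphic_maps_def
  proof (intro conjI ballI)
    have "continuous_map M euclidean (?F \<circ> x)"
      by (rule continuous_map_compose[OF smooth_map_continuous[OF smooth_x]])
         (auto intro!: continuous_intros bounded_linear.continuous_on[OF bL])
    moreover have "(?F \<circ> x) p \<in> P" if "p \<in> topspace M" for p
    proof -
      have "x p = (proj p, w (proj p))" using x_eq[of "proj p"] \<xi>_proj[OF that] by simp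
      then show ?thesis using into by simp
    qed
    ultimately show "continuous_map M (top_of_set P) (?F \<circ> x)" by (auto simp: continuous_map_in_subtopology)
    show "continuous_map (top_of_set P) M (\<xi> \<circ> (\<lambda>Y. fst (?F' Y)))"
    proof (rule continuous_map_compose)
      show "continuous_map (top_of_set P) euclidean (\<lambda>Y. fst (?F' Y))"
        by (auto intro!: continuous_intros bounded_linear.continuous_on[OF bL])
      show "continuous_map euclidean M \<xi>" using param by (simp add: smooth_param_def)
    qed
    show "(\<xi> \<circ> (\<lambda>Y. fst (?F' Y))) ((?F \<circ> x) p) = p" if "p \<in> topspace M" for p
      using \<xi>_proj[OF that] by (simp add: L(3) proj_def)
    show "(?F \<circ> x) ((\<xi> \<circ> (\<lambda>Y. fst (?F' Y))) Y) = Y" if "Y \<in> topspace (top_of_set P)" for Y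
    proof -
      have "(fst (?F' Y), w (fst (?F' Y))) = ?F' Y" using onto[of Y] that by (simp add: prod_eq_iff)
      then show ?thesis by (simp add: x_eq L(3))
    qed
  qed
  ultimately show ?thesis unfolding isometric_to_def homeomorphic_map_maps by blast
qed

lemma derivative_x: "((\<lambda>z. x (\<xi> z)) has_derivative (\<lambda>v. (v, grad z \<bullet> v))) (at z)"
  using param_derivative(1)[OF param UNIV_I smooth_x] by (simp add: o_def dx)

lemma constantI:
  fixes f :: "real ^ 'n \<Rightarrow> 'b::real_normed_vector"
  assumes "\<And>z. (f has_derivative (\<lambda>v. 0)) (at z)"
  shows "\<exists>c. \<forall>z. f z = c"
  using has_derivative_zero_constant[of UNIV f] assms by auto

lemma lorentz_bounded_linear: "bounded_linear (\<lambda>X. \<langle>X, V\<rangle>\<^sub>L)"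
  unfolding lorentz_def
  by (intro bounded_linear_sub bounded_linear_inner_left_comp bounded_linear_mult_const bounded_linear_fst bounded_linear_snd)

text \<open>Once the principal curvature is a constant \<open>l\<close>, the vector V = N - l x is
  fixed. For \<open>l = 0\<close> it is the constant normal of a hyperplane. For nonzero
  \<open>l\<close> the shrinker equation forces V = 0, which centres the hyperboloid at the
  origin.\<close>

theorem umbilic_shrinker:
  assumes n2: "CARD('n) \<ge> 2"
    and shrinker: "\<And>z. H (\<xi> z) = \<langle>x (\<xi> z), x (\<xi> z)\<rangle>\<^sub>L * \<langle>x (\<xi> z), N (\<xi> z)\<rangle>\<^sub>L"
    and umb: "\<And>z. S (\<xi> z) = (H (\<xi> z))\<^sup>2 / real CARD('n)"
  shows "isometric_to M x (hyperbolic_space (- 1 / sqrt (real CARD('n)))) \<or> isometric_to M x spacelike_hyperplane"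
proof -
  let ?n = "real CARD('n)"
  define lam where "lam z = H (\<xi> z) / ?n" for z
  have DN: "((\<lambda>z. N (\<xi> z)) has_derivative (\<lambda>v. lam z *\<^sub>R (v, grad z \<bullet> v))) (at z)" for z
    using param_derivative(1)[OF param UNIV_I smooth_N] unfolding umbilic_derivative[OF umb] dx
    by (simp add: o_def lam_def)
  define m where "m i z = fst (N (\<xi> z)) $ i" for i z
  have sm: "smooth (m i)" for i
    using smooth_linear_param[OF smooth_N bounded_linear_compose[OF bounded_linear_vec_nth bounded_linear_fst]]
    by (simp add: m_def[abs_def])
  have pm: "pd j (m i) z = (if i = j then lam z else 0)" for i j z
  proof -
    have "(m i has_derivative (\<lambda>v. fst (lam z *\<^sub>R (v, grad z \<bullet> v)) $ i)) (at z)"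
      unfolding m_def[abs_def] by (rule bounded_linear.has_derivative[OF bounded_linear_vec_nth has_derivative_fst[OF DN]])
    from pd_eqI[OF this] show ?thesis by (simp add: axis_def)
  qed
  have lamm: "lam = pd i (m i)" for i using pm[of i i] by auto
  have smlam: "smooth lam" using smooth_pd[OF sm] lamm by metis
  \<comment> \<open>The i-th horizontal coordinate of \<open>N\<close> has derivative
    \<open>lam\<close> along i and zero along every other direction j. Exchanging these two
    derivatives kills the derivative of \<open>lam\<close> along j; a second direction exists
    because \<open>n2\<close> holds.\<close>
  have dlam: "pd j lam = (\<lambda>z. 0)" for j
  proof -
    have "\<exists>i. i \<noteq> j"
    proof (rule ccontr)
      assume "\<not> ?thesis"
      then have "(UNIV :: 'n set) = {j}" by auto
      then have "CARD('n) = card {j}" by (rule arg_cong)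
      then show False using n2 by simp
    qed
    then obtain i where "i \<noteq> j" by blast
    then have "pd j (m i) = (\<lambda>z. 0)" using pm by auto
    then have "pd i (pd j (m i)) = (\<lambda>z. 0)" by simp
    then show ?thesis using pd_commute[OF sm, of j i i] lamm[of i] by simp
  qed
  have "\<exists>l. \<forall>z. lam z = l"
  proof (rule constantI)
    fix z
    have "frechet_derivative lam (at z) = (\<lambda>v. 0)" by (intro ext) (simp add: frechet_pd[OF smlam] dlam)
    then show "(lam has_derivative (\<lambda>v. 0)) (at z)" using smooth_imp_has_derivative[OF smlam UNIV_I] by metis
  qed
  then obtain l where l: "\<And>z. lam z = l" by blast
  have Hl: "H (\<xi> z) = ?n * l" for z using l[of z] by (simp add: lam_def field_simps)
  have DNl: "((\<lambda>z. N (\<xi> z)) has_derivative (\<lambda>v. l *\<^sub>R (v, grad z \<bullet> v))) (at z)" for z using DN l by simp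
  have "\<exists>V. \<forall>z. N (\<xi> z) - l *\<^sub>R x (\<xi> z) = V"
  proof (rule constantI)
    fix z
    show "((\<lambda>z. N (\<xi> z) - l *\<^sub>R x (\<xi> z)) has_derivative (\<lambda>v. 0)) (at z)"
      by (rule has_derivative_eq_rhs[OF has_derivative_diff[OF DNl has_derivative_scaleR_right[OF derivative_x]]]) auto
  qed
  then obtain V where V: "\<And>z. N (\<xi> z) - l *\<^sub>R x (\<xi> z) = V" by blast
  show ?thesis
  proof (cases "l = 0")
    case True
    then have NV: "N (\<xi> z) = V" for z using V by simp
    then have VV: "\<langle>V, V\<rangle>\<^sub>L = - 1" using N_unit[OF in_M] by metis
    obtain L :: "'n lorentz_space \<Rightarrow> 'n lorentz_space" where L0: "linear L" "\<forall>X Y. \<langle>L X, L Y\<rangle>\<^sub>L = \<langle>X, Y\<rangle>\<^sub>L" "\<forall>X. L (L X) = X" "L V = (0, 1)"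
      using lorentz_reflection[OF VV] by blast
    then have L: "linear L" "\<And>X Y. \<langle>L X, L Y\<rangle>\<^sub>L = \<langle>X, Y\<rangle>\<^sub>L" "\<And>X. L (L X) = X" "L V = (0, 1)" by blast+
    have "\<exists>c. \<forall>z. \<langle>x (\<xi> z), V\<rangle>\<^sub>L = c"
    proof (rule constantI)
      fix z
      have "\<langle>(v, grad z \<bullet> v), V\<rangle>\<^sub>L = 0" for v
        using N_orth[OF in_M, of z "\<Lambda> z v"] unfolding dx NV by (simp add: lorentz_commute)
      then show "((\<lambda>z. \<langle>x (\<xi> z), V\<rangle>\<^sub>L) has_derivative (\<lambda>v. 0)) (at z)"
        using bounded_linear.has_derivative[OF lorentz_bounded_linear derivative_x, of V z] by simp
    qed
    then obtain c where c: "\<And>z. \<langle>x (\<xi> z), V\<rangle>\<^sub>L = c" by blast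
    have sndL: "\<langle>X, V\<rangle>\<^sub>L = - snd (L X)" for X
      using L(2)[of X V] unfolding L(4) by (simp add: lorentz_def)
    \<comment> \<open>\<open>L\<close> turns the product with \<open>V\<close> into minus the
      height, so the image of the hypersurface has height - c and is translated by
      \<open>(0, c)\<close>.\<close>
    have "isometric_to M x spacelike_hyperplane"
    proof (rule isometric_toI[OF L(1,2,3)])
      show "L (z, w z) + (0, c) \<in> spacelike_hyperplane" for z
        using c[of z] sndL[of "(z, w z)"] by (simp add: spacelike_hyperplane_def x_eq)
      fix Y :: "'n lorentz_space" assume "Y \<in> spacelike_hyperplane"
      then have Y: "snd Y = 0" by (simp add: spacelike_hyperplane_def)
      let ?X = "L (Y - (0, c))"
      have "\<langle>?X, V\<rangle>\<^sub>L = c" unfolding sndL L(3) by (simp add: Y)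
      moreover have "\<langle>(fst ?X, w (fst ?X)), V\<rangle>\<^sub>L = c" using c[of "fst ?X"] by (simp add: x_eq)
      ultimately have "(snd ?X - w (fst ?X)) * snd V = 0" by (simp add: lorentz_def algebra_simps)
      moreover have "snd V \<noteq> 0"
      proof
        assume "snd V = 0"
        then have "fst V \<bullet> fst V = - 1" using VV by (simp add: lorentz_def)
        then show False using inner_ge_zero[of "fst V"] by linarith
      qed
      ultimately show "snd ?X = w (fst ?X)" by simp
    qed
    then show ?thesis by blast
  next
    case False
    \<comment> \<open>Substituting l x = N - V expresses both factors of the shrinker equation
      through \<open>\<beta>\<close> alone, with constant coefficients.\<close>
    define \<beta> where "\<beta> z = \<langle>N (\<xi> z), V\<rangle>\<^sub>L" for z
    define \<kappa> where "\<kappa> = \<langle>V, V\<rangle>\<^sub>L"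
    have VNb: "\<langle>V, N (\<xi> z)\<rangle>\<^sub>L = \<beta> z" for z unfolding \<beta>_def by (rule lorentz_commute)
    have lx: "l *\<^sub>R x (\<xi> z) = N (\<xi> z) - V" for z unfolding V[of z, symmetric] by simp
    have lxx: "l\<^sup>2 * \<langle>x (\<xi> z), x (\<xi> z)\<rangle>\<^sub>L = \<kappa> - 1 - 2 * \<beta> z" for z
    proof -
      have "l\<^sup>2 * \<langle>x (\<xi> z), x (\<xi> z)\<rangle>\<^sub>L = \<langle>l *\<^sub>R x (\<xi> z), l *\<^sub>R x (\<xi> z)\<rangle>\<^sub>L"
        by (simp add: lorentz_bilinear power2_eq_square)
      also have "\<dots> = \<langle>N (\<xi> z), N (\<xi> z)\<rangle>\<^sub>L - \<beta> z - (\<langle>V, N (\<xi> z)\<rangle>\<^sub>L - \<kappa>)"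
        unfolding lx by (simp add: lorentz_bilinear \<beta>_def \<kappa>_def)
      finally show ?thesis unfolding N_unit[OF in_M] VNb by simp
    qed
    have lxN: "l * \<langle>x (\<xi> z), N (\<xi> z)\<rangle>\<^sub>L = - 1 - \<beta> z" for z
    proof -
      have "l * \<langle>x (\<xi> z), N (\<xi> z)\<rangle>\<^sub>L = \<langle>l *\<^sub>R x (\<xi> z), N (\<xi> z)\<rangle>\<^sub>L" by (simp add: lorentz_bilinear)
      then show ?thesis unfolding lx using N_unit[OF in_M, of z] VNb[of z] by (simp add: lorentz_bilinear)
    qed
    have quad: "?n * l ^ 4 = (\<kappa> - 1 - 2 * \<beta> z) * (- 1 - \<beta> z)" for z
    proof -
      have "?n * l ^ 4 = l ^ 3 * H (\<xi> z)" unfolding Hl by (simp add: power4_eq_xxxx power3_eq_cube)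
      also have "\<dots> = (l\<^sup>2 * \<langle>x (\<xi> z), x (\<xi> z)\<rangle>\<^sub>L) * (l * \<langle>x (\<xi> z), N (\<xi> z)\<rangle>\<^sub>L)"
        unfolding shrinker by (simp add: power3_eq_cube power2_eq_square)
      finally show ?thesis unfolding lxx lxN .
    qed
    \<comment> \<open>The two roots of the quadratic \<open>quad\<close> add up to (\<kappa> - 3)/2,
      so they are \<open>\<beta> 0\<close> and the second listed value. A continuous function with
      finitely many values on a connected space is constant.\<close>
    have "\<beta> ` UNIV \<subseteq> {\<beta> 0, (\<kappa> - 3) / 2 - \<beta> 0}"
    proof (rule image_subsetI)
      fix z
      have "(\<beta> z - \<beta> 0) * (2 * (\<beta> z + \<beta> 0) - (\<kappa> - 3)) = 0"
        using quad[of z] quad[of 0] by (simp add: algebra_simps)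
      then have "\<beta> z - \<beta> 0 = 0 \<or> 2 * (\<beta> z + \<beta> 0) - (\<kappa> - 3) = 0" by (simp only: mult_eq_0_iff)
      then have "\<beta> z = \<beta> 0 \<or> \<beta> z = (\<kappa> - 3) / 2 - \<beta> 0" by (rule disj_forward) (simp, argo)
      then show "\<beta> z \<in> {\<beta> 0, (\<kappa> - 3) / 2 - \<beta> 0}" by blast
    qed
    then have "finite (\<beta> ` UNIV)" by (rule finite_subset) simp
    moreover have D\<beta>: "(\<beta> has_derivative (\<lambda>v. \<langle>l *\<^sub>R (v, grad z \<bullet> v), V\<rangle>\<^sub>L)) (at z)" for z
      unfolding \<beta>_def[abs_def] by (rule bounded_linear.has_derivative[OF lorentz_bounded_linear DNl])
    then have "continuous_on UNIV \<beta>"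
      by (intro continuous_at_imp_continuous_on ballI has_derivative_continuous[OF D\<beta>])
    ultimately have "\<beta> constant_on UNIV" by (intro continuous_finite_range_constant) (auto simp: connected_UNIV)
    then obtain b where b: "\<beta> = (\<lambda>z. b)" unfolding constant_on_def by auto
    have Vtan: "\<langle>V, differential \<A> x (\<xi> z) (\<Lambda> z u)\<rangle>\<^sub>L = 0" for z u
    proof -
      have "(\<lambda>v. \<langle>l *\<^sub>R (v, grad z \<bullet> v), V\<rangle>\<^sub>L) = (\<lambda>v. 0)"
        using has_derivative_unique[OF D\<beta>[of z, unfolded b] has_derivative_const] .
      from fun_cong[OF this, of u] have "\<langle>(u, grad z \<bullet> u), V\<rangle>\<^sub>L = 0"
        using False by (simp only: lorentz_bilinear mult_eq_0_iff) simp
      then show ?thesis unfolding dx by (subst lorentz_commute)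
    qed
    have VN: "V + b *\<^sub>R N (\<xi> z) = 0" for z
    proof (rule orth_zero)
      show "\<langle>V + b *\<^sub>R N (\<xi> z), differential \<A> x (\<xi> z) (\<Lambda> z u)\<rangle>\<^sub>L = 0" for u
        by (simp add: lorentz_bilinear Vtan N_orth[OF in_M])
      show "\<langle>V + b *\<^sub>R N (\<xi> z), N (\<xi> z)\<rangle>\<^sub>L = 0"
        using fun_cong[OF b, of z] N_unit[OF in_M, of z] VNb[of z] by (simp add: lorentz_bilinear)
    qed
    \<comment> \<open>Since V = - b N is constant while \<open>N\<close> has derivative l dx with
      \<open>l\<close> nonzero, \<open>b\<close> must vanish.\<close>
    have "((\<lambda>z. V + b *\<^sub>R N (\<xi> z)) has_derivative (\<lambda>v. b *\<^sub>R (l *\<^sub>R (v, grad 0 \<bullet> v)))) (at 0)"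
      by (rule has_derivative_eq_rhs[OF has_derivative_add[OF has_derivative_const has_derivative_scaleR_right[OF DNl]]]) simp
    then have "((\<lambda>z. 0) has_derivative (\<lambda>v. b *\<^sub>R (l *\<^sub>R (v, grad 0 \<bullet> v)))) (at 0)" unfolding VN .
    from fun_cong[OF has_derivative_unique[OF this has_derivative_const], of "axis undefined 1"]
    have b0: "b = 0" using False by (simp add: prod_eq_iff)
    then have V0: "V = 0" using VN[of 0] by simp
    \<comment> \<open>With V = 0 we have N = l x, so the square of x is - 1/l^2; the shrinker
      equation then fixes l^2 = 1/sqrt n, the source of the radius in the conclusion.\<close>
    have "?n * l ^ 4 = 1" using quad[of 0] by (simp add: b b0 \<kappa>_def V0 lorentz_bilinear)
    then have "(sqrt ?n * l\<^sup>2)\<^sup>2 = 1\<^sup>2" by (simp add: power_mult_distrib flip: power_mult)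
    then have l2: "sqrt ?n * l\<^sup>2 = 1" by (rule power2_eq_imp_eq) auto
    have "\<langle>x (\<xi> z), x (\<xi> z)\<rangle>\<^sub>L = - sqrt ?n" for z
    proof -
      have "l\<^sup>2 * \<langle>x (\<xi> z), x (\<xi> z)\<rangle>\<^sub>L = - 1" using lxx[of z] by (simp add: b b0 \<kappa>_def V0 lorentz_bilinear)
      then have "sqrt ?n * l\<^sup>2 * \<langle>x (\<xi> z), x (\<xi> z)\<rangle>\<^sub>L = - sqrt ?n" by (simp add: mult.assoc)
      then show ?thesis unfolding l2 by simp
    qed
    then have w2: "(w z)\<^sup>2 = z \<bullet> z + sqrt ?n" for z by (simp add: x_eq lorentz_def power2_eq_square algebra_simps)
    have n0: "sqrt ?n > 0" by simp
    have wnz: "w z \<noteq> 0" for z using w2[of z] n0 inner_ge_zero[of z] by (metis add_nonneg_pos less_irrefl zero_power2)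
    \<comment> \<open>The graph lies on one of the two sheets, as \<open>w\<close> is continuous
      without zeros. The central reflection brings the lower sheet to the upper one.\<close>
    have "\<exists>\<sigma>\<in>{1, - 1}. \<forall>z. \<sigma> * w z > 0"
    proof (rule ccontr)
      assume "\<not> ?thesis"
      then obtain z1 z2 where "w z1 \<le> 0" "w z2 \<ge> 0" by (auto simp: not_less)
      moreover have "is_interval (w ` UNIV)"
        unfolding is_interval_connected_1
        by (rule connected_continuous_image) (use smooth_w in \<open>auto simp: smooth_on_def dest: spec[of _ 0]\<close>)
      ultimately have "0 \<in> w ` UNIV" unfolding is_interval_1 by blast
      then show False using wnz by auto
    qed
    then obtain \<sigma> where \<sigma>: "\<sigma> = 1 \<or> \<sigma> = - 1" "\<And>z. \<sigma> * w z > 0" by blast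
    then have ss: "\<sigma> * \<sigma> = 1" by auto
    have "isometric_to M x (hyperbolic_space (- 1 / sqrt ?n))"
    proof (rule isometric_toI[where L = "\<lambda>X. \<sigma> *\<^sub>R X" and c = 0])
      show "linear (\<lambda>X. \<sigma> *\<^sub>R X)" by (simp add: linear_scaleR)
      show "\<langle>\<sigma> *\<^sub>R X, \<sigma> *\<^sub>R Y\<rangle>\<^sub>L = \<langle>X, Y\<rangle>\<^sub>L" "\<sigma> *\<^sub>R \<sigma> *\<^sub>R X = X" for X Y :: "'n lorentz_space"
        using ss by (simp_all add: lorentz_bilinear flip: mult.assoc)
      show "\<sigma> *\<^sub>R (z, w z) + 0 \<in> hyperbolic_space (- 1 / sqrt ?n)" for z
      proof -
        have "\<langle>\<sigma> *\<^sub>R (z, w z), \<sigma> *\<^sub>R (z, w z)\<rangle>\<^sub>L = \<langle>(z, w z), (z, w z)\<rangle>\<^sub>L"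
          using ss by (simp only: lorentz_bilinear mult_1 flip: mult.assoc)
        also have "\<dots> = - sqrt ?n" using w2[of z] by (simp add: lorentz_def power2_eq_square)
        finally show ?thesis using \<sigma>(2)[of z] by (simp add: hyperbolic_space_def)
      qed
      fix Y :: "'n lorentz_space" assume "Y \<in> hyperbolic_space (- 1 / sqrt ?n)"
      then have Y: "\<langle>Y, Y\<rangle>\<^sub>L = - sqrt ?n" "snd Y > 0" by (simp_all add: hyperbolic_space_def)
      have "(\<sigma> * w (\<sigma> *\<^sub>R fst Y))\<^sup>2 = (w (\<sigma> *\<^sub>R fst Y))\<^sup>2" using ss by (simp add: power2_eq_square mult_ac) 
      also have "\<dots> = (\<sigma> * \<sigma>) * (fst Y \<bullet> fst Y) + sqrt ?n" unfolding w2 by simp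
      also have "\<dots> = (snd Y)\<^sup>2" using Y(1) by (simp add: ss lorentz_def power2_eq_square)
      finally have "\<sigma> * w (\<sigma> *\<^sub>R fst Y) = snd Y"
        by (rule power2_eq_imp_eq) (use \<sigma>(2) Y(2) in \<open>auto simp: less_imp_le\<close>)
      then have "\<sigma> * (\<sigma> * w (\<sigma> *\<^sub>R fst Y)) = \<sigma> * snd Y" by simp
      then show "snd (\<sigma> *\<^sub>R (Y - 0)) = w (fst (\<sigma> *\<^sub>R (Y - 0)))" using ss by (simp flip: mult.assoc)
    qed
    then show ?thesis by blast
  qed
qed

end

theorem corollary1p7:
  fixes M :: "'m topology"
    and \<A> :: "('m, 'n::finite) chart set"
    and x N :: "'m \<Rightarrow> 'n lorentz_space"
  defines "n \<equiv> real CARD('n)"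
    and "H \<equiv> mean_curvature \<A> x N"
    and "S \<equiv> sq_norm_sff \<A> x N"
    and "A \<equiv> shape_operator \<A> x N"
  assumes "CARD('n) \<ge> 2"
    and "smooth_manifold M \<A>" and "connected_space M" and "topspace M \<noteq> {}"
    and "spacelike_immersion M \<A> x" and "complete_hypersurface M \<A> x"
    and "unit_normal_field M \<A> x N"
    and "\<forall>p\<in>topspace M. H p - \<langle>x p, x p\<rangle>\<^sub>L * \<langle>x p, N p\<rangle>\<^sub>L = 0"
    and "\<exists>k. \<forall>p\<in>topspace M. S p - (H p)\<^sup>2 / n = k"
    and "\<forall>p\<in>topspace M. endo_nonneg \<A> x p
           (\<lambda>v. 4 *\<^sub>R A p (A p v) - (4 * H p / n) *\<^sub>R A p v + (S p - (H p)\<^sup>2 / n) *\<^sub>R v)"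
  shows "isometric_to M x (hyperbolic_space (- 1 / sqrt n)) \<or>
         isometric_to M x spacelike_hyperplane"
proof -
  interpret immersion_normal M \<A> x N
    by unfold_locales (fact assms)+
  have shrinker: "H p = \<langle>x p, x p\<rangle>\<^sub>L * \<langle>x p, N p\<rangle>\<^sub>L" if "p \<in> topspace M" for p
    using assms(12) that by simp
  obtain k where k: "\<And>p. p \<in> topspace M \<Longrightarrow> S p - (H p)\<^sup>2 / n = k" using assms(13) by blast
  have "k = 0"
    by (rule traceless_zero[OF assms(10) shrinker[unfolded H_def] k[unfolded H_def S_def n_def]])
      (use assms(14) in \<open>auto simp: H_def S_def A_def n_def\<close>)
  obtain \<xi> where \<xi>: "smooth_param UNIV \<xi>" "\<forall>z. proj (\<xi> z) = z" "\<forall>p\<in>topspace M. \<xi> (proj p) = p"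
    using complete_graph[OF assms(10)] by blast
  interpret immersion_graph M \<A> x N \<xi> by unfold_locales (use \<xi> in auto)
  show ?thesis unfolding n_def
  proof (rule umbilic_shrinker[OF assms(5)])
    show "mean_curvature \<A> x N (\<xi> z) = \<langle>x (\<xi> z), x (\<xi> z)\<rangle>\<^sub>L * \<langle>x (\<xi> z), N (\<xi> z)\<rangle>\<^sub>L" for z
      using shrinker[OF in_M] by (simp add: H_def)
    show "sq_norm_sff \<A> x N (\<xi> z) = (mean_curvature \<A> x N (\<xi> z))\<^sup>2 / real CARD('n)" for z
      using k[OF in_M, of z] \<open>k = 0\<close> by (simp add: H_def S_def n_def)
  qed
qed

end
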